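(* Let $p\ge 1$ be an integer, let $0<m\le M$ be constants, and let $f:\mathbb{R}^p\to\mathbb{R}$ be a differentiable function satisfying, for all $\theta,\theta'\in\mathbb{R}^p$, $$f(\theta)-f(\theta')-\nabla f(\theta')^\top(\theta-\theta')\ge \tfrac{m}{2}\|\theta-\theta'\|_2^2,\qquad \|\nabla f(\theta)-\nabla f(\theta')\|_2\le M\|\theta-\theta'\|_2 .$$ Let $\pi$ be the probability measure on $\mathbb{R}^p$ with density $\pi(\theta)=e^{-f(\theta)}/\int_{\mathbb{R}^p}e^{-f(u)}\,du$. Let $h\in(0,2/M)$, and let $(\vartheta^{(k,h)})_{k\ge 0}$ be the Langevin Monte Carlo sequence $$\vartheta^{(k+1,h)}=\vartheta^{(k,h)}-h\nabla f(\vartheta^{(k,h)})+\sqrt{2h}\,\xi^{(k+1)},\qquad k=0,1,2,\ldots,$$ started from a (deterministic or random) point $\vartheta^{(0,h)}=\vartheta^{(0)}\in\mathbb{R}^p$, where $\xi^{(1)},\xi^{(2)},\ldots$ are mutually independent, and independent of $\vartheta^{(0)}$, centered Gaussian vectors in $\mathbb{R}^p$ with identity covariance matrix. Let $\nu_k$ be the distribution of $\vartheta^{(k,h)}$. Then for every integer $K\ge 0$: (a) If $h\le \frac{2}{m+M}$, then $$W_2(\nu_K,\pi)\le (1-mh)^K\,W_2(\nu_0,\pi)+1.82\,\frac{M}{m}\,(hp)^{1/2}.$$ (b) If $h\ge \frac{2}{m+M}$, then $$W_2(\nu_K,\pi)\le (Mh-1)^K\,W_2(\nu_0,\pi)+1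.82\,\frac{Mh}{2-Mh}\,(hp)^{1/2}.$$
   Context: $\|\cdot\|_2$ is the Euclidean norm on $\mathbb{R}^p$. For two probability measures $\mu,\nu$ on the Borel sets of $\mathbb{R}^p$, the Wasserstein distance is $$W_2(\mu,\nu)=\Big(\inf_{\gamma\in\Gamma(\mu,\nu)}\int_{\mathbb{R}^p\times\mathbb{R}^p}\|\theta-\theta'\|_2^2\,d\gamma(\theta,\theta')\Big)^{1/2},$$ where $\Gamma(\mu,\nu)$ is the set of joint distributions on $\mathbb{R}^p\times\mathbb{R}^p$ with marginals $\mu$ and $\nu$. *)

theory Defs
  imports "HOL-Probability.Probability"
begin

definition couplings ::
    "'a::euclidean_space measure \<Rightarrow> 'a measure \<Rightarrow> ('a \<times> 'a) measure set" where
  "couplings \<mu> \<nu> =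
     {\<gamma>. prob_space \<gamma> \<and> sets \<gamma> = sets (borel \<Otimes>\<^sub>M borel) \<and>
         distr \<gamma> borel fst = \<mu> \<and> distr \<gamma> borel snd = \<nu>}"

definition ennsqrt :: "ennreal \<Rightarrow> ennreal" where
  "ennsqrt x = (if x = \<top> then \<top> else ennreal (sqrt (enn2real x)))"

text \<open>The distance is extended-valued: it is infinite when no coupling has finite quadratic
  cost, which can happen when one of the measures has no second moment.\<close>

definition wasserstein2 :: "'a::euclidean_space measure \<Rightarrow> 'a measure \<Rightarrow> ennreal" where
  "wasserstein2 \<mu> \<nu> =
     ennsqrt (INF \<gamma>\<in>couplings \<mu> \<nu>. \<integral>\<^sup>+ z. ennreal ((norm (fst z - snd z))\<^sup>2) \<partial>\<gamma>)"

text \<open>Density of a non-degenerate Gaussian vector with mean \<open>\<mu>\<close> and (symmetric positive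
  definite) covariance matrix \<open>\<Sigma>\<close>.\<close>

definition mvnormal_density :: "real ^ 'p \<Rightarrow> real ^ 'p ^ 'p \<Rightarrow> real ^ 'p \<Rightarrow> real" where
  "mvnormal_density \<mu> \<Sigma> x =
     exp (- ((x - \<mu>) \<bullet> (matrix_inv \<Sigma> *v (x - \<mu>))) / 2) / sqrt ((2 * pi) ^ CARD('p) * det \<Sigma>)"

lemma mvnormal_density_standard:
  "mvnormal_density 0 (mat 1) (x :: real ^ 'p) =
     exp (- (norm x)\<^sup>2 / 2) / sqrt ((2 * pi) ^ CARD('p))"
proof -
  have "matrix_inv (mat 1 :: real ^ 'p ^ 'p) = mat 1"
    unfolding matrix_inv_def by (rule some_equality) simp_all
  then show ?thesis
    by (simp add: mvnormal_density_def power2_norm_eq_inner)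
qed

text \<open>If \<open>exp (- f)\<close> is not integrable, the normalising integral is \<open>0\<close> by convention and this is
  the null measure. Strong convexity of \<open>f\<close> excludes that case.\<close>

definition gibbs_measure :: "('a::euclidean_space \<Rightarrow> real) \<Rightarrow> 'a measure" where
  "gibbs_measure f =
     density lborel (\<lambda>\<theta>. ennreal (exp (- f \<theta>) / (\<integral>u. exp (- f u) \<partial>lborel)))"

end

theory Submission
  imports Defs
begin

text \<open>
  Write \<open>T x = x - h \<nabla>f(x)\<close>. On the given range of \<open>h\<close> the map \<open>T\<close> is Lipschitz with
  constant \<open>\<rho> = max (1 - m h) (M h - 1) < 1\<close>, because \<open>f - m/2 \<parallel>\<cdot>\<parallel>\<^sup>2\<close> is convex with an
  \<open>(M - m)\<close>-Lipschitz, hence co-coercive, gradient (\<open>gradient_step_contraction\<close>). Let \<open>(x, v\<^sub>0)\<close> be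
  a coupling of \<open>\<nu>\<^sub>k\<close> and \<open>\<pi>\<close>. If \<open>v\<^sub>0\<close> can be moved to a point
  \<open>v = T v\<^sub>0 + sqrt (2 h) \<xi> + r\<close> that is again distributed according to \<open>\<pi>\<close>, where \<open>\<xi>\<close> is the Gaussian
  vector that drives the chain, then the chain point \<open>T x + sqrt (2 h) \<xi>\<close> is at \<open>L\<^sup>2\<close>-distance at most
  \<open>\<rho> \<parallel>x - v\<^sub>0\<parallel> + \<parallel>r\<parallel>\<close> from \<open>v\<close>. With \<open>\<parallel>r\<parallel> \<le> 1.82 M h sqrt (h p)\<close> the theorem follows by iteration,
  since \<open>1 - \<rho>\<close> is \<open>m h\<close> or \<open>2 - M h\<close>.

  The classical choice of \<open>v\<close> is the stationary Langevin diffusion at time \<open>h\<close>, which needs stochastic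
  calculus. Here \<open>v\<close> is the end of a random-walk Metropolis chain of \<open>n\<close> tiny steps: propose
  \<open>v\<^sub>j + s z\<close> with \<open>z\<close> standard Gaussian and \<open>s = sqrt (2 h / n)\<close>, and accept with probability
  \<open>min 1 (exp (f(v\<^sub>j) - f(v\<^sub>j + s z)))\<close>. Each step is an explicit function of \<open>v\<^sub>j\<close>, \<open>z\<close> and a uniform
  variable, it preserves \<open>\<pi>\<close> exactly (\<open>metropolis_invariant\<close>), and the sum of the increments \<open>s z\<close>
  has the law of \<open>sqrt (2 h) \<xi>\<close>. Compared with an Euler step of length \<open>s\<^sup>2/2 = h/n\<close>, rejection
  causes an error whose mean square and whose conditional mean are both \<open>O(s\<^sup>3)\<close>
  (\<open>metropolis_drift\<close>); the errors are therefore almost orthogonal, and over \<open>n = 2 h / s\<^sup>2\<close> steps they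
  accumulate to a mean square of order \<open>s\<close> (\<open>walk_error_bound\<close>), which vanishes as \<open>n\<close> grows.

  What remains of \<open>r\<close> is \<open>(h/n) \<Sum>\<^sub>j (\<nabla>f(v\<^sub>0) - \<nabla>f(v\<^sub>j))\<close>. Its norm is at most \<open>M h/n\<close> times the sum of
  the displacements \<open>\<parallel>v\<^sub>j - v\<^sub>0\<parallel>\<close>. At time \<open>t = j h / n\<close> the displacement is at most
  \<open>sqrt (2 t p) + t sqrt (M p)\<close> up to a vanishing error, because integration by parts gives \<open>E \<parallel>\<nabla>f\<parallel>\<^sup>2 \<le> M p\<close> under \<open>\<pi>\<close>. Integrating over \<open>t \<le> h\<close> and using \<open>M h \<le> 2\<close>
  yields \<open>(2/3 + 1/2) sqrt 2 M h sqrt (h p)\<close>, and \<open>7/6 sqrt 2 < 1.66\<close> leaves room below \<open>1.82\<close> for the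
  error that vanishes (\<open>walk_endpoint\<close>).
\<close>

section \<open>The quadratic norm of a random vector and quadratic couplings\<close>

text \<open>The norm is extended-valued, because the initial law of the chain may lack a second moment.\<close>

definition l2norm :: "'b measure \<Rightarrow> ('b \<Rightarrow> 'a::euclidean_space) \<Rightarrow> ennreal" where
  "l2norm Q F = ennsqrt (\<integral>\<^sup>+ x. ennreal ((norm (F x))\<^sup>2) \<partial>Q)"

lemma ennsqrt_ennreal: "0 \<le> r \<Longrightarrow> ennsqrt (ennreal r) = ennreal (sqrt r)"
  by (simp add: ennsqrt_def)

lemma ennsqrt_top: "ennsqrt \<top> = \<top>"
  by (simp add: ennsqrt_def)

text \<open>The form in which the square root is used: it turns a bound on an \<open>L\<^sup>2\<close>-norm into a bound on an
  integral, also when one side is infinite.\<close>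

lemma ennsqrt_le_iff: "ennsqrt x \<le> y \<longleftrightarrow> x \<le> y\<^sup>2"
proof (cases x)
  case (real r)
  show ?thesis
  proof (cases y)
    case y: (real t)
    have "sqrt r \<le> t \<longleftrightarrow> r \<le> t\<^sup>2"
      using real y by (metis real_le_lsqrt real_sqrt_le_iff real_sqrt_unique)
    then show ?thesis using real y by (simp add: ennsqrt_ennreal ennreal_power)
  qed (use real in \<open>simp add: ennsqrt_ennreal ennreal_top_mult power2_eq_square\<close>)
next
  case top
  then show ?thesis by (cases y) (simp_all add: ennsqrt_top ennreal_power top_unique power2_eq_square ennreal_mult_eq_top_iff)
qed

lemma ennsqrt_power2: "(ennsqrt x)\<^sup>2 = x"
  by (cases x) (simp_all add: ennsqrt_ennreal ennsqrt_top ennreal_power power2_eq_square flip: ennreal_mult)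

lemma ennsqrt_mono: "x \<le> y \<Longrightarrow> ennsqrt x \<le> ennsqrt y"
  by (simp add: ennsqrt_le_iff ennsqrt_power2)

lemma l2norm_le_iff: "l2norm Q F \<le> c \<longleftrightarrow> (\<integral>\<^sup>+ x. ennreal ((norm (F x))\<^sup>2) \<partial>Q) \<le> c\<^sup>2"
  by (simp add: l2norm_def ennsqrt_le_iff)

lemma l2norm_mono:
  assumes "0 \<le> c" and "\<And>x. x \<in> space Q \<Longrightarrow> norm (F x) \<le> c * norm (G x)"
    and [measurable]: "G \<in> borel_measurable Q"
  shows "l2norm Q F \<le> ennreal c * l2norm Q G"
  unfolding l2norm_le_iff power_mult_distrib
proof -
  have "(\<integral>\<^sup>+ x. ennreal ((norm (F x))\<^sup>2) \<partial>Q) \<le> (\<integral>\<^sup>+ x. ennreal (c\<^sup>2) * ennreal ((norm (G x))\<^sup>2) \<partial>Q)"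
    using power_mono[OF assms(2), of _ 2] assms(1)
    by (intro nn_integral_mono) (simp add: power_mult_distrib flip: ennreal_mult)
  also have "\<dots> = (ennreal c)\<^sup>2 * (l2norm Q G)\<^sup>2"
    using assms(1) by (simp add: nn_integral_cmult l2norm_def ennsqrt_power2 ennreal_power)
  finally show "(\<integral>\<^sup>+ x. ennreal ((norm (F x))\<^sup>2) \<partial>Q) \<le> (ennreal c)\<^sup>2 * (l2norm Q G)\<^sup>2" .
qed

lemma l2norm_scaleR:
  assumes [measurable]: "F \<in> borel_measurable Q"
  shows "l2norm Q (\<lambda>x. c *\<^sub>R F x) \<le> ennreal \<bar>c\<bar> * l2norm Q F"
  by (rule l2norm_mono) auto

lemma l2norm_minus: "l2norm Q (\<lambda>x. - F x) = l2norm Q F"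
  by (simp add: l2norm_def)

lemma l2norm_triangle:
  assumes [measurable]: "F \<in> borel_measurable Q" "G \<in> borel_measurable Q"
  shows "l2norm Q (\<lambda>x. F x + G x) \<le> l2norm Q F + l2norm Q G"
  unfolding l2norm_le_iff
proof -
  define A where "A = (\<integral>\<^sup>+ x. ennreal ((norm (F x))\<^sup>2) \<partial>Q)"
  define B where "B = (\<integral>\<^sup>+ x. ennreal ((norm (G x))\<^sup>2) \<partial>Q)"
  define D where "D = (\<integral>\<^sup>+ x. ennreal (norm (F x)) * ennreal (norm (G x)) \<partial>Q)"
  have CS: "D \<le> l2norm Q F * l2norm Q G"
  proof -
    have "D\<^sup>2 \<le> A * B"
      unfolding A_def B_def D_def
      using Cauchy_Schwarz_nn_integral[of "\<lambda>x. ennreal (norm (F x))" Q "\<lambda>x. ennreal (norm (G x))"]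
      by (simp add: ennreal_power)
    also have "\<dots> = (l2norm Q F * l2norm Q G)\<^sup>2"
      by (simp add: power_mult_distrib l2norm_def ennsqrt_power2 A_def B_def)
    finally have "ennsqrt (D\<^sup>2) \<le> l2norm Q F * l2norm Q G"
      by (simp add: ennsqrt_le_iff)
    moreover have "ennsqrt (D\<^sup>2) = D"
      by (cases D) (simp_all add: ennreal_power ennsqrt_ennreal ennsqrt_top power2_eq_square flip: ennreal_mult)
    ultimately show ?thesis by simp
  qed
  have "(\<integral>\<^sup>+ x. ennreal ((norm (F x + G x))\<^sup>2) \<partial>Q)
      \<le> (\<integral>\<^sup>+ x. ennreal ((norm (F x))\<^sup>2) + ennreal ((norm (G x))\<^sup>2)
            + 2 * (ennreal (norm (F x)) * ennreal (norm (G x))) \<partial>Q)"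
  proof (rule nn_integral_mono)
    fix x
    have "(norm (F x + G x))\<^sup>2 \<le> (norm (F x) + norm (G x))\<^sup>2"
      by (intro power_mono norm_triangle_ineq) auto
    also have "\<dots> = (norm (F x))\<^sup>2 + (norm (G x))\<^sup>2 + 2 * (norm (F x) * norm (G x))"
      by (simp add: power2_sum)
    finally have "ennreal ((norm (F x + G x))\<^sup>2)
        \<le> ennreal ((norm (F x))\<^sup>2 + (norm (G x))\<^sup>2 + 2 * (norm (F x) * norm (G x)))"
      by (rule ennreal_leI)
    then show "ennreal ((norm (F x + G x))\<^sup>2) \<le> ennreal ((norm (F x))\<^sup>2) + ennreal ((norm (G x))\<^sup>2)
            + 2 * (ennreal (norm (F x)) * ennreal (norm (G x)))"
      by (simp add: ennreal_mult)
  qed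
  also have "\<dots> = A + B + 2 * D"
    by (simp add: nn_integral_add nn_integral_cmult A_def B_def D_def)
  also have "\<dots> \<le> A + B + 2 * (l2norm Q F * l2norm Q G)"
    by (intro add_left_mono mult_left_mono CS) auto
  also have "\<dots> = (l2norm Q F + l2norm Q G)\<^sup>2"
    by (simp add: A_def B_def l2norm_def power2_sum ennsqrt_power2 mult.assoc)
  finally show "(\<integral>\<^sup>+ x. ennreal ((norm (F x + G x))\<^sup>2) \<partial>Q) \<le> (l2norm Q F + l2norm Q G)\<^sup>2" .
qed

lemma l2norm_distr:
  assumes [measurable]: "T \<in> measurable Q R" "F \<in> borel_measurable R"
  shows "l2norm (distr Q R T) F = l2norm Q (\<lambda>x. F (T x))"
  by (simp add: l2norm_def nn_integral_distr)

lemma wasserstein2_le_coupling: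
  assumes "\<gamma> \<in> couplings \<mu> \<nu>"
  shows "wasserstein2 \<mu> \<nu> \<le> l2norm \<gamma> (\<lambda>z. fst z - snd z)"
  unfolding wasserstein2_def l2norm_def by (intro ennsqrt_mono INF_lower assms)

lemma couplings_nonempty:
  fixes \<mu> \<nu> :: "'a::euclidean_space measure"
  assumes "prob_space \<mu>" "prob_space \<nu>" and [measurable_cong, simp]: "sets \<mu> = sets borel" "sets \<nu> = sets borel"
  shows "\<mu> \<Otimes>\<^sub>M \<nu> \<in> couplings \<mu> \<nu>"
proof -
  interpret \<mu>: prob_space \<mu> by fact
  interpret \<nu>: prob_space \<nu> by fact
  interpret pair_prob_space \<mu> \<nu> ..
  have "distr (\<mu> \<Otimes>\<^sub>M \<nu>) borel fst = \<mu>"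
  proof -
    have "distr (\<mu> \<Otimes>\<^sub>M \<nu>) borel fst = distr (\<mu> \<Otimes>\<^sub>M \<nu>) \<mu> fst" by (rule distr_cong) auto
    then show ?thesis using \<nu>.distr_pair_fst[of \<mu>] by simp
  qed
  moreover have "distr (\<mu> \<Otimes>\<^sub>M \<nu>) borel snd = \<nu>"
  proof (rule measure_eqI)
    fix A assume "A \<in> sets (distr (\<mu> \<Otimes>\<^sub>M \<nu>) borel snd)"
    then have [measurable]: "A \<in> sets borel" by simp
    have "emeasure (distr (\<mu> \<Otimes>\<^sub>M \<nu>) borel snd) A = emeasure (\<mu> \<Otimes>\<^sub>M \<nu>) (snd -` A \<inter> space (\<mu> \<Otimes>\<^sub>M \<nu>))"
      by (subst emeasure_distr) auto
    also have "snd -` A \<inter> space (\<mu> \<Otimes>\<^sub>M \<nu>) = space \<mu> \<times> A"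
      using sets.sets_into_space[of A \<nu>] by (auto simp: space_pair_measure)
    also have "space \<mu> = UNIV" using sets_eq_imp_space_eq[of \<mu> borel] by simp
    also have "emeasure (\<mu> \<Otimes>\<^sub>M \<nu>) (UNIV \<times> A) = emeasure \<nu> A"
      by (subst \<nu>.emeasure_pair_measure_Times) (use \<mu>.emeasure_space_1 sets_eq_imp_space_eq[of \<mu> borel] in auto)
    finally show "emeasure (distr (\<mu> \<Otimes>\<^sub>M \<nu>) borel snd) A = emeasure \<nu> A" .
  qed simp
  moreover have "sets (\<mu> \<Otimes>\<^sub>M \<nu>) = sets (borel \<Otimes>\<^sub>M borel)" by (intro sets_pair_measure_cong) auto
  ultimately show ?thesis using prob_space_axioms by (simp add: couplings_def)
qed

text \<open>As the infimum in the distance may not be attained, the bound is taken along couplings whose cost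
  approaches it. If the distance is infinite, every coupling has infinite cost; arguing with
  an actual coupling then also covers \<open>\<rho> = 0\<close>, where the right-hand side is finite.\<close>

lemma wasserstein2_le_via_couplings:
  fixes \<mu> \<nu> \<mu>' \<nu>' :: "'a::euclidean_space measure"
  assumes ne: "couplings \<mu> \<nu> \<noteq> {}"
    and step: "\<And>\<gamma>. \<gamma> \<in> couplings \<mu> \<nu> \<Longrightarrow>
      wasserstein2 \<mu>' \<nu>' \<le> ennreal \<rho> * l2norm \<gamma> (\<lambda>z. fst z - snd z) + c"
  shows "wasserstein2 \<mu>' \<nu>' \<le> ennreal \<rho> * wasserstein2 \<mu> \<nu> + c"
proof (cases "wasserstein2 \<mu> \<nu> = \<top>")
  case True
  obtain \<gamma> where \<gamma>: "\<gamma> \<in> couplings \<mu> \<nu>" using ne by auto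
  then have "l2norm \<gamma> (\<lambda>z. fst z - snd z) = \<top>"
    using wasserstein2_le_coupling[OF \<gamma>] True by (simp add: top_unique)
  then show ?thesis using step[OF \<gamma>] True by simp
next
  case False
  then obtain W where W: "wasserstein2 \<mu> \<nu> = ennreal W" "0 \<le> W" by (cases "wasserstein2 \<mu> \<nu>") auto
  define I where "I = (INF \<gamma>\<in>couplings \<mu> \<nu>. \<integral>\<^sup>+ z. ennreal ((norm (fst z - snd z))\<^sup>2) \<partial>\<gamma>)"
  have I: "I = (ennreal W)\<^sup>2"
    using ennsqrt_power2[of I] W by (simp add: I_def wasserstein2_def)
  have near: "wasserstein2 \<mu>' \<nu>' \<le> ennreal \<rho> * wasserstein2 \<mu> \<nu> + c + ennreal \<rho> * ennreal e" if "0 < e" for e :: real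
  proof -
    have "W\<^sup>2 < (W + e)\<^sup>2" using W that by (intro power_strict_mono) auto
    then have "I < (ennreal (W + e))\<^sup>2" using W that by (simp add: I ennreal_power ennreal_lessI del: ennreal_plus)
    then obtain \<gamma> where \<gamma>: "\<gamma> \<in> couplings \<mu> \<nu>"
      "(\<integral>\<^sup>+ z. ennreal ((norm (fst z - snd z))\<^sup>2) \<partial>\<gamma>) < (ennreal (W + e))\<^sup>2"
      unfolding I_def INF_less_iff by auto
    have "wasserstein2 \<mu>' \<nu>' \<le> ennreal \<rho> * l2norm \<gamma> (\<lambda>z. fst z - snd z) + c" by (rule step) fact
    also have "\<dots> \<le> ennreal \<rho> * ennreal (W + e) + c"
      using \<gamma>(2) by (intro add_right_mono mult_left_mono) (auto simp: l2norm_le_iff)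
    also have "\<dots> = ennreal \<rho> * wasserstein2 \<mu> \<nu> + c + ennreal \<rho> * ennreal e"
      using W that by (simp add: distrib_left ac_simps)
    finally show ?thesis .
  qed
  show ?thesis
  proof (rule ennreal_le_epsilon)
    fix e :: real assume e: "0 < e"
    define d where "d = e / (\<bar>\<rho>\<bar> + 1)"
    have d: "0 < d" using e by (simp add: d_def)
    have "ennreal \<rho> * ennreal d \<le> ennreal e"
    proof (cases "0 \<le> \<rho>")
      case True
      then have "\<rho> * d \<le> e" using e by (simp add: d_def field_simps)
      then show ?thesis using True d by (simp add: ennreal_leI flip: ennreal_mult)
    qed (simp add: ennreal_neg)
    then show "wasserstein2 \<mu>' \<nu>' \<le> ennreal \<rho> * wasserstein2 \<mu> \<nu> + c + ennreal e"
      using near[OF d] by (meson add_left_mono order_trans)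
  qed
qed

section \<open>Lebesgue and standard Gaussian measure\<close>

lemma nn_integral_lborel_affine:
  fixes \<phi> :: "'a::euclidean_space \<Rightarrow> ennreal"
  assumes [measurable]: "\<phi> \<in> borel_measurable borel" and "c \<noteq> 0"
  shows "(\<integral>\<^sup>+ x. \<phi> x \<partial>lborel) = ennreal (\<bar>c\<bar> ^ DIM('a)) * (\<integral>\<^sup>+ x. \<phi> (t + c *\<^sub>R x) \<partial>lborel)"
  by (subst lborel_affine[OF assms(2), of t])
     (simp add: nn_integral_density nn_integral_distr nn_integral_cmult)

lemma nn_integral_lborel_translate:
  fixes \<phi> :: "'a::euclidean_space \<Rightarrow> ennreal"
  assumes [measurable]: "\<phi> \<in> borel_measurable borel"
  shows "(\<integral>\<^sup>+ x. \<phi> (x + t) \<partial>lborel) = (\<integral>\<^sup>+ x. \<phi> x \<partial>lborel)"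
  using nn_integral_lborel_affine[OF assms, of 1 t] by (simp add: add.commute)

lemma nn_integral_lborel_neg:
  fixes \<phi> :: "'a::euclidean_space \<Rightarrow> ennreal"
  assumes [measurable]: "\<phi> \<in> borel_measurable borel"
  shows "(\<integral>\<^sup>+ x. \<phi> (- x) \<partial>lborel) = (\<integral>\<^sup>+ x. \<phi> x \<partial>lborel)"
  using nn_integral_lborel_affine[OF assms, of "-1" 0] by simp

lemma integral_lborel_translate:
  fixes u :: "'a::euclidean_space \<Rightarrow> real"
  assumes [measurable]: "u \<in> borel_measurable borel"
  shows "(\<integral> x. u (x + t) \<partial>lborel) = (\<integral> x. u x \<partial>lborel)"
    and "integrable lborel (\<lambda>x. u (x + t)) \<longleftrightarrow> integrable lborel u"
proof -
  have *: "lborel = distr lborel borel (\<lambda>x::'a. x + t)"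
    using lborel_affine[of 1 t] by (simp add: add.commute density_1)
  show "(\<integral> x. u (x + t) \<partial>lborel) = (\<integral> x. u x \<partial>lborel)"
    by (subst (2) *) (simp add: integral_distr)
  show "integrable lborel (\<lambda>x. u (x + t)) \<longleftrightarrow> integrable lborel u"
    by (subst (2) *) (simp add: integrable_distr_eq)
qed

text \<open>Integration by parts without boundary terms. Translation invariance gives
  \<open>\<integral> (u(x + e) - u(x)) dx = 0\<close>; the integrand is the integral of the derivative along a segment, and
  Fubini turns the left-hand side into \<open>\<integral> u'(x) dx\<close>.\<close>

lemma integral_directional_derivative_eq_0:
  fixes u u' :: "'a::euclidean_space \<Rightarrow> real"
  assumes deriv: "\<And>x. ((\<lambda>t. u (x + t *\<^sub>R e)) has_real_derivative u' x) (at 0)"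
    and cont: "continuous_on UNIV u'"
    and iu: "integrable lborel u" and iu': "integrable lborel u'"
  shows "(\<integral> x. u' x \<partial>lborel) = 0"
proof -
  have [measurable]: "u' \<in> borel_measurable borel" "u \<in> borel_measurable borel"
    using iu iu' by auto
  have d: "((\<lambda>t. u (x + t *\<^sub>R e)) has_real_derivative u' (x + r *\<^sub>R e)) (at r)" for x r
    using deriv[of "x + r *\<^sub>R e"] DERIV_shift[of "\<lambda>t. u (x + t *\<^sub>R e)" _ 0 r]
    by (simp add: scaleR_add_left algebra_simps)
  have ftc: "(\<integral>t. u' (x + t *\<^sub>R e) * indicator {0..1} t \<partial>lborel) = u (x + e) - u x" for x
  proof -
    have "isCont (\<lambda>t. u' (x + t *\<^sub>R e)) r" for r
      using continuous_on_compose2[OF cont, of UNIV "\<lambda>t. x + t *\<^sub>R e"]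
      by (auto simp: continuous_on_eq_continuous_at intro!: continuous_intros)
    then show ?thesis
      using integral_FTC_Icc_real[of 0 1 "\<lambda>t. u (x + t *\<^sub>R e)" "\<lambda>t. u' (x + t *\<^sub>R e)"] d by auto
  qed
  have int2: "integrable (lborel \<Otimes>\<^sub>M lborel) (\<lambda>(t::real, x). u' (x + t *\<^sub>R e) * indicator {0..1} t)"
  proof (rule lborel_pair.Fubini_integrable)
    show "(\<lambda>(t::real, x). u' (x + t *\<^sub>R e) * indicator {0..1} t) \<in> borel_measurable (lborel \<Otimes>\<^sub>M lborel)"
      by measurable
    have "(\<integral> x. norm (u' (x + t *\<^sub>R e) * indicator {0..1} t) \<partial>lborel)
        = (\<integral> x. \<bar>u' x\<bar> \<partial>lborel) * indicator {0..1} t" for t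
      using integral_lborel_translate(1)[of "\<lambda>x. \<bar>u' x\<bar>" "t *\<^sub>R e"] by (simp add: abs_mult)
    then show "integrable lborel (\<lambda>t::real. \<integral>x. norm (case (t, x) of (t, x) \<Rightarrow> u' (x + t *\<^sub>R e) * indicator {0..1} t) \<partial>lborel)"
      by (simp add: integrable_real_indicator)
    show "AE t::real in lborel. integrable lborel (\<lambda>x. case (t, x) of (t, x) \<Rightarrow> u' (x + t *\<^sub>R e) * indicator {0..1} t)"
      using iu' by (auto simp: integral_lborel_translate(2))
  qed
  have "(\<integral>x. u (x + e) - u x \<partial>lborel) = 0"
    using iu by (subst Bochner_Integration.integral_diff) (auto simp: integral_lborel_translate)
  then have "0 = (\<integral>x. (\<integral>t. u' (x + t *\<^sub>R e) * indicator {0..1} t \<partial>lborel) \<partial>lborel)"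
    by (simp add: ftc)
  also have "\<dots> = (\<integral>t. (\<integral>x. u' (x + t *\<^sub>R e) * indicator {0..1} t \<partial>lborel) \<partial>(lborel::real measure))"
    using lborel_pair.Fubini_integral[OF int2] by simp
  also have "\<dots> = (\<integral>t. (\<integral>x. u' x \<partial>lborel) * indicator {0..1} t \<partial>(lborel::real measure))"
    by (simp add: integral_lborel_translate(1))
  also have "\<dots> = (\<integral>x. u' x \<partial>lborel)" by simp
  finally show ?thesis by simp
qed

lemma nn_integral_exp_neg_square:
  assumes "0 < c"
  shows "(\<integral>\<^sup>+ (x::'a::euclidean_space). ennreal (exp (- c * (norm x)\<^sup>2)) \<partial>lborel) = ennreal (sqrt (pi / c) ^ DIM('a))"
proof -
  define \<sigma> where "\<sigma> = sqrt (1 / (2 * c))"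
  have \<sigma>: "0 < \<sigma>" "\<sigma>\<^sup>2 = 1 / (2 * c)" using assms by (auto simp: \<sigma>_def)
  have 1: "exp (- c * y\<^sup>2) = sqrt (pi / c) * normal_density 0 \<sigma> y" for y
  proof -
    have "2 * \<sigma>\<^sup>2 = 1 / c" using \<sigma>(2) by simp
    moreover from this have "2 * pi * \<sigma>\<^sup>2 = pi / c" by (simp add: field_simps)
    ultimately show ?thesis using assms by (simp add: normal_density_def mult.commute)
  qed
  interpret prob_space "density lborel (normal_density 0 \<sigma>)" by (rule prob_space_normal_density) fact
  have "emeasure (density lborel (normal_density 0 \<sigma>)) UNIV = 1"
    using emeasure_space_1 by simp
  then have 2: "(\<integral>\<^sup>+ y. ennreal (normal_density 0 \<sigma> y) \<partial>lborel) = 1"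
    by (simp add: emeasure_density)
  have "exp (- c * (norm x)\<^sup>2) = (\<Prod>b\<in>Basis. exp (- c * (x \<bullet> b)\<^sup>2))" for x :: 'a
    unfolding power2_norm_eq_inner euclidean_inner[of x x]
    by (simp add: exp_sum sum_distrib_left power2_eq_square)
  then have "(\<integral>\<^sup>+ (x::'a). ennreal (exp (- c * (norm x)\<^sup>2)) \<partial>lborel)
      = (\<integral>\<^sup>+ (x::'a). (\<Prod>b\<in>Basis. ennreal (exp (- c * (x \<bullet> b)\<^sup>2))) \<partial>lborel)"
    by (simp add: prod_ennreal)
  also have "\<dots> = (\<Prod>b\<in>(Basis::'a set). \<integral>\<^sup>+ y. ennreal (exp (- c * y\<^sup>2)) \<partial>lborel)"
    by (rule nn_integral_lborel_prod) auto
  also have "(\<integral>\<^sup>+ y. ennreal (exp (- c * y\<^sup>2)) \<partial>lborel) = ennreal (sqrt (pi / c))"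
    unfolding 1 using assms by (simp add: ennreal_mult nn_integral_cmult 2)
  finally show ?thesis using assms by (simp add: ennreal_power)
qed

lemma integrable_exp_neg_square:
  assumes "0 < c"
  shows "integrable lborel (\<lambda>x::'a::euclidean_space. exp (- c * (norm x)\<^sup>2))"
  using nn_integral_exp_neg_square[OF assms, where 'a='a] by (intro integrableI_nonneg) auto

text \<open>Since \<open>1 + r \<le> exp r\<close>, polynomial growth only adds a linear term to the exponent, and completing the
  square absorbs it into half of the quadratic term. This gives all moments of both the Gaussian and the
  Gibbs measure.\<close>

lemma integrable_poly_exp_neg:
  fixes f :: "'a::euclidean_space \<Rightarrow> real"
  assumes "0 < c" and lower: "\<And>x. a - b * norm x + c * (norm x)\<^sup>2 \<le> f x"
    and [measurable]: "f \<in> borel_measurable borel" "\<phi> \<in> borel_measurable borel"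
    and growth: "\<And>x. \<bar>\<phi> x\<bar> \<le> C * (1 + norm x) ^ k"
  shows "integrable lborel (\<lambda>x. \<phi> x * exp (- f x))"
proof (rule Bochner_Integration.integrable_bound)
  \<comment> \<open>The maximum over all real \<open>r\<close> of \<open>exp ((k + b) r - c/2 r\<^sup>2 - a)\<close>.\<close>
  define B where "B = exp ((real k + b)\<^sup>2 / (2 * c) - a)"
  show "integrable lborel (\<lambda>x::'a. \<bar>C\<bar> * B * exp (- (c / 2) * (norm x)\<^sup>2))"
    using assms(1) by (intro integrable_mult_right integrable_exp_neg_square) auto
  show "AE x in lborel. norm (\<phi> x * exp (- f x)) \<le> norm (\<bar>C\<bar> * B * exp (- (c / 2) * (norm x)\<^sup>2))"
  proof (rule AE_I2)
    fix x :: 'a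
    define r where "r = norm x"
    have "(1 + r) ^ k \<le> exp r ^ k"
      by (intro power_mono) (auto simp: r_def)
    also have "\<dots> = exp (real k * r)" by (simp add: exp_of_nat_mult)
    finally have 1: "(1 + r) ^ k \<le> exp (real k * r)" .
    have "(real k + b) * r \<le> (real k + b)\<^sup>2 / (2 * c) + c / 2 * r\<^sup>2"
    proof -
      have "0 \<le> ((real k + b) - c * r)\<^sup>2 / (2 * c)" using assms(1) by simp
      also have "\<dots> = (real k + b)\<^sup>2 / (2 * c) + c / 2 * r\<^sup>2 - (real k + b) * r"
        using assms(1) by (simp add: power2_eq_square field_simps)
      finally show ?thesis by simp
    qed
    then have 2: "real k * r - f x \<le> ((real k + b)\<^sup>2 / (2 * c) - a) - c / 2 * r\<^sup>2"
      using lower[of x] by (simp add: r_def algebra_simps)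
    have "\<bar>\<phi> x\<bar> * exp (- f x) \<le> \<bar>C\<bar> * (1 + r) ^ k * exp (- f x)"
    proof (intro mult_right_mono)
      have "C * (1 + r) ^ k \<le> \<bar>C\<bar> * (1 + r) ^ k"
        by (intro mult_right_mono) (auto simp: r_def)
      then show "\<bar>\<phi> x\<bar> \<le> \<bar>C\<bar> * (1 + r) ^ k" using growth[of x] by (simp add: r_def)
    qed auto
    also have "\<dots> \<le> \<bar>C\<bar> * exp (real k * r) * exp (- f x)"
      using 1 by (intro mult_right_mono mult_left_mono) auto
    also have "\<dots> = \<bar>C\<bar> * exp (real k * r - f x)"
      by (simp add: exp_diff exp_minus field_simps)
    also have "\<dots> \<le> \<bar>C\<bar> * exp (((real k + b)\<^sup>2 / (2 * c) - a) - c / 2 * r\<^sup>2)"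
      using 2 by (intro mult_left_mono) auto
    also have "\<dots> = \<bar>C\<bar> * B * exp (- (c / 2) * (norm x)\<^sup>2)"
      by (simp add: B_def r_def mult.assoc flip: exp_add)
    finally show "norm (\<phi> x * exp (- f x)) \<le> norm (\<bar>C\<bar> * B * exp (- (c / 2) * (norm x)\<^sup>2))"
      by (simp add: abs_mult B_def)
  qed
qed measurable

definition gauss_density :: "'a::euclidean_space \<Rightarrow> real" where
  "gauss_density x = exp (- (norm x)\<^sup>2 / 2) / sqrt ((2 * pi) ^ DIM('a))"

definition std_gauss :: "'a::euclidean_space measure" where
  "std_gauss = density lborel (\<lambda>x. ennreal (gauss_density x))"

lemma gauss_density_measurable [measurable]: "gauss_density \<in> borel_measurable borel"
  unfolding gauss_density_def by measurable

lemma gauss_density_nonneg [simp]: "0 \<le> gauss_density x"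
  by (simp add: gauss_density_def)

lemma sets_std_gauss [simp, measurable_cong]: "sets std_gauss = sets borel"
  by (simp add: std_gauss_def)

lemma space_std_gauss [simp]: "space std_gauss = UNIV"
  by (simp add: std_gauss_def)

lemma nn_integral_std_gauss:
  "\<phi> \<in> borel_measurable borel \<Longrightarrow>
    (\<integral>\<^sup>+ x. \<phi> x \<partial>std_gauss) = (\<integral>\<^sup>+ x. ennreal (gauss_density x) * \<phi> x \<partial>lborel)"
  unfolding std_gauss_def by (rule nn_integral_density) auto

lemma nn_integral_gauss_density: "(\<integral>\<^sup>+ (x::'a::euclidean_space). ennreal (gauss_density x) \<partial>lborel) = 1"
proof -
  define Z :: real where "Z = sqrt ((2 * pi) ^ DIM('a))"
  have Z: "0 < Z" by (simp add: Z_def)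
  have "(\<integral>\<^sup>+ (x::'a). ennreal (gauss_density x) \<partial>lborel)
      = (\<integral>\<^sup>+ (x::'a). ennreal (1 / Z) * ennreal (exp (- (1/2) * (norm x)\<^sup>2)) \<partial>lborel)"
    using Z by (intro nn_integral_cong) (simp add: gauss_density_def Z_def flip: ennreal_mult)
  also have "\<dots> = ennreal (1 / Z) * ennreal (sqrt (pi / (1/2)) ^ DIM('a))"
    by (subst nn_integral_cmult, simp, subst nn_integral_exp_neg_square) simp_all
  also have "\<dots> = 1"
  proof -
    have "sqrt (pi / (1/2)) ^ DIM('a) = Z" unfolding Z_def real_sqrt_power by (simp add: mult.commute)
    then show ?thesis using Z by (simp flip: ennreal_mult)
  qed
  finally show ?thesis .
qed

lemma prob_space_std_gauss: "prob_space std_gauss"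
  by (rule prob_spaceI) (simp add: std_gauss_def emeasure_density nn_integral_gauss_density)

lemma nn_integral_std_gauss_neg:
  assumes [measurable]: "\<phi> \<in> borel_measurable borel"
  shows "(\<integral>\<^sup>+ x. \<phi> (- x) \<partial>std_gauss) = (\<integral>\<^sup>+ x. \<phi> x \<partial>std_gauss)"
  using nn_integral_lborel_neg[of "\<lambda>x. ennreal (gauss_density x) * \<phi> x"]
  by (simp add: nn_integral_std_gauss gauss_density_def)

lemma integrable_std_gauss:
  fixes \<phi> :: "'a::euclidean_space \<Rightarrow> real"
  assumes [measurable]: "\<phi> \<in> borel_measurable borel"
    and growth: "\<And>x. \<bar>\<phi> x\<bar> \<le> C * (1 + norm x) ^ k"
  shows "integrable std_gauss \<phi>"
proof -
  have "integrable lborel (\<lambda>x. \<phi> x * exp (- ((norm x)\<^sup>2 / 2)))"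
    by (rule integrable_poly_exp_neg[where a=0 and b=0 and c="1/2", OF _ _ _ _ growth]) auto
  then have "integrable lborel (\<lambda>x. (1 / sqrt ((2 * pi) ^ DIM('a))) * (\<phi> x * exp (- ((norm x)\<^sup>2 / 2))))"
    by (rule integrable_mult_right)
  then show ?thesis
    by (simp add: std_gauss_def integrable_density gauss_density_def mult_ac)
qed

text \<open>Integration by parts applied to \<open>(z \<bullet> a)\<close> times the density, in the direction \<open>b\<close>.\<close>

lemma std_gauss_covariance:
  fixes a b :: "'a::euclidean_space"
  shows "(\<integral> z. (z \<bullet> a) * (z \<bullet> b) \<partial>std_gauss) = a \<bullet> b"
proof -
  define Z :: real where "Z = sqrt ((2 * pi) ^ DIM('a))"
  have Z: "0 < Z" by (simp add: Z_def)
  have g: "gauss_density z = exp (- ((norm z)\<^sup>2 / 2)) / Z" for z :: 'a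
    by (simp add: gauss_density_def Z_def)
  have bnd: "\<bar>(z \<bullet> a) * (z \<bullet> b)\<bar> \<le> norm a * norm b * (1 + norm z) ^ 2" for z :: 'a
  proof -
    have "\<bar>(z \<bullet> a) * (z \<bullet> b)\<bar> \<le> (norm z * norm a) * (norm z * norm b)"
      unfolding abs_mult by (intro mult_mono Cauchy_Schwarz_ineq2) auto
    also have "\<dots> = norm a * norm b * (norm z)\<^sup>2" by (simp add: power2_eq_square mult_ac)
    also have "\<dots> \<le> norm a * norm b * (1 + norm z)\<^sup>2"
      by (intro mult_left_mono power_mono) auto
    finally show ?thesis .
  qed
  have bnd1: "\<bar>z \<bullet> a\<bar> \<le> norm a * (1 + norm z) ^ 1" for z :: 'a
  proof -
    have "\<bar>z \<bullet> a\<bar> \<le> norm a * norm z" using Cauchy_Schwarz_ineq2[of z a] by (simp add: mult.commute)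
    also have "\<dots> \<le> norm a * (1 + norm z) ^ 1" by (intro mult_left_mono) auto
    finally show ?thesis .
  qed
  have int: "integrable std_gauss (\<lambda>z. (z \<bullet> a) * (z \<bullet> b))"
    "integrable std_gauss (\<lambda>z::'a. z \<bullet> a)" "integrable std_gauss (\<lambda>z::'a. 1::real)"
    by (rule integrable_std_gauss[OF _ bnd], simp)
       (rule integrable_std_gauss[OF _ bnd1], simp, rule integrable_std_gauss[of _ 1 0], simp_all)
  have il: "integrable lborel (\<lambda>z. gauss_density z * ((z \<bullet> a) * (z \<bullet> b)))"
    "integrable lborel (\<lambda>z::'a. gauss_density z * (z \<bullet> a))"
    "integrable lborel (\<lambda>z::'a. gauss_density z)"
    using int by (simp_all add: std_gauss_def integrable_density)
  have "(\<integral> z. (a \<bullet> b) * gauss_density z - gauss_density z * ((z \<bullet> a) * (z \<bullet> b)) \<partial>lborel) = 0"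
  proof (rule integral_directional_derivative_eq_0[where u = "\<lambda>z. gauss_density z * (z \<bullet> a)" and e = b])
    show "((\<lambda>t. gauss_density (x + t *\<^sub>R b) * ((x + t *\<^sub>R b) \<bullet> a)) has_real_derivative
         a \<bullet> b * gauss_density x - gauss_density x * (x \<bullet> a * (x \<bullet> b))) (at 0)" for x
    proof -
      have "gauss_density (x + t *\<^sub>R b) * ((x + t *\<^sub>R b) \<bullet> a)
          = exp (- ((x \<bullet> x + 2 * t * (x \<bullet> b) + t\<^sup>2 * (b \<bullet> b)) / 2)) / Z * (x \<bullet> a + t * (b \<bullet> a))" for t
        unfolding g power2_norm_eq_inner
        by (simp add: inner_add_left inner_add_right inner_commute[of b x] power2_eq_square algebra_simps)
      moreover have "((\<lambda>t. exp (- ((x \<bullet> x + 2 * t * (x \<bullet> b) + t\<^sup>2 * (b \<bullet> b)) / 2)) / Z * (x \<bullet> a + t * (b \<bullet> a)))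
          has_real_derivative (a \<bullet> b * gauss_density x - gauss_density x * (x \<bullet> a * (x \<bullet> b)))) (at 0)"
        unfolding g power2_norm_eq_inner
        using Z by (auto intro!: derivative_eq_intros simp: inner_commute[of b a] diff_divide_distrib mult_ac)
      ultimately show ?thesis by simp
    qed
    show "continuous_on UNIV (\<lambda>x. a \<bullet> b * gauss_density x - gauss_density x * (x \<bullet> a * (x \<bullet> b)))"
      unfolding gauss_density_def by (intro continuous_intros) auto
  qed (use il in auto)
  then have "(\<integral> z. gauss_density z * ((z \<bullet> a) * (z \<bullet> b)) \<partial>lborel) = (a \<bullet> b) * (\<integral> (z::'a). gauss_density z \<partial>lborel)"
    using il by simp
  also have "(\<integral> (z::'a). gauss_density z \<partial>lborel) = 1"
    using nn_integral_gauss_density[where 'a='a] by (intro integral_eq_nn_integral[THEN trans]) auto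
  finally show ?thesis by (simp add: std_gauss_def integral_density)
qed

lemma std_gauss_second_moment: "(\<integral> (z::'a::euclidean_space). (norm z)\<^sup>2 \<partial>std_gauss) = real DIM('a)"
proof -
  have int: "integrable std_gauss (\<lambda>z::'a. (z \<bullet> b) * (z \<bullet> b))" if "b \<in> Basis" for b :: 'a
  proof (rule integrable_std_gauss[where C=1 and k=2])
    show "\<bar>(x \<bullet> b) * (x \<bullet> b)\<bar> \<le> 1 * (1 + norm x) ^ 2" for x :: 'a
    proof -
      have "\<bar>x \<bullet> b\<bar> \<le> 1 + norm x" using Basis_le_norm[OF that, of x] by simp
      then have "\<bar>x \<bullet> b\<bar> ^ 2 \<le> (1 + norm x) ^ 2" by (intro power_mono) auto
      then show ?thesis by (simp add: power2_eq_square)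
    qed
  qed auto
  have "(\<integral> (z::'a). (norm z)\<^sup>2 \<partial>std_gauss) = (\<integral> (z::'a). (\<Sum>b\<in>Basis. (z \<bullet> b) * (z \<bullet> b)) \<partial>std_gauss)"
    by (subst euclidean_inner[symmetric]) (simp add: power2_norm_eq_inner)
  also have "\<dots> = (\<Sum>b\<in>Basis. \<integral> (z::'a). (z \<bullet> b) * (z \<bullet> b) \<partial>std_gauss)"
    by (rule Bochner_Integration.integral_sum) (use int in auto)
  also have "\<dots> = real DIM('a)" by (simp add: std_gauss_covariance inner_same_Basis)
  finally show ?thesis .
qed

text \<open>By the symmetry \<open>z \<mapsto> -z\<close> the positive part of \<open>z \<bullet> a\<close> carries half of the covariance. This
  factor one half is how Metropolis rejections produce the drift \<open>- s\<^sup>2/2 \<nabla>f\<close>.\<close>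

lemma std_gauss_covariance_halfspace:
  fixes a b :: "'a::euclidean_space"
  shows "(\<integral> z. max 0 (z \<bullet> a) * (z \<bullet> b) \<partial>std_gauss) = (a \<bullet> b) / 2"
proof -
  have bnd: "\<bar>max 0 (z \<bullet> a) * (z \<bullet> b)\<bar> \<le> norm a * norm b * (1 + norm z) ^ 2" for z :: 'a
  proof -
    have "\<bar>max 0 (z \<bullet> a) * (z \<bullet> b)\<bar> \<le> (norm z * norm a) * (norm z * norm b)"
      unfolding abs_mult
    proof (intro mult_mono)
      show "\<bar>max 0 (z \<bullet> a)\<bar> \<le> norm z * norm a"
        using Cauchy_Schwarz_ineq2[of z a] by (auto simp: max_def)
    qed (simp_all add: Cauchy_Schwarz_ineq2)
    also have "\<dots> = norm a * norm b * (norm z)\<^sup>2" by (simp add: power2_eq_square mult_ac)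
    also have "\<dots> \<le> norm a * norm b * (1 + norm z)\<^sup>2"
      by (intro mult_left_mono power_mono) auto
    finally show ?thesis .
  qed
  have int: "integrable std_gauss (\<lambda>z. max 0 (z \<bullet> a) * (z \<bullet> b))"
    by (rule integrable_std_gauss[OF _ bnd]) auto
  have neg: "distr std_gauss borel uminus = (std_gauss :: 'a measure)"
  proof (rule measure_eqI)
    fix A assume "A \<in> sets (distr std_gauss borel uminus :: 'a measure)"
    then have [measurable]: "A \<in> sets borel" by simp
    have "emeasure (distr std_gauss borel uminus) A = (\<integral>\<^sup>+ z. indicator A z \<partial>distr std_gauss borel (uminus :: 'a \<Rightarrow> 'a))"
      by simp
    also have "\<dots> = (\<integral>\<^sup>+ z. indicator A (- z) \<partial>std_gauss)" by (rule nn_integral_distr) auto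
    also have "\<dots> = emeasure std_gauss A" by (subst nn_integral_std_gauss_neg) auto
    finally show "emeasure (distr std_gauss borel uminus) A = emeasure std_gauss A" .
  qed simp
  have int2: "integrable std_gauss (\<lambda>z. max 0 (- z \<bullet> a) * (- z \<bullet> b))"
    using int by (subst (asm) neg[symmetric]) (simp add: integrable_distr_eq)
  have "(\<integral> z. max 0 (z \<bullet> a) * (z \<bullet> b) \<partial>std_gauss) = (\<integral> z. max 0 (- z \<bullet> a) * (- z \<bullet> b) \<partial>std_gauss)"
    by (subst neg[symmetric]) (simp add: integral_distr)
  then have "2 * (\<integral> z. max 0 (z \<bullet> a) * (z \<bullet> b) \<partial>std_gauss)
      = (\<integral> z. max 0 (z \<bullet> a) * (z \<bullet> b) + max 0 (- z \<bullet> a) * (- z \<bullet> b) \<partial>std_gauss)"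
    using int int2 by simp
  also have "\<dots> = (\<integral> z. (z \<bullet> a) * (z \<bullet> b) \<partial>std_gauss)"
    by (intro Bochner_Integration.integral_cong) (auto simp: max_def)
  finally show ?thesis by (simp add: std_gauss_covariance)
qed

text \<open>Stability of the Gaussian law under sums, in the normalised form with \<open>a\<^sup>2 + b\<^sup>2 = 1\<close>. After the
  substitution \<open>w = a y + b z\<close> the joint density factorises again, now into a Gaussian in \<open>w\<close> and a
  Gaussian in \<open>(z - b w) / a\<close>, which integrates to one.\<close>

lemma nn_integral_std_gauss_rotate:
  fixes \<phi> :: "'a::euclidean_space \<Rightarrow> ennreal"
  assumes [measurable]: "\<phi> \<in> borel_measurable borel" and ab: "a\<^sup>2 + b\<^sup>2 = 1" and "a \<noteq> 0"
  shows "(\<integral>\<^sup>+ y. \<integral>\<^sup>+ z. \<phi> (a *\<^sub>R y + b *\<^sub>R z) \<partial>std_gauss \<partial>std_gauss) = (\<integral>\<^sup>+ z. \<phi> z \<partial>std_gauss)"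
proof -
  interpret G: prob_space "std_gauss :: 'a measure" by (rule prob_space_std_gauss)
  interpret GG: pair_sigma_finite "std_gauss :: 'a measure" "std_gauss :: 'a measure" ..
  define c where "c = 1 / a"
  have c: "c \<noteq> 0" using assms by (simp add: c_def)
  define p where "p = ennreal (\<bar>c\<bar> ^ DIM('a))"
  have key: "gauss_density (c *\<^sub>R (w - b *\<^sub>R z)) * gauss_density z
      = gauss_density w * gauss_density (c *\<^sub>R (z - b *\<^sub>R w))" for w z :: 'a
  proof -
    have a: "a\<^sup>2 = 1 - b\<^sup>2" using ab by simp
    have *: "(norm (c *\<^sub>R (w - b *\<^sub>R z)))\<^sup>2 + (norm z)\<^sup>2 = (norm w)\<^sup>2 + (norm (c *\<^sub>R (z - b *\<^sub>R w)))\<^sup>2"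
    proof -
      have e: "(norm (c *\<^sub>R (w - b *\<^sub>R z)))\<^sup>2 = c\<^sup>2 * (w \<bullet> w - 2 * b * (w \<bullet> z) + b\<^sup>2 * (z \<bullet> z))" for w z :: 'a
      proof -
        have "(norm (w - b *\<^sub>R z))\<^sup>2 = w \<bullet> w - 2 * b * (w \<bullet> z) + b\<^sup>2 * (z \<bullet> z)"
          unfolding power2_norm_eq_inner
          by (simp add: inner_diff_left inner_diff_right inner_commute[of z w] power2_eq_square algebra_simps)
        then show ?thesis by (simp add: power_mult_distrib)
      qed
      have c2: "c\<^sup>2 * (1 - b\<^sup>2) = 1" using assms(3) a[symmetric] by (simp add: c_def power_divide)
      have "c\<^sup>2 * (w \<bullet> w - 2 * b * (w \<bullet> z) + b\<^sup>2 * (z \<bullet> z)) + (z \<bullet> z) * (c\<^sup>2 * (1 - b\<^sup>2))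
        = (w \<bullet> w) * (c\<^sup>2 * (1 - b\<^sup>2)) + c\<^sup>2 * (z \<bullet> z - 2 * b * (z \<bullet> w) + b\<^sup>2 * (w \<bullet> w))"
        by (simp add: algebra_simps inner_commute)
      then show ?thesis unfolding e c2 by (simp add: power2_norm_eq_inner)
    qed
    have "- (norm (c *\<^sub>R (w - b *\<^sub>R z)))\<^sup>2 / 2 + - (norm z)\<^sup>2 / 2 = - (norm w)\<^sup>2 / 2 + - (norm (c *\<^sub>R (z - b *\<^sub>R w)))\<^sup>2 / 2"
      using * by (simp add: field_simps)
    then have "exp (- (norm (c *\<^sub>R (w - b *\<^sub>R z)))\<^sup>2 / 2) * exp (- (norm z)\<^sup>2 / 2)
      = exp (- (norm w)\<^sup>2 / 2) * exp (- (norm (c *\<^sub>R (z - b *\<^sub>R w)))\<^sup>2 / 2)"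
      unfolding exp_add[symmetric] by simp
    then show ?thesis by (simp add: gauss_density_def field_simps)
  qed
  have "(\<integral>\<^sup>+ y. \<integral>\<^sup>+ z. \<phi> (a *\<^sub>R y + b *\<^sub>R z) \<partial>std_gauss \<partial>std_gauss)
      = (\<integral>\<^sup>+ z. \<integral>\<^sup>+ y. \<phi> (a *\<^sub>R y + b *\<^sub>R z) \<partial>std_gauss \<partial>std_gauss)"
    by (rule GG.Fubini') measurable
  also have "\<dots> = (\<integral>\<^sup>+ z. (\<integral>\<^sup>+ w. p * (ennreal (gauss_density (c *\<^sub>R (w - b *\<^sub>R z))) * \<phi> w) \<partial>lborel) \<partial>std_gauss)"
  proof (rule nn_integral_cong)
    fix z :: 'a
    have "(\<integral>\<^sup>+ y. \<phi> (a *\<^sub>R y + b *\<^sub>R z) \<partial>std_gauss) = (\<integral>\<^sup>+ y. ennreal (gauss_density y) * \<phi> (a *\<^sub>R y + b *\<^sub>R z) \<partial>lborel)"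
      by (subst nn_integral_std_gauss) auto
    also have "\<dots> = p * (\<integral>\<^sup>+ w. ennreal (gauss_density (- (c * b) *\<^sub>R z + c *\<^sub>R w)) * \<phi> (a *\<^sub>R (- (c * b) *\<^sub>R z + c *\<^sub>R w) + b *\<^sub>R z) \<partial>lborel)"
      unfolding p_def by (rule nn_integral_lborel_affine) (use c in auto)
    also have "\<dots> = p * (\<integral>\<^sup>+ w. (ennreal (gauss_density (c *\<^sub>R (w - b *\<^sub>R z))) * \<phi> w) \<partial>lborel)"
    proof -
      have "a *\<^sub>R (- (c * b) *\<^sub>R z + c *\<^sub>R w) + b *\<^sub>R z = w" for w
        using assms(3) by (simp add: c_def scaleR_diff_right)
      moreover have "- (c * b) *\<^sub>R z + c *\<^sub>R w = c *\<^sub>R (w - b *\<^sub>R z)" for w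
        by (simp add: algebra_simps)
      ultimately show ?thesis by simp
    qed
    finally show "(\<integral>\<^sup>+ y. \<phi> (a *\<^sub>R y + b *\<^sub>R z) \<partial>std_gauss)
        = (\<integral>\<^sup>+ w. p * (ennreal (gauss_density (c *\<^sub>R (w - b *\<^sub>R z))) * \<phi> w) \<partial>lborel)"
      by (simp add: nn_integral_cmult)
  qed
  also have "\<dots> = (\<integral>\<^sup>+ z. (\<integral>\<^sup>+ w. p * (ennreal (gauss_density z * gauss_density (c *\<^sub>R (w - b *\<^sub>R z))) * \<phi> w) \<partial>lborel) \<partial>lborel)"
    by (subst nn_integral_std_gauss) (auto simp: ennreal_mult mult_ac simp flip: nn_integral_cmult)
  also have "\<dots> = (\<integral>\<^sup>+ w. (\<integral>\<^sup>+ z. p * (ennreal (gauss_density z * gauss_density (c *\<^sub>R (w - b *\<^sub>R z))) * \<phi> w) \<partial>lborel) \<partial>lborel)"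
    by (rule lborel_pair.Fubini') measurable
  also have "\<dots> = (\<integral>\<^sup>+ w. ennreal (gauss_density w) * \<phi> w * (p * (\<integral>\<^sup>+ z. ennreal (gauss_density (c *\<^sub>R (z - b *\<^sub>R w))) \<partial>lborel)) \<partial>lborel)"
    using key by (auto simp: ennreal_mult mult_ac simp flip: nn_integral_cmult intro!: nn_integral_cong)
  also have "\<dots> = (\<integral>\<^sup>+ w. ennreal (gauss_density w) * \<phi> w \<partial>lborel)"
  proof -
    have "p * (\<integral>\<^sup>+ z. ennreal (gauss_density (c *\<^sub>R (z - b *\<^sub>R w))) \<partial>lborel) = 1" for w :: 'a
      using nn_integral_lborel_affine[of "\<lambda>z. ennreal (gauss_density z)" c "- (c * b) *\<^sub>R w"] c
      by (simp add: p_def nn_integral_gauss_density algebra_simps)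
    then show ?thesis by simp
  qed
  also have "\<dots> = (\<integral>\<^sup>+ z. \<phi> z \<partial>std_gauss)" by (subst nn_integral_std_gauss) auto
  finally show ?thesis .
qed

section \<open>Smooth and strongly convex potentials\<close>

locale smooth_strongly_convex =
  fixes f :: "'a::euclidean_space \<Rightarrow> real" and g :: "'a \<Rightarrow> 'a" and m M :: real
  assumes m_pos: "0 < m" and m_le_M: "m \<le> M"
    and gradient: "\<And>x. GDERIV f x :> g x"
    and strong_convexity: "\<And>x y. f x - f y - g y \<bullet> (x - y) \<ge> m / 2 * (norm (x - y))\<^sup>2"
    and lipschitz: "\<And>x y. norm (g x - g y) \<le> M * norm (x - y)"
begin

lemma M_pos: "0 < M" using m_pos m_le_M by simp

lemma f_continuous: "continuous_on S f"
proof (intro continuous_at_imp_continuous_on ballI)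
  show "isCont f x" for x
    using gradient[of x] unfolding gderiv_def by (rule has_derivative_continuous)
qed

lemma g_continuous: "continuous_on S g"
  unfolding continuous_on_iff dist_norm
proof (intro ballI allI impI)
  fix x and e :: real assume "0 < e"
  show "\<exists>d>0. \<forall>x'\<in>S. norm (x' - x) < d \<longrightarrow> norm (g x' - g x) < e"
  proof (intro exI[of _ "e / M"] conjI ballI impI)
    fix x' assume "norm (x' - x) < e / M"
    then have "M * norm (x' - x) < e" using M_pos by (simp add: field_simps)
    then show "norm (g x' - g x) < e" using lipschitz[of x' x] by simp
  qed (use \<open>0 < e\<close> M_pos in simp)
qed

lemma f_measurable [measurable]: "f \<in> borel_measurable borel"
  by (rule borel_measurable_continuous_onI[OF f_continuous])

lemma g_measurable [measurable]: "g \<in> borel_measurable borel"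
  by (rule borel_measurable_continuous_onI[OF g_continuous])

lemma f_line_derivative: "((\<lambda>t. f (x + t *\<^sub>R z)) has_real_derivative (g (x + r *\<^sub>R z) \<bullet> z)) (at r)"
proof -
  have "(f has_derivative (\<lambda>h. h \<bullet> g (x + r *\<^sub>R z))) (at (x + r *\<^sub>R z))"
    using gradient by (simp add: gderiv_def)
  then have "((\<lambda>t. f (x + t *\<^sub>R z)) has_derivative (\<lambda>t. (t *\<^sub>R z) \<bullet> g (x + r *\<^sub>R z))) (at r)"
    by (rule has_derivative_compose[rotated]) (auto intro!: derivative_eq_intros)
  moreover have "(\<lambda>t. (t *\<^sub>R z) \<bullet> g (x + r *\<^sub>R z)) = (*) (g (x + r *\<^sub>R z) \<bullet> z)"
    by (auto simp: inner_commute mult.commute)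
  ultimately show ?thesis by (simp add: has_field_derivative_def)
qed

lemma convexity: "g y \<bullet> (x - y) \<le> f x - f y"
proof -
  have "0 \<le> m / 2 * (norm (x - y))\<^sup>2" using m_pos by simp
  then show ?thesis using strong_convexity[of x y] by linarith
qed

lemma descent: "f x - f y - g y \<bullet> (x - y) \<le> M / 2 * (norm (x - y))\<^sup>2"
proof -
  define z where "z = x - y"
  define \<phi> where "\<phi> t = f (y + t *\<^sub>R z) - t * (g y \<bullet> z) - M * t\<^sup>2 / 2 * (norm z)\<^sup>2" for t
  have "\<phi> 1 \<le> \<phi> 0"
  proof (rule DERIV_nonpos_imp_nonincreasing[where f=\<phi> and a=0 and b=1])
    fix t :: real assume t: "0 \<le> t" "t \<le> 1"
    have "(\<phi> has_real_derivative (g (y + t *\<^sub>R z) \<bullet> z - g y \<bullet> z - M * t * (norm z)\<^sup>2)) (at t)"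
      unfolding \<phi>_def by (auto intro!: derivative_eq_intros f_line_derivative)
    moreover have "g (y + t *\<^sub>R z) \<bullet> z - g y \<bullet> z - M * t * (norm z)\<^sup>2 \<le> 0"
    proof -
      have "(g (y + t *\<^sub>R z) - g y) \<bullet> z \<le> norm (g (y + t *\<^sub>R z) - g y) * norm z"
        by (rule norm_cauchy_schwarz)
      also have "\<dots> \<le> (M * (t * norm z)) * norm z"
        using lipschitz[of "y + t *\<^sub>R z" y] t by (intro mult_right_mono) auto
      finally show ?thesis by (simp add: inner_diff_left power2_eq_square mult_ac)
    qed
    ultimately show "\<exists>d. (\<phi> has_real_derivative d) (at t) \<and> d \<le> 0" by blast
  qed simp
  then show ?thesis by (simp add: \<phi>_def z_def)
qed

text \<open>The function \<open>F = f - m/2 \<parallel>\<cdot>\<parallel>\<^sup>2\<close> is convex with gradient \<open>G\<close>, and it lies below its quadratic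
  models of curvature \<open>M - m\<close>. Comparing the tangent plane at \<open>y\<close> with the quadratic model at \<open>x\<close> in
  the point that minimises the difference gives half of the claim; exchanging \<open>x\<close> and \<open>y\<close> gives the
  other half.\<close>

lemma cocoercivity:
  defines "G \<equiv> \<lambda>x. g x - m *\<^sub>R x"
  shows "(norm (G x - G y))\<^sup>2 \<le> (M - m) * ((G x - G y) \<bullet> (x - y))"
    and "0 \<le> (G x - G y) \<bullet> (x - y)"
proof -
  define F where "F x = f x - m / 2 * (norm x)\<^sup>2" for x
  have sq: "(norm x)\<^sup>2 = (norm y)\<^sup>2 + 2 * (y \<bullet> (x - y)) + (norm (x - y))\<^sup>2" for x y :: 'a
    by (simp add: power2_norm_eq_inner inner_diff_left inner_diff_right inner_commute)
  have sqm: "m / 2 * (norm x)\<^sup>2 = m / 2 * (norm y)\<^sup>2 + m * (y \<bullet> (x - y)) + m / 2 * (norm (x - y))\<^sup>2" for x y :: 'a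
    unfolding sq[of x y] by (simp add: algebra_simps)
  have G: "G y \<bullet> (x - y) = g y \<bullet> (x - y) - m * (y \<bullet> (x - y))" for x y
    by (simp add: G_def inner_diff_left)
  have lo: "0 \<le> F x - F y - G y \<bullet> (x - y)" for x y
    using strong_convexity[of x y] sqm[of x y] unfolding F_def G by linarith
  have up: "F x - F y - G y \<bullet> (x - y) \<le> (M - m) / 2 * (norm (x - y))\<^sup>2" for x y
  proof -
    have "(M - m) / 2 * (norm (x - y))\<^sup>2 = M / 2 * (norm (x - y))\<^sup>2 - m / 2 * (norm (x - y))\<^sup>2"
      by (simp add: algebra_simps diff_divide_distrib)
    then show ?thesis using descent[of x y] sqm[of x y] unfolding F_def G by linarith
  qed
  show nonneg: "0 \<le> (G x - G y) \<bullet> (x - y)"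
    using lo[of x y] lo[of y x] by (simp add: inner_diff_left inner_diff_right)
  have half: "F x - F y \<ge> G y \<bullet> (x - y) + (norm (G x - G y))\<^sup>2 / (2 * L)"
    if L: "0 < L" "M - m \<le> L" for L x y
  proof -
    define d where "d = G x - G y"
    \<comment> \<open>The minimiser of the quadratic model with curvature \<open>L\<close> at \<open>x\<close> minus the tangent plane at \<open>y\<close>.\<close>
    define z where "z = x - (1 / L) *\<^sub>R d"
    have n: "(norm (z - x))\<^sup>2 = (norm d)\<^sup>2 / L\<^sup>2" by (simp add: z_def power_divide)
    have "F y + G y \<bullet> (z - y) \<le> F z" using lo[of z y] by simp
    also have "F z \<le> F x + G x \<bullet> (z - x) + (M - m) / 2 * (norm (z - x))\<^sup>2" using up[of z x] by simp
    also have "\<dots> \<le> F x + G x \<bullet> (z - x) + L / 2 * (norm (z - x))\<^sup>2"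
      using L by (intro add_left_mono mult_right_mono) auto
    finally have "F y + G y \<bullet> (z - y) \<le> F x + G x \<bullet> (z - x) + L / 2 * (norm (z - x))\<^sup>2" .
    moreover have "G y \<bullet> (z - y) - G x \<bullet> (z - x) = G y \<bullet> (x - y) + (norm d)\<^sup>2 / L"
    proof -
      have "G y \<bullet> (z - y) - G x \<bullet> (z - x) = G y \<bullet> (x - y) - d \<bullet> (z - x)"
        by (simp add: d_def inner_diff_left inner_diff_right)
      also have "d \<bullet> (z - x) = - ((norm d)\<^sup>2 / L)" by (simp add: z_def power2_norm_eq_inner)
      finally show ?thesis by simp
    qed
    moreover have "L / 2 * (norm (z - x))\<^sup>2 = (norm d)\<^sup>2 / (2 * L)"
      unfolding n using L by (simp add: power2_eq_square)
    moreover have "(norm d)\<^sup>2 / L = (norm d)\<^sup>2 / (2 * L) + (norm d)\<^sup>2 / (2 * L)" by simp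
    ultimately show ?thesis unfolding d_def by linarith
  qed
  \<comment> \<open>Positive curvatures \<open>L \<ge> M - m\<close> are used because \<open>M - m\<close> itself may be zero.\<close>
  have each: "(norm (G x - G y))\<^sup>2 \<le> L * ((G x - G y) \<bullet> (x - y))" if L: "0 < L" "M - m \<le> L" for L
  proof -
    have "G y \<bullet> (x - y) + G x \<bullet> (y - x) + (norm (G x - G y))\<^sup>2 / L \<le> 0"
      using half[OF L, of y x] half[OF L, of x y] by (simp add: norm_minus_commute)
    then have "(norm (G x - G y))\<^sup>2 / L \<le> (G x - G y) \<bullet> (x - y)"
      by (simp add: inner_diff_left inner_diff_right)
    then show ?thesis using L by (simp add: field_simps)
  qed
  show "(norm (G x - G y))\<^sup>2 \<le> (M - m) * ((G x - G y) \<bullet> (x - y))"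
  proof (rule field_le_epsilon)
    fix e :: real assume e: "0 < e"
    define q where "q = (G x - G y) \<bullet> (x - y)"
    define d where "d = e / (q + 1)"
    have q: "0 \<le> q" using nonneg by (simp add: q_def)
    then have d: "0 < d" "d * q \<le> e" using e by (auto simp: d_def field_simps)
    have "(norm (G x - G y))\<^sup>2 \<le> (M - m + d) * q"
      unfolding q_def using d m_le_M by (intro each) auto
    then show "(norm (G x - G y))\<^sup>2 \<le> (M - m) * ((G x - G y) \<bullet> (x - y)) + e"
      using d unfolding q_def[symmetric] distrib_right by linarith
  qed
qed

text \<open>This is \<open>max (1 - m h) (M h - 1)\<close>: the two expressions agree at \<open>h = 2 / (m + M)\<close>.\<close>

definition contraction_factor :: "real \<Rightarrow> real" where
  "contraction_factor h = (if h \<le> 2 / (m + M) then 1 - m * h else M * h - 1)"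

lemma contraction_factor_bounds:
  assumes "0 < h" "h < 2 / M"
  shows "0 \<le> contraction_factor h" "contraction_factor h < 1"
proof -
  have mM: "0 < m + M" using m_pos M_pos by simp
  show "0 \<le> contraction_factor h"
  proof (cases "h \<le> 2 / (m + M)")
    case True
    have "m * h \<le> m * (2 / (m + M))" using True m_pos by (intro mult_left_mono) auto
    also have "\<dots> \<le> 1" using mM m_le_M by (simp add: field_simps)
    finally show ?thesis using True by (simp add: contraction_factor_def)
  next
    case False
    have "1 \<le> M * (2 / (m + M))" using mM m_le_M by (simp add: field_simps)
    also have "\<dots> \<le> M * h" using False M_pos by (intro mult_left_mono) auto
    finally show ?thesis using False by (simp add: contraction_factor_def)
  qed
  have "M * h < 2" using assms M_pos by (simp add: field_simps)
  then show "contraction_factor h < 1" using assms m_pos by (simp add: contraction_factor_def)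
qed

text \<open>With \<open>d = x - y\<close> and \<open>\<gamma>\<close> the increment of \<open>\<nabla>f - m id\<close>, the difference of the two images is
  \<open>(1 - m h) d - h \<gamma>\<close>. Co-coercivity bounds its squared norm by an affine function of \<open>q = \<gamma> \<bullet> d\<close>, where
  \<open>0 \<le> q \<le> (M - m) \<parallel>d\<parallel>\<^sup>2\<close>; which end of this range is extremal depends on the sign of
  \<open>h (m + M) - 2\<close>.\<close>

lemma gradient_step_contraction:
  assumes h: "0 < h" "h < 2 / M"
  shows "norm ((x - h *\<^sub>R g x) - (y - h *\<^sub>R g y)) \<le> contraction_factor h * norm (x - y)"
proof -
  define d where "d = x - y"
  define \<gamma> where "\<gamma> = (g x - m *\<^sub>R x) - (g y - m *\<^sub>R y)"
  define q where "q = \<gamma> \<bullet> d"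
  have mM: "0 < m + M" using m_pos M_pos by simp
  have q0: "0 \<le> q" and q1: "(norm \<gamma>)\<^sup>2 \<le> (M - m) * q"
    using cocoercivity[of x y] by (simp_all add: q_def \<gamma>_def d_def)
  have q2: "q \<le> (M - m) * (norm d)\<^sup>2"
  proof -
    have "q\<^sup>2 \<le> (norm \<gamma>)\<^sup>2 * (norm d)\<^sup>2"
      using Cauchy_Schwarz_ineq[of \<gamma> d] by (simp add: q_def power2_norm_eq_inner)
    also have "\<dots> \<le> (M - m) * q * (norm d)\<^sup>2" using q1 by (intro mult_right_mono) auto
    finally have "q * q \<le> q * ((M - m) * (norm d)\<^sup>2)" by (simp add: power2_eq_square mult_ac)
    then show ?thesis using q0 m_le_M by (cases "q = 0") auto
  qed
  have eq: "(x - h *\<^sub>R g x) - (y - h *\<^sub>R g y) = (1 - m * h) *\<^sub>R d - h *\<^sub>R \<gamma>"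
    by (simp add: d_def \<gamma>_def algebra_simps)
  have "(norm ((1 - m * h) *\<^sub>R d - h *\<^sub>R \<gamma>))\<^sup>2
      = (1 - m * h)\<^sup>2 * (norm d)\<^sup>2 - 2 * h * (1 - m * h) * q + h\<^sup>2 * (norm \<gamma>)\<^sup>2"
    unfolding power2_norm_eq_inner q_def
    by (simp add: inner_diff_left inner_diff_right inner_commute[of d \<gamma>] power2_eq_square algebra_simps)
  also have "\<dots> \<le> (1 - m * h)\<^sup>2 * (norm d)\<^sup>2 - 2 * h * (1 - m * h) * q + h\<^sup>2 * ((M - m) * q)"
    using q1 by (intro add_left_mono mult_left_mono) auto
  also have "\<dots> = (1 - m * h)\<^sup>2 * (norm d)\<^sup>2 + h * (h * (m + M) - 2) * q"
    by (simp add: power2_eq_square algebra_simps)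
  also have "\<dots> \<le> (contraction_factor h)\<^sup>2 * (norm d)\<^sup>2"
  proof (cases "h \<le> 2 / (m + M)")
    case True
    then have "h * (m + M) - 2 \<le> 0" using mM by (simp add: field_simps)
    then have "h * (h * (m + M) - 2) * q \<le> 0"
      using h q0 by (intro mult_nonpos_nonneg mult_nonneg_nonpos) auto
    then show ?thesis using True by (simp add: contraction_factor_def)
  next
    case False
    then have "0 \<le> h * (m + M) - 2" using mM by (simp add: field_simps)
    then have "h * (h * (m + M) - 2) * q \<le> h * (h * (m + M) - 2) * ((M - m) * (norm d)\<^sup>2)"
      using h q2 by (intro mult_left_mono) auto
    then have "(1 - m * h)\<^sup>2 * (norm d)\<^sup>2 + h * (h * (m + M) - 2) * q
      \<le> ((1 - m * h)\<^sup>2 + h * (h * (m + M) - 2) * (M - m)) * (norm d)\<^sup>2"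
      by (simp add: algebra_simps)
    also have "(1 - m * h)\<^sup>2 + h * (h * (m + M) - 2) * (M - m) = (M * h - 1)\<^sup>2"
      by (simp add: power2_eq_square algebra_simps)
    finally show ?thesis using False by (simp add: contraction_factor_def)
  qed
  finally have "(norm ((1 - m * h) *\<^sub>R d - h *\<^sub>R \<gamma>))\<^sup>2 \<le> (contraction_factor h * norm d)\<^sup>2"
    by (simp add: power_mult_distrib)
  moreover have "0 \<le> contraction_factor h" by (rule contraction_factor_bounds(1)[OF h])
  ultimately show ?thesis
    unfolding eq d_def[symmetric] by (intro power2_le_imp_le[OF _ mult_nonneg_nonneg]) auto
qed

lemma lower_bound: "f 0 - norm (g 0) * norm x + m / 2 * (norm x)\<^sup>2 \<le> f x"
proof -
  have "- (norm (g 0) * norm x) \<le> g 0 \<bullet> x"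
    using Cauchy_Schwarz_ineq2[of "g 0" x] by linarith
  then show ?thesis using strong_convexity[of x 0] by simp
qed

lemma integrable_poly_growth:
  assumes "\<phi> \<in> borel_measurable borel" and "\<And>x. \<bar>\<phi> x\<bar> \<le> C * (1 + norm x) ^ k"
  shows "integrable lborel (\<lambda>x. \<phi> x * exp (- f x))"
  by (rule integrable_poly_exp_neg[OF _ lower_bound _ assms]) (use m_pos in auto)

definition "Z = (\<integral> x. exp (- f x) \<partial>lborel)"
definition "\<pi> = gibbs_measure f"

lemma integrable_exp_neg: "integrable lborel (\<lambda>x. exp (- f x))"
  using integrable_poly_growth[of "\<lambda>_. 1" 1 0] by simp

lemma Z_pos: "0 < Z"
proof -
  have "Z \<noteq> 0"
  proof
    assume "Z = 0"
    then have "AE x in lborel. exp (- f x) = 0"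
      using integral_nonneg_eq_0_iff_AE[OF integrable_exp_neg] by (simp add: Z_def)
    then have "AE x in (lborel::'a measure). False" by simp
    then show False
      using ae_filter_eq_bot_iff[of "lborel::'a measure"] by (simp add: trivial_limit_def)
  qed
  moreover have "0 \<le> Z" unfolding Z_def by (rule Bochner_Integration.integral_nonneg) simp
  ultimately show ?thesis by simp
qed

lemma \<pi>_eq: "\<pi> = density lborel (\<lambda>x. ennreal (exp (- f x) / Z))"
  by (simp add: \<pi>_def gibbs_measure_def Z_def)

lemma sets_\<pi> [simp, measurable_cong]: "sets \<pi> = sets borel"
  by (simp add: \<pi>_eq)

lemma space_\<pi> [simp]: "space \<pi> = UNIV"
  by (simp add: \<pi>_eq)

lemma prob_space_\<pi>: "prob_space \<pi>"
proof (rule prob_spaceI)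
  have "emeasure \<pi> UNIV = (\<integral>\<^sup>+ x. ennreal (exp (- f x) / Z) \<partial>lborel)"
    by (simp add: \<pi>_eq emeasure_density)
  also have "\<dots> = ennreal (\<integral> x. exp (- f x) / Z \<partial>lborel)"
    using Z_pos integrable_exp_neg by (intro nn_integral_eq_integral) auto
  also have "\<dots> = 1" using Z_pos by (simp flip: Z_def)
  finally show "emeasure \<pi> (space \<pi>) = 1" by simp
qed

lemma integrable_\<pi>:
  fixes \<phi> :: "'a \<Rightarrow> real"
  assumes [measurable]: "\<phi> \<in> borel_measurable borel" and "\<And>x. \<bar>\<phi> x\<bar> \<le> C * (1 + norm x) ^ k"
  shows "integrable \<pi> \<phi>"
proof -
  have "integrable lborel (\<lambda>x. (1 / Z) * (\<phi> x * exp (- f x)))"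
    by (intro integrable_mult_right integrable_poly_growth[OF assms])
  then show ?thesis using Z_pos by (simp add: \<pi>_eq integrable_density mult_ac)
qed

lemma integral_\<pi>:
  fixes \<phi> :: "'a \<Rightarrow> real"
  assumes [measurable]: "\<phi> \<in> borel_measurable borel"
  shows "(\<integral> x. \<phi> x \<partial>\<pi>) = (\<integral> x. \<phi> x * exp (- f x) \<partial>lborel) / Z"
  using Z_pos by (simp add: \<pi>_eq integral_density mult_ac)

lemma norm_g_growth: "norm (g x) \<le> (norm (g 0) + M) * (1 + norm x)"
proof -
  have "norm (g x) \<le> norm (g 0) + norm (g x - g 0)" by (rule norm_triangle_sub)
  also have "\<dots> \<le> norm (g 0) + M * norm x" using lipschitz[of x 0] by simp
  also have "\<dots> \<le> (norm (g 0) + M) * (1 + norm x)" using M_pos by (simp add: algebra_simps)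
  finally show ?thesis .
qed

lemma f_increment: "\<bar>f (x + z) - f x - g x \<bullet> z\<bar> \<le> M * (norm z)\<^sup>2"
proof -
  have "f (x + z) - f x - g x \<bullet> z \<le> M / 2 * (norm z)\<^sup>2" using descent[of "x + z" x] by simp
  also have "\<dots> \<le> M * (norm z)\<^sup>2" using M_pos by (intro mult_right_mono) auto
  finally show ?thesis using convexity[of x "x + z"] by simp
qed

text \<open>Formally, integration by parts gives \<open>E (\<partial>\<^sub>e f)\<^sup>2 = E \<partial>\<^sub>e\<partial>\<^sub>e f \<le> M\<close>, but \<open>f\<close> need not be twice
  differentiable. The difference quotient of \<open>f\<close> in the direction \<open>e\<close> is differentiable, its derivative
  is at most \<open>M\<close> by the Lipschitz condition, and it is within \<open>M t\<close> of \<open>\<partial>\<^sub>e f\<close>. So the argument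
  applies to it, and \<open>t\<close> tends to zero.\<close>

lemma expectation_directional_derivative_squared:
  assumes "norm e = 1"
  shows "(\<integral> x. (g x \<bullet> e)\<^sup>2 \<partial>\<pi>) \<le> M"
proof -
  define A where "A = norm (g 0) + M"
  have A: "0 \<le> A" using M_pos by (simp add: A_def)
  have ge: "\<bar>g x \<bullet> e\<bar> \<le> A * (1 + norm x)" for x
    using Cauchy_Schwarz_ineq2[of "g x" e] norm_g_growth[of x] assms by (simp add: A_def)
  have ge2: "\<bar>(g x \<bullet> e)\<^sup>2\<bar> \<le> A\<^sup>2 * (1 + norm x) ^ 2" for x
    using power_mono[OF ge[of x], of 2] by (simp add: power_mult_distrib)
  have ige: "integrable \<pi> (\<lambda>x. \<bar>g x \<bullet> e\<bar>)"
    by (rule integrable_\<pi>[where C=A and k=1]) (use ge in auto)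
  have ige2: "integrable \<pi> (\<lambda>x. (g x \<bullet> e)\<^sup>2)"
    by (rule integrable_\<pi>[OF _ ge2]) auto
  define I where "I = (\<integral> x. \<bar>g x \<bullet> e\<bar> \<partial>\<pi>)"
  define J where "J = (\<integral> x. (g x \<bullet> e)\<^sup>2 \<partial>\<pi>)"
  have I: "0 \<le> I" by (simp add: I_def)
  have main: "t * J \<le> M * t + M * t\<^sup>2 * I" if t: "0 < t" "t \<le> 1" for t
  proof -
    \<comment> \<open>Up to the factor \<open>t\<close>, the difference quotient of \<open>f\<close> and its derivative along \<open>e\<close>.\<close>
    define \<Delta> where "\<Delta> x = f (x + t *\<^sub>R e) - f x" for x
    define \<Gamma> where "\<Gamma> x = (g (x + t *\<^sub>R e) - g x) \<bullet> e" for x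
    have [measurable]: "\<Delta> \<in> borel_measurable borel" "\<Gamma> \<in> borel_measurable borel"
      unfolding \<Delta>_def \<Gamma>_def by measurable
    have \<Delta>: "\<bar>\<Delta> x - t * (g x \<bullet> e)\<bar> \<le> M * t\<^sup>2" for x
      using f_increment[of x "t *\<^sub>R e"] assms by (simp add: \<Delta>_def power_mult_distrib)
    have \<Gamma>: "\<bar>\<Gamma> x\<bar> \<le> M * t" for x
    proof -
      have "\<bar>\<Gamma> x\<bar> \<le> norm (g (x + t *\<^sub>R e) - g x) * norm e" unfolding \<Gamma>_def by (rule Cauchy_Schwarz_ineq2)
      also have "\<dots> \<le> M * t" using lipschitz[of "x + t *\<^sub>R e" x] assms t by simp
      finally show ?thesis .
    qed
    have g\<Delta>: "\<bar>\<Delta> x\<bar> \<le> (A + M) * (1 + norm x)" for x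
    proof -
      have "t * \<bar>g x \<bullet> e\<bar> \<le> 1 * (A * (1 + norm x))" using ge[of x] t by (intro mult_mono) auto
      moreover have "M * t\<^sup>2 \<le> M * (1 * (1 + norm x))"
        using t M_pos power_mono[of t 1 2] norm_ge_zero[of x] by (intro mult_left_mono) (auto simp del: norm_ge_zero)
      moreover have "\<bar>t * (g x \<bullet> e)\<bar> = t * \<bar>g x \<bullet> e\<bar>" using t by (simp add: abs_mult)
      ultimately have "\<bar>\<Delta> x\<bar> \<le> 1 * (A * (1 + norm x)) + M * (1 * (1 + norm x))"
        using \<Delta>[of x] by linarith
      then show ?thesis by (simp add: algebra_simps)
    qed
    have g\<Delta>g: "\<bar>\<Delta> x * (g x \<bullet> e)\<bar> \<le> ((A + M) * A) * (1 + norm x) ^ 2" for x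
    proof -
      have "\<bar>\<Delta> x * (g x \<bullet> e)\<bar> \<le> ((A + M) * (1 + norm x)) * (A * (1 + norm x))"
        unfolding abs_mult using A M_pos by (intro mult_mono g\<Delta> ge) auto
      then show ?thesis by (simp add: power2_eq_square mult_ac)
    qed
    have i\<Delta>: "integrable lborel (\<lambda>x. \<Delta> x * exp (- f x))"
      by (rule integrable_poly_growth[where k=1]) (use g\<Delta> in auto)
    have i\<Gamma>: "integrable lborel (\<lambda>x. \<Gamma> x * exp (- f x))"
      by (rule integrable_poly_growth[where k=0]) (use \<Gamma> in auto)
    have i\<Delta>g: "integrable lborel (\<lambda>x. (\<Delta> x * (g x \<bullet> e)) * exp (- f x))"
      by (rule integrable_poly_growth[OF _ g\<Delta>g]) auto
    have "(\<integral> x. \<Gamma> x * exp (- f x) - (\<Delta> x * (g x \<bullet> e)) * exp (- f x) \<partial>lborel) = 0"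
    proof (rule integral_directional_derivative_eq_0[where u="\<lambda>x. \<Delta> x * exp (- f x)" and e=e])
      show "((\<lambda>r. \<Delta> (x + r *\<^sub>R e) * exp (- f (x + r *\<^sub>R e))) has_real_derivative
        \<Gamma> x * exp (- f x) - (\<Delta> x * (g x \<bullet> e)) * exp (- f x)) (at 0)" for x
      proof -
        have 1: "((\<lambda>r. f (x + r *\<^sub>R e)) has_real_derivative (g x \<bullet> e)) (at 0)"
          using f_line_derivative[of x e 0] by simp
        have 2: "((\<lambda>r. f (x + r *\<^sub>R e + t *\<^sub>R e)) has_real_derivative (g (x + t *\<^sub>R e) \<bullet> e)) (at 0)"
          using f_line_derivative[of "x + t *\<^sub>R e" e 0] by (simp add: add_ac)
        have "((\<lambda>r. \<Delta> (x + r *\<^sub>R e)) has_real_derivative \<Gamma> x) (at 0)"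
          using DERIV_diff[OF 2 1] by (simp add: \<Delta>_def \<Gamma>_def inner_diff_left)
        moreover have "((\<lambda>r. exp (- f (x + r *\<^sub>R e))) has_real_derivative (exp (- f x) * - (g x \<bullet> e))) (at 0)"
          using DERIV_fun_exp[OF DERIV_minus[OF 1]] by simp
        ultimately show ?thesis using DERIV_mult[of "\<lambda>r. \<Delta> (x + r *\<^sub>R e)" "\<Gamma> x" 0 UNIV "\<lambda>r. exp (- f (x + r *\<^sub>R e))" "exp (- f x) * - (g x \<bullet> e)"]
          by (simp add: mult_ac)
      qed
      show "continuous_on UNIV (\<lambda>x. \<Gamma> x * exp (- f x) - \<Delta> x * (g x \<bullet> e) * exp (- f x))"
        unfolding \<Gamma>_def \<Delta>_def
        by (intro continuous_intros continuous_on_compose2[OF f_continuous[of UNIV]]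
            continuous_on_compose2[OF g_continuous[of UNIV]]) auto
    qed (use i\<Delta> i\<Gamma> i\<Delta>g in auto)
    then have "(\<integral> x. \<Delta> x * (g x \<bullet> e) \<partial>\<pi>) = (\<integral> x. \<Gamma> x \<partial>\<pi>)"
      using i\<Delta>g i\<Gamma> by (simp add: integral_\<pi>)
    also have "\<dots> \<le> M * t"
    proof -
      interpret prob_space \<pi> by (rule prob_space_\<pi>)
      have i: "integrable \<pi> \<Gamma>" by (rule integrable_\<pi>[where k=0]) (use \<Gamma> in auto)
      show ?thesis by (rule integral_le_const[OF i]) (use \<Gamma> in \<open>auto simp: abs_le_iff\<close>)
    qed
    finally have 3: "(\<integral> x. \<Delta> x * (g x \<bullet> e) \<partial>\<pi>) \<le> M * t" .
    have ii: "integrable \<pi> (\<lambda>x. \<Delta> x * (g x \<bullet> e))"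
      by (rule integrable_\<pi>[OF _ g\<Delta>g]) auto
    have "t * J = (\<integral> x. t * (g x \<bullet> e)\<^sup>2 \<partial>\<pi>)" by (simp add: J_def)
    also have "\<dots> \<le> (\<integral> x. \<Delta> x * (g x \<bullet> e) + M * t\<^sup>2 * \<bar>g x \<bullet> e\<bar> \<partial>\<pi>)"
    proof (rule integral_mono)
      fix x
      have "(t * (g x \<bullet> e) - \<Delta> x) * (g x \<bullet> e) \<le> \<bar>t * (g x \<bullet> e) - \<Delta> x\<bar> * \<bar>g x \<bullet> e\<bar>"
        unfolding abs_mult[symmetric] by simp
      also have "\<dots> \<le> M * t\<^sup>2 * \<bar>g x \<bullet> e\<bar>"
        using \<Delta>[of x] by (intro mult_right_mono) (auto simp: abs_minus_commute)
      finally show "t * (g x \<bullet> e)\<^sup>2 \<le> \<Delta> x * (g x \<bullet> e) + M * t\<^sup>2 * \<bar>g x \<bullet> e\<bar>"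
        by (simp add: power2_eq_square algebra_simps)
    qed (use ige ige2 ii in auto)
    also have "\<dots> = (\<integral> x. \<Delta> x * (g x \<bullet> e) \<partial>\<pi>) + M * t\<^sup>2 * I"
      using ii ige by (simp add: I_def)
    finally show ?thesis using 3 by simp
  qed
  have "J \<le> M"
  proof (rule field_le_epsilon)
    fix \<epsilon> :: real assume \<epsilon>: "0 < \<epsilon>"
    define t where "t = min 1 (\<epsilon> / (M * I + 1))"
    have MI: "0 \<le> M * I" using M_pos I by simp
    have t: "0 < t" "t \<le> 1" using \<epsilon> MI by (auto simp: t_def)
    have "t * J \<le> t * (M + t * (M * I))" using main[OF t] by (simp add: power2_eq_square algebra_simps)
    then have "J \<le> M + t * (M * I)" using t by simp
    also have "t * (M * I) \<le> \<epsilon> / (M * I + 1) * (M * I)"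
      using MI by (intro mult_right_mono) (auto simp: t_def)
    also have "\<dots> \<le> \<epsilon>" using \<epsilon> MI by (simp add: field_simps)
    finally show "J \<le> M + \<epsilon>" by simp
  qed
  then show ?thesis by (simp add: J_def)
qed

lemma expectation_norm_gradient_squared: 
  "(\<integral>\<^sup>+ x. ennreal ((norm (g x))\<^sup>2) \<partial>\<pi>) \<le> ennreal (M * DIM('a))"
proof -
  define A where "A = norm (g 0) + M"
  have A: "0 \<le> A" using M_pos by (simp add: A_def)
  have i: "integrable \<pi> (\<lambda>x. (g x \<bullet> b)\<^sup>2)" if "b \<in> Basis" for b
  proof (rule integrable_\<pi>[where C="A\<^sup>2" and k=2])
    fix x
    have "\<bar>g x \<bullet> b\<bar> \<le> A * (1 + norm x)"
      using Basis_le_norm[OF that, of "g x"] norm_g_growth[of x] by (simp add: A_def)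
    from power_mono[OF this, of 2] show "\<bar>(g x \<bullet> b)\<^sup>2\<bar> \<le> A\<^sup>2 * (1 + norm x) ^ 2"
      by (simp add: power_mult_distrib)
  qed simp
  have sq: "(norm (g x))\<^sup>2 = (\<Sum>b\<in>Basis. (g x \<bullet> b)\<^sup>2)" for x
    unfolding power2_norm_eq_inner euclidean_inner[of "g x" "g x"] by (simp add: power2_eq_square)
  have "(\<integral>\<^sup>+ x. ennreal ((norm (g x))\<^sup>2) \<partial>\<pi>) = ennreal (\<integral> x. (norm (g x))\<^sup>2 \<partial>\<pi>)"
    using i by (intro nn_integral_eq_integral) (auto simp: sq intro!: AE_I2 sum_nonneg)
  also have "(\<integral> x. (norm (g x))\<^sup>2 \<partial>\<pi>) = (\<Sum>b\<in>Basis. \<integral> x. (g x \<bullet> b)\<^sup>2 \<partial>\<pi>)"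
    unfolding sq using i by (rule Bochner_Integration.integral_sum)
  also have "\<dots> \<le> (\<Sum>b\<in>(Basis::'a set). M)"
    by (intro sum_mono expectation_directional_derivative_squared) simp
  finally show ?thesis by (simp add: ennreal_leI mult.commute)
qed

end

section \<open>One Metropolis step for the target measure\<close>

definition unit_uniform :: "real measure" where
  "unit_uniform = uniform_measure lborel {0..1}"

lemma sets_unit_uniform [simp, measurable_cong]: "sets unit_uniform = sets borel"
  by (simp add: unit_uniform_def)

lemma prob_space_unit_uniform: "prob_space unit_uniform"
  unfolding unit_uniform_def by (rule prob_space_uniform_measure) auto

lemma nn_integral_unit_uniform_threshold:
  assumes "0 \<le> a"
  shows "(\<integral>\<^sup>+ u. (if u \<le> a then A else B) \<partial>unit_uniform)
    = ennreal (min 1 a) * A + ennreal (1 - min 1 a) * B"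
proof -
  interpret prob_space unit_uniform by (rule prob_space_unit_uniform)
  have "{0..1} \<inter> {..a} = {0..min 1 a}" by auto
  then have 1: "emeasure unit_uniform {..a} = ennreal (min 1 a)"
    using assms by (simp add: unit_uniform_def min_def divide_ennreal_def)
  have "{0..1} \<inter> {a<..} = (if a < 1 then {a<..1} else {})" using assms by auto
  then have 2: "emeasure unit_uniform {a<..} = ennreal (1 - min 1 a)"
    using assms by (simp add: unit_uniform_def min_def divide_ennreal_def)
  have "(\<integral>\<^sup>+ u. (if u \<le> a then A else B) \<partial>unit_uniform)
      = (\<integral>\<^sup>+ u. A * indicator {..a} u + B * indicator {a<..} u \<partial>unit_uniform)"
    by (intro nn_integral_cong) (auto split: split_indicator)
  also have "\<dots> = A * emeasure unit_uniform {..a} + B * emeasure unit_uniform {a<..}"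
    by (subst nn_integral_add) (auto simp: nn_integral_cmult_indicator)
  finally show ?thesis by (simp add: 1 2 mult.commute)
qed

lemma rejection_probability_bounds:
  fixes D :: real
  defines "r \<equiv> 1 - min 1 (exp (- D))"
  shows "0 \<le> r" "r \<le> 1" "r \<le> max 0 D" "\<bar>r - max 0 D\<bar> \<le> D\<^sup>2"
proof -
  show "0 \<le> r" "r \<le> 1" by (auto simp: r_def)
  have e: "1 - D \<le> exp (- D)" using exp_ge_add_one_self[of "- D"] by simp
  then show 1: "r \<le> max 0 D" by (auto simp: r_def)
  show "\<bar>r - max 0 D\<bar> \<le> D\<^sup>2"
  proof (cases "D \<le> 0")
    case True
    then show ?thesis by (simp add: r_def)
  next
    case False
    have "exp (- D) \<le> 1 - D + D\<^sup>2"
    proof -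
      have "1 \<le> 1 + D * (D * D)" using False by simp
      also have "\<dots> = (1 + D) * (1 - D + D\<^sup>2)" by (simp add: power2_eq_square algebra_simps)
      also have "\<dots> \<le> exp D * (1 - D + D\<^sup>2)"
      proof (intro mult_right_mono)
        have "0 \<le> (D - 1/2)\<^sup>2" by simp
        then show "0 \<le> 1 - D + D\<^sup>2" by (simp add: power2_eq_square algebra_simps)
      qed (rule exp_ge_add_one_self)
      finally show ?thesis by (simp add: exp_minus field_simps)
    qed
    then show ?thesis using False 1 by (auto simp: r_def max_def)
  qed
qed

context smooth_strongly_convex
begin

definition noise :: "('a \<times> real) measure" where
  "noise = std_gauss \<Otimes>\<^sub>M unit_uniform"

definition accept :: "real \<Rightarrow> 'a \<Rightarrow> 'a \<Rightarrow> real" where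
  "accept s v z = min 1 (exp (f v - f (v + s *\<^sub>R z)))"

definition metropolis :: "real \<Rightarrow> 'a \<Rightarrow> 'a \<Rightarrow> real \<Rightarrow> 'a" where
  "metropolis s v z u = (if u \<le> exp (f v - f (v + s *\<^sub>R z)) then v + s *\<^sub>R z else v)"

lemma sets_noise [simp, measurable_cong]: "sets noise = sets (borel \<Otimes>\<^sub>M borel)"
  unfolding noise_def by (intro sets_pair_measure_cong) auto

lemma prob_space_noise: "prob_space noise"
proof -
  interpret A: prob_space "std_gauss::'a measure" by (rule prob_space_std_gauss)
  interpret B: prob_space unit_uniform by (rule prob_space_unit_uniform)
  interpret pair_prob_space "std_gauss::'a measure" unit_uniform ..
  show ?thesis unfolding noise_def by (rule prob_space_axioms)
qed

lemma nn_integral_noise: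
  assumes [measurable]: "\<phi> \<in> borel_measurable (borel \<Otimes>\<^sub>M borel)"
  shows "(\<integral>\<^sup>+ \<zeta>. \<phi> \<zeta> \<partial>noise) = (\<integral>\<^sup>+ z. \<integral>\<^sup>+ u. \<phi> (z, u) \<partial>unit_uniform \<partial>std_gauss)"
proof -
  interpret B: prob_space unit_uniform by (rule prob_space_unit_uniform)
  show ?thesis unfolding noise_def by (subst B.nn_integral_fst[symmetric]) auto
qed

lemma accept_measurable [measurable (raw)]:
  assumes [measurable]: "V \<in> borel_measurable N" "Y \<in> borel_measurable N"
  shows "(\<lambda>x. accept s (V x) (Y x)) \<in> borel_measurable N"
  unfolding accept_def by measurable

lemma metropolis_measurable [measurable (raw)]:
  assumes [measurable]: "V \<in> borel_measurable N" "Y \<in> borel_measurable N" "U \<in> borel_measurable N"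
  shows "(\<lambda>x. metropolis s (V x) (Y x) (U x)) \<in> borel_measurable N"
  unfolding metropolis_def by measurable

lemma accept_bounds: "0 < accept s v z" "accept s v z \<le> 1"
  by (simp_all add: accept_def)

lemma nn_integral_metropolis:
  assumes [measurable]: "(\<lambda>(z, x). \<phi> z x) \<in> borel_measurable (borel \<Otimes>\<^sub>M borel)"
  shows "(\<integral>\<^sup>+ \<zeta>. \<phi> (fst \<zeta>) (metropolis s v (fst \<zeta>) (snd \<zeta>)) \<partial>noise)
    = (\<integral>\<^sup>+ z. ennreal (accept s v z) * \<phi> z (v + s *\<^sub>R z) + ennreal (1 - accept s v z) * \<phi> z v \<partial>std_gauss)"
proof -
  have [measurable]: "(\<lambda>x. \<phi> (Y x) (X x)) \<in> borel_measurable N"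
    if [measurable]: "Y \<in> borel_measurable N" "X \<in> borel_measurable N"
    for X Y and N :: "'b measure"
    using measurable_compose[of "\<lambda>x. (Y x, X x)" N "borel \<Otimes>\<^sub>M borel" "\<lambda>(z, x). \<phi> z x" borel] by simp
  have "(\<integral>\<^sup>+ \<zeta>. \<phi> (fst \<zeta>) (metropolis s v (fst \<zeta>) (snd \<zeta>)) \<partial>noise)
      = (\<integral>\<^sup>+ z. \<integral>\<^sup>+ u. \<phi> z (metropolis s v z u) \<partial>unit_uniform \<partial>std_gauss)"
    by (subst nn_integral_noise) auto
  also have "\<dots> = (\<integral>\<^sup>+ z. \<integral>\<^sup>+ u. (if u \<le> exp (f v - f (v + s *\<^sub>R z)) then \<phi> z (v + s *\<^sub>R z) else \<phi> z v) \<partial>unit_uniform \<partial>std_gauss)"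
    by (intro nn_integral_cong) (simp add: metropolis_def)
  also have "\<dots> = (\<integral>\<^sup>+ z. ennreal (accept s v z) * \<phi> z (v + s *\<^sub>R z) + ennreal (1 - accept s v z) * \<phi> z v \<partial>std_gauss)"
    by (simp add: nn_integral_unit_uniform_threshold accept_def)
  finally show ?thesis .
qed

lemma nn_integral_\<pi>:
  assumes [measurable]: "\<phi> \<in> borel_measurable borel"
  shows "(\<integral>\<^sup>+ x. \<phi> x \<partial>\<pi>) = (\<integral>\<^sup>+ x. ennreal (exp (- f x) / Z) * \<phi> x \<partial>lborel)"
  unfolding \<pi>_eq by (rule nn_integral_density) auto

text \<open>Detailed balance. The density of \<open>\<pi>\<close> at \<open>v\<close> times the acceptance probability is
  \<open>min (exp (- f(v))) (exp (- f(v + s z))) / Z\<close>, which is symmetric in the two end points. Translating by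
  \<open>s z\<close> and reflecting \<open>z\<close> therefore exchanges them, so as much mass of \<open>\<phi>\<close> moves in as moves out.\<close>

lemma metropolis_invariant:
  assumes [measurable]: "\<phi> \<in> borel_measurable borel"
  shows "(\<integral>\<^sup>+ v. \<integral>\<^sup>+ \<zeta>. \<phi> (metropolis s v (fst \<zeta>) (snd \<zeta>)) \<partial>noise \<partial>\<pi>) = (\<integral>\<^sup>+ v. \<phi> v \<partial>\<pi>)"
proof -
  interpret G: prob_space "std_gauss::'a measure" by (rule prob_space_std_gauss)
  interpret P: prob_space \<pi> by (rule prob_space_\<pi>)
  interpret GP: pair_sigma_finite "std_gauss::'a measure" \<pi> ..
  define S where "S v z = ennreal (min (exp (- f v)) (exp (- f (v + s *\<^sub>R z))) / Z)" for v z
  have [measurable]: "(\<lambda>x. S (X x) (Y x)) \<in> borel_measurable N"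
    if [measurable]: "Y \<in> borel_measurable N" "X \<in> borel_measurable N" for X Y and N :: "'b measure"
    unfolding S_def by measurable
  have S: "ennreal (exp (- f v) / Z) * ennreal (accept s v z) = S v z" for v z
  proof -
    have "exp (- f v) * min 1 (exp (f v - f (v + s *\<^sub>R z))) = min (exp (- f v)) (exp (- f (v + s *\<^sub>R z)))"
      by (simp add: min_def flip: exp_add)
    then show ?thesis using Z_pos by (simp add: S_def accept_def flip: ennreal_mult)
  qed
  have int: "(\<integral>\<^sup>+ v. \<integral>\<^sup>+ z. ennreal (accept s v z) * \<psi> v z \<partial>std_gauss \<partial>\<pi>)
      = (\<integral>\<^sup>+ z. \<integral>\<^sup>+ v. S v z * \<psi> v z \<partial>lborel \<partial>std_gauss)"
    if [measurable]: "(\<lambda>(v, z). \<psi> v z) \<in> borel_measurable (borel \<Otimes>\<^sub>M borel)" for \<psi>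
  proof -
    have "(\<integral>\<^sup>+ v. \<integral>\<^sup>+ z. ennreal (accept s v z) * \<psi> v z \<partial>std_gauss \<partial>\<pi>)
        = (\<integral>\<^sup>+ z. \<integral>\<^sup>+ v. ennreal (accept s v z) * \<psi> v z \<partial>\<pi> \<partial>std_gauss)"
      by (rule GP.Fubini') measurable
    also have "\<dots> = (\<integral>\<^sup>+ z. \<integral>\<^sup>+ v. S v z * \<psi> v z \<partial>lborel \<partial>std_gauss)"
      by (simp add: nn_integral_\<pi> S flip: mult.assoc)
    finally show ?thesis .
  qed
  have sym: "(\<integral>\<^sup>+ v. \<integral>\<^sup>+ z. ennreal (accept s v z) * \<phi> (v + s *\<^sub>R z) \<partial>std_gauss \<partial>\<pi>)
      = (\<integral>\<^sup>+ v. \<integral>\<^sup>+ z. ennreal (accept s v z) * \<phi> v \<partial>std_gauss \<partial>\<pi>)"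
  proof -
    have "(\<integral>\<^sup>+ v. \<integral>\<^sup>+ z. ennreal (accept s v z) * \<phi> (v + s *\<^sub>R z) \<partial>std_gauss \<partial>\<pi>)
        = (\<integral>\<^sup>+ z. \<integral>\<^sup>+ v. S v z * \<phi> (v + s *\<^sub>R z) \<partial>lborel \<partial>std_gauss)"
      by (rule int) measurable
    also have "\<dots> = (\<integral>\<^sup>+ z. \<integral>\<^sup>+ v. S v (- z) * \<phi> v \<partial>lborel \<partial>std_gauss)"
    proof (rule nn_integral_cong)
      fix z :: 'a
      have "S v z = S (v + s *\<^sub>R z) (- z)" for v by (simp add: S_def min.commute)
      then show "(\<integral>\<^sup>+ v. S v z * \<phi> (v + s *\<^sub>R z) \<partial>lborel) = (\<integral>\<^sup>+ v. S v (- z) * \<phi> v \<partial>lborel)"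
        using nn_integral_lborel_translate[of "\<lambda>v. S v (- z) * \<phi> v" "s *\<^sub>R z"] by simp
    qed
    also have "\<dots> = (\<integral>\<^sup>+ z. \<integral>\<^sup>+ v. S v z * \<phi> v \<partial>lborel \<partial>std_gauss)"
      by (rule nn_integral_std_gauss_neg) measurable
    also have "\<dots> = (\<integral>\<^sup>+ v. \<integral>\<^sup>+ z. ennreal (accept s v z) * \<phi> v \<partial>std_gauss \<partial>\<pi>)"
      by (rule int[symmetric]) measurable
    finally show ?thesis .
  qed
  have "(\<integral>\<^sup>+ v. \<integral>\<^sup>+ \<zeta>. \<phi> (metropolis s v (fst \<zeta>) (snd \<zeta>)) \<partial>noise \<partial>\<pi>)
      = (\<integral>\<^sup>+ v. \<integral>\<^sup>+ z. ennreal (accept s v z) * \<phi> (v + s *\<^sub>R z) + ennreal (1 - accept s v z) * \<phi> v \<partial>std_gauss \<partial>\<pi>)"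
    by (intro nn_integral_cong nn_integral_metropolis) measurable
  also have "\<dots> = (\<integral>\<^sup>+ v. \<integral>\<^sup>+ z. ennreal (accept s v z) * \<phi> (v + s *\<^sub>R z) \<partial>std_gauss \<partial>\<pi>)
      + (\<integral>\<^sup>+ v. \<integral>\<^sup>+ z. ennreal (1 - accept s v z) * \<phi> v \<partial>std_gauss \<partial>\<pi>)"
    by (simp add: nn_integral_add)
  also have "\<dots> = (\<integral>\<^sup>+ v. \<integral>\<^sup>+ z. ennreal (accept s v z) * \<phi> v + ennreal (1 - accept s v z) * \<phi> v \<partial>std_gauss \<partial>\<pi>)"
    unfolding sym by (simp add: nn_integral_add)
  also have "\<dots> = (\<integral>\<^sup>+ v. \<integral>\<^sup>+ (z::'a). \<phi> v \<partial>std_gauss \<partial>\<pi>)"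
    using accept_bounds(1)[THEN less_imp_le] accept_bounds(2)
    by (simp flip: distrib_right ennreal_plus)
  also have "\<dots> = (\<integral>\<^sup>+ v. \<phi> v \<partial>\<pi>)" using G.emeasure_space_1 by simp
  finally show ?thesis .
qed

text \<open>How far one Metropolis step is from the Euler step \<open>v + s z - s\<^sup>2/2 \<nabla>f(v)\<close>, when an earlier error
  \<open>w\<close> is already present. The new error \<open>e\<close> differs from \<open>s\<^sup>2/2 \<nabla>f(v)\<close> only on rejection, where \<open>s z\<close> is
  subtracted. To first order the rejection probability is \<open>s (\<nabla>f(v) \<bullet> z)\<^sup>+\<close>, so by the half-space
  covariance the mean of \<open>e\<close> cancels up to order \<open>s\<^sup>3\<close>, and the mean square of \<open>e\<close> is of order \<open>s\<^sup>3\<close>.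
  The cross term with \<open>w\<close> is split as \<open>2 \<parallel>w\<parallel> s\<^sup>3 c \<le> s\<^sup>2 \<parallel>w\<parallel>\<^sup>2 + s\<^sup>4 c\<^sup>2\<close>, which turns the estimate into a
  recursion with factor \<open>1 + s\<^sup>2\<close>.\<close>

lemma metropolis_drift:
  "\<exists>C\<ge>0. \<forall>s v w. 0 < s \<longrightarrow> s \<le> 1 \<longrightarrow>
    (\<integral>\<^sup>+ \<zeta>. ennreal ((norm (w + (metropolis s v (fst \<zeta>) (snd \<zeta>) - v - s *\<^sub>R fst \<zeta> + (s\<^sup>2 / 2) *\<^sub>R g v)))\<^sup>2) \<partial>noise)
    \<le> ennreal ((1 + s\<^sup>2) * (norm w)\<^sup>2 + C * s ^ 3 * (1 + (norm (g v))\<^sup>2)\<^sup>2)"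
proof -
  define c where "c k = (\<integral> z. norm z ^ k \<partial>(std_gauss::'a measure))" for k
  have c0: "0 \<le> c k" for k by (simp add: c_def)
  have ic [simp]: "integrable std_gauss (\<lambda>z::'a. norm z ^ k)" for k
    by (rule integrable_std_gauss[where C=1 and k=k]) (auto intro!: power_mono)
  define C0 where "C0 = M + 2 + 2 * M\<^sup>2"
  define C1 where "C1 = C0 * (c 3 + c 5)"
  define C2 where "C2 = 1 + c 1 + c 3 + M * c 4"
  have C: "0 \<le> C0" "0 \<le> C1" "0 \<le> C2" using M_pos c0 by (auto simp: C0_def C1_def C2_def)
  interpret G: prob_space "std_gauss::'a measure" by (rule prob_space_std_gauss)
  show ?thesis
  proof (intro exI[of _ "C1\<^sup>2 + C2"] conjI allI impI)
    fix s :: real and v w :: 'a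
    assume s: "0 < s" "s \<le> 1"
    define \<delta> where "\<delta> = s\<^sup>2 / 2"
    define q where "q = (norm (g v))\<^sup>2"
    define W where "W = w + \<delta> *\<^sub>R g v"
    define r where "r z = 1 - accept s v z" for z
    \<comment> \<open>An integrable pointwise majorant in \<open>z\<close>. The term with \<open>max 0\<close> is the first-order part of the
      rejection probability; its integral cancels the term \<open>2 * \<delta> * (w \<bullet> g v)\<close>.\<close>
    define \<psi> where "\<psi> z = (norm w)\<^sup>2 + 2 * \<delta> * (w \<bullet> g v) + \<delta>\<^sup>2 * q - 2 * s\<^sup>2 * (max 0 (z \<bullet> g v) * (z \<bullet> w))
        + (2 * s ^ 3 * norm w * (1 + q) * C0 * (norm z ^ 3 + norm z ^ 5)
        + s ^ 3 * (1 + q) * (norm z ^ 1 + norm z ^ 3 + M * norm z ^ 4))" for z :: 'a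
    have q0: "0 \<le> q" by (simp add: q_def)
    have gq: "norm (g v) \<le> 1 + q"
    proof -
      have "0 \<le> (norm (g v) - 1/2)\<^sup>2" by simp
      then show ?thesis by (simp add: q_def power2_eq_square algebra_simps)
    qed
    have s_pow: "s ^ 4 \<le> s ^ 3" "s ^ 4 \<le> s\<^sup>2" using s by (auto intro: power_decreasing)
    have pointwise: "accept s v z * (norm W)\<^sup>2 + (1 - accept s v z) * (norm (W - s *\<^sub>R z))\<^sup>2 \<le> \<psi> z" for z
    proof -
      define n where "n = norm z"
      have n: "0 \<le> n" by (simp add: n_def)
      define a where "a = g v \<bullet> z"
      \<comment> \<open>The increase of the potential under the proposal; its first-order part is \<open>s * a\<close>.\<close>
      define D where "D = f (v + s *\<^sub>R z) - f v"
      have r: "r z = 1 - min 1 (exp (- D))" by (simp add: r_def accept_def D_def)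
      note rb = rejection_probability_bounds[of D, folded r]
      have an: "\<bar>a\<bar> \<le> norm (g v) * n" unfolding a_def n_def by (rule Cauchy_Schwarz_ineq2)
      have D: "\<bar>D - s * a\<bar> \<le> M * s\<^sup>2 * n\<^sup>2"
        using f_increment[of v "s *\<^sub>R z"] by (simp add: D_def a_def n_def power_mult_distrib mult.assoc)
      have D2: "D\<^sup>2 \<le> 2 * s\<^sup>2 * q * n\<^sup>2 + 2 * M\<^sup>2 * s ^ 4 * n ^ 4"
      proof -
        have "D\<^sup>2 = ((s * a) + (D - s * a))\<^sup>2" by simp
        also have "\<dots> \<le> 2 * (s * a)\<^sup>2 + 2 * (D - s * a)\<^sup>2"
          using zero_le_power2[of "s * a - (D - s * a)"] by (simp add: power2_eq_square algebra_simps)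
        also have "(s * a)\<^sup>2 \<le> s\<^sup>2 * (norm (g v) * n)\<^sup>2"
          using power_mono[OF an, of 2] by (simp add: power_mult_distrib mult_left_mono)
        also have "(D - s * a)\<^sup>2 \<le> (M * s\<^sup>2 * n\<^sup>2)\<^sup>2"
          using power_mono[OF D, of 2] by simp
        finally show ?thesis by (simp add: q_def power_mult_distrib mult_ac flip: power_mult)
      qed
      have rej: "\<bar>s * max 0 a - r z\<bar> \<le> s\<^sup>2 * ((1 + q) * C0 * (n\<^sup>2 + n ^ 4))"
      proof -
        have "\<bar>s * max 0 a - max 0 D\<bar> \<le> M * s\<^sup>2 * n\<^sup>2"
        proof -
          have "s * max 0 a = max 0 (s * a)" using s by (auto simp: max_def zero_le_mult_iff mult_le_0_iff)
          moreover have "\<bar>max 0 (s * a) - max 0 D\<bar> \<le> \<bar>D - s * a\<bar>" by (auto simp: max_def)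
          ultimately show ?thesis using D by simp
        qed
        then have "\<bar>s * max 0 a - r z\<bar> \<le> M * s\<^sup>2 * n\<^sup>2 + (2 * s\<^sup>2 * q * n\<^sup>2 + 2 * M\<^sup>2 * s ^ 4 * n ^ 4)"
          using rb(4) D2 by linarith
        also have "\<dots> \<le> M * s\<^sup>2 * n\<^sup>2 + (2 * s\<^sup>2 * q * n\<^sup>2 + 2 * M\<^sup>2 * s\<^sup>2 * n ^ 4)"
          using s_pow n by (intro add_left_mono mult_right_mono mult_left_mono) auto
        also have "\<dots> = s\<^sup>2 * (M * n\<^sup>2 + 2 * q * n\<^sup>2 + 2 * M\<^sup>2 * n ^ 4)" by (simp add: algebra_simps)
        also have "\<dots> \<le> s\<^sup>2 * ((1 + q) * C0 * (n\<^sup>2 + n ^ 4))"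
        proof (rule mult_left_mono)
          have "0 \<le> M * n\<^sup>2 + M * n ^ 4" "0 \<le> q * n\<^sup>2" "0 \<le> q * n ^ 4" "0 \<le> M\<^sup>2 * n\<^sup>2" "0 \<le> M\<^sup>2 * n ^ 4" "0 \<le> n\<^sup>2" "0 \<le> n ^ 4"
             "0 \<le> q * M * n\<^sup>2" "0 \<le> q * M * n ^ 4" "0 \<le> q * M\<^sup>2 * n\<^sup>2" "0 \<le> q * M\<^sup>2 * n ^ 4" "0 \<le> M * n ^ 4"
            using M_pos q0 n by auto
          then show "M * n\<^sup>2 + 2 * q * n\<^sup>2 + 2 * M\<^sup>2 * n ^ 4 \<le> (1 + q) * C0 * (n\<^sup>2 + n ^ 4)"
            by (simp add: C0_def algebra_simps)
        qed simp
        finally show ?thesis .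
      qed
      have expand: "accept s v z * (norm W)\<^sup>2 + (1 - accept s v z) * (norm (W - s *\<^sub>R z))\<^sup>2
          = (norm w)\<^sup>2 + 2 * \<delta> * (w \<bullet> g v) + \<delta>\<^sup>2 * q - 2 * s * r z * (z \<bullet> w) - 2 * s * \<delta> * r z * a + s\<^sup>2 * r z * n\<^sup>2"
      proof -
        have "(norm W)\<^sup>2 = (norm w)\<^sup>2 + 2 * \<delta> * (w \<bullet> g v) + \<delta>\<^sup>2 * q"
          unfolding W_def q_def power2_norm_eq_inner
          by (simp add: inner_add_left inner_add_right inner_commute[of "g v" w] power2_eq_square algebra_simps)
        moreover have "(norm (W - s *\<^sub>R z))\<^sup>2 = (norm W)\<^sup>2 - 2 * s * (z \<bullet> w) - 2 * s * \<delta> * a + s\<^sup>2 * n\<^sup>2"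
        proof -
          have "(norm (W - s *\<^sub>R z))\<^sup>2 = (norm W)\<^sup>2 - 2 * s * (z \<bullet> W) + s\<^sup>2 * n\<^sup>2"
            unfolding n_def power2_norm_eq_inner
            by (simp add: inner_diff_left inner_diff_right inner_commute[of z W] power2_eq_square algebra_simps)
          then show ?thesis
            by (simp add: W_def a_def inner_add_right inner_commute[of z "g v"] algebra_simps)
        qed
        moreover from this have "accept s v z * (norm W)\<^sup>2 + (1 - accept s v z) * (norm (W - s *\<^sub>R z))\<^sup>2
            = (norm W)\<^sup>2 - r z * (2 * s * (z \<bullet> w) + 2 * s * \<delta> * a - s\<^sup>2 * n\<^sup>2)"
          by (simp only:) (simp add: r_def algebra_simps)
        ultimately show ?thesis by (simp only:) (simp add: algebra_simps)
      qed
      have t1: "- (2 * s * r z * (z \<bullet> w)) \<le> - (2 * s\<^sup>2 * (max 0 a * (z \<bullet> w))) + 2 * s ^ 3 * norm w * (1 + q) * C0 * (n ^ 3 + n ^ 5)"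
      proof -
        have "(s * max 0 a - r z) * (z \<bullet> w) \<le> \<bar>s * max 0 a - r z\<bar> * \<bar>z \<bullet> w\<bar>"
          unfolding abs_mult[symmetric] by simp
        also have "\<dots> \<le> (s\<^sup>2 * ((1 + q) * C0 * (n\<^sup>2 + n ^ 4))) * (n * norm w)"
          unfolding n_def using q0 C by (intro mult_mono rej[unfolded n_def] Cauchy_Schwarz_ineq2 mult_nonneg_nonneg) auto
        finally have "2 * s * ((s * max 0 a - r z) * (z \<bullet> w)) \<le> 2 * s * ((s\<^sup>2 * ((1 + q) * C0 * (n\<^sup>2 + n ^ 4))) * (n * norm w))"
          using s by (intro mult_left_mono) auto
        also have "\<dots> = 2 * s ^ 3 * norm w * (1 + q) * C0 * (n ^ 3 + n ^ 5)"
          by (simp add: power2_eq_square power3_eq_cube eval_nat_numeral algebra_simps)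
        finally show ?thesis by (simp add: power2_eq_square algebra_simps)
      qed
      have t2: "- (2 * s * \<delta> * r z * a) \<le> s ^ 3 * ((1 + q) * n)"
      proof -
        have "- (r z * a) \<le> \<bar>r z\<bar> * \<bar>a\<bar>" unfolding abs_mult[symmetric] by simp
        also have "\<dots> \<le> 1 * ((1 + q) * n)"
        proof (intro mult_mono)
          show "\<bar>a\<bar> \<le> (1 + q) * n" using an mult_right_mono[OF gq n] by linarith
        qed (use rb in auto)
        finally have "s ^ 3 * - (r z * a) \<le> s ^ 3 * ((1 + q) * n)" using s by (intro mult_left_mono) auto
        then show ?thesis by (simp add: \<delta>_def power2_eq_square power3_eq_cube mult_ac)
      qed
      have t3: "s\<^sup>2 * r z * n\<^sup>2 \<le> s ^ 3 * ((1 + q) * (n ^ 3 + M * n ^ 4))"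
      proof -
        have "r z \<le> s * (norm (g v) * n) + M * s\<^sup>2 * n\<^sup>2"
        proof -
          have "s * a \<le> s * (norm (g v) * n)" using an s by (intro mult_left_mono) auto
          then have "D \<le> s * (norm (g v) * n) + M * s\<^sup>2 * n\<^sup>2" using D by linarith
          moreover have "0 \<le> s * (norm (g v) * n) + M * s\<^sup>2 * n\<^sup>2" using s n M_pos by simp
          ultimately show ?thesis using rb(3) by simp
        qed
        also have "\<dots> \<le> s * ((1 + q) * n) + M * s * n\<^sup>2"
        proof -
          have "s\<^sup>2 \<le> s" using s by (simp add: power2_eq_square mult_le_one)
          then show ?thesis using s n gq M_pos by (intro add_mono mult_left_mono mult_right_mono) auto
        qed
        also have "\<dots> \<le> s * ((1 + q) * (n + M * n\<^sup>2))"
        proof -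
          have "0 \<le> s * q * M * n\<^sup>2" using s q0 M_pos by simp
          then show ?thesis by (simp add: algebra_simps)
        qed
        finally have "s\<^sup>2 * n\<^sup>2 * r z \<le> s\<^sup>2 * n\<^sup>2 * (s * ((1 + q) * (n + M * n\<^sup>2)))"
          by (intro mult_left_mono) auto
        also have "\<dots> = s ^ 3 * ((1 + q) * (n ^ 3 + M * n ^ 4))"
          by (simp add: eval_nat_numeral algebra_simps)
        finally show ?thesis by (simp add: mult_ac)
      qed
      show ?thesis
        unfolding expand \<psi>_def n_def[symmetric] inner_commute[of z "g v"] a_def[symmetric]
        using t1 t2 t3 by (simp add: algebra_simps)
    qed
    have half: "integrable std_gauss (\<lambda>z. max 0 (z \<bullet> g v) * (z \<bullet> w))"
    proof (rule integrable_std_gauss[where C="norm (g v) * norm w" and k=2])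
      fix z :: 'a
      have "\<bar>max 0 (z \<bullet> g v) * (z \<bullet> w)\<bar> \<le> (norm z * norm (g v)) * (norm z * norm w)"
        unfolding abs_mult
      proof (intro mult_mono)
        show "\<bar>max 0 (z \<bullet> g v)\<bar> \<le> norm z * norm (g v)"
          using Cauchy_Schwarz_ineq2[of z "g v"] by (auto simp: max_def)
      qed (simp_all add: Cauchy_Schwarz_ineq2)
      also have "\<dots> = norm (g v) * norm w * (norm z)\<^sup>2" by (simp add: power2_eq_square mult_ac)
      also have "\<dots> \<le> norm (g v) * norm w * (1 + norm z)\<^sup>2"
        by (intro mult_left_mono power_mono) auto
      finally show "\<bar>max 0 (z \<bullet> g v) * (z \<bullet> w)\<bar> \<le> norm (g v) * norm w * (1 + norm z)\<^sup>2" .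
    qed simp
    have i\<psi>: "integrable std_gauss \<psi>"
      unfolding \<psi>_def using half by (intro Bochner_Integration.integrable_add Bochner_Integration.integrable_diff integrable_mult_right ic) auto
    have "(\<integral> z. \<psi> z \<partial>std_gauss) = (norm w)\<^sup>2 + 2 * \<delta> * (w \<bullet> g v) + \<delta>\<^sup>2 * q - 2 * s\<^sup>2 * ((g v \<bullet> w) / 2)
        + (2 * s ^ 3 * norm w * (1 + q) * C0 * (c 3 + c 5) + s ^ 3 * (1 + q) * (c 1 + c 3 + M * c 4))"
      unfolding \<psi>_def using half ic[of 1] by (simp add: std_gauss_covariance_halfspace c_def G.prob_space[simplified] del: power_one_right)
    also have "\<dots> = (norm w)\<^sup>2 + \<delta>\<^sup>2 * q + 2 * s ^ 3 * norm w * (1 + q) * C1 + s ^ 3 * (1 + q) * (C2 - 1)"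
      by (simp add: \<delta>_def inner_commute C1_def C2_def)
    also have "\<dots> \<le> (norm w)\<^sup>2 + 2 * s ^ 3 * norm w * (1 + q) * C1 + s ^ 3 * (1 + q) * C2"
    proof -
      have "\<delta>\<^sup>2 = s ^ 4 / 4" by (simp add: \<delta>_def power_divide flip: power_mult)
      then have "\<delta>\<^sup>2 \<le> s ^ 3" using s_pow s zero_less_power[of s 3] by linarith
      then have "\<delta>\<^sup>2 * q \<le> s ^ 3 * (1 + q)"
        using s q0 by (intro mult_mono) auto
      then show ?thesis by (simp add: algebra_simps)
    qed
    also have "\<dots> \<le> (norm w)\<^sup>2 + (s\<^sup>2 * (norm w)\<^sup>2 + s ^ 3 * (C1\<^sup>2 * (1 + q)\<^sup>2)) + s ^ 3 * ((1 + q)\<^sup>2 * C2)"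
    proof (intro add_mono order_refl)
      have "2 * s ^ 3 * norm w * (1 + q) * C1 = 2 * (s * norm w) * (s\<^sup>2 * (C1 * (1 + q)))"
        by (simp add: eval_nat_numeral mult_ac)
      also have "\<dots> \<le> (s * norm w)\<^sup>2 + (s\<^sup>2 * (C1 * (1 + q)))\<^sup>2" by (rule sum_squares_bound)
      also have "\<dots> = s\<^sup>2 * (norm w)\<^sup>2 + s ^ 4 * (C1\<^sup>2 * (1 + q)\<^sup>2)"
        by (simp add: power_mult_distrib flip: power_mult)
      also have "\<dots> \<le> s\<^sup>2 * (norm w)\<^sup>2 + s ^ 3 * (C1\<^sup>2 * (1 + q)\<^sup>2)"
        using s_pow by (intro add_left_mono mult_right_mono) auto
      finally show "2 * s ^ 3 * norm w * (1 + q) * C1 \<le> s\<^sup>2 * (norm w)\<^sup>2 + s ^ 3 * (C1\<^sup>2 * (1 + q)\<^sup>2)" .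
      have "(1 + q) * C2 \<le> (1 + q)\<^sup>2 * C2"
        using q0 C by (intro mult_right_mono self_le_power) auto
      then show "s ^ 3 * (1 + q) * C2 \<le> s ^ 3 * ((1 + q)\<^sup>2 * C2)"
        using s by (simp add: mult.assoc)
    qed
    also have "\<dots> = (1 + s\<^sup>2) * (norm w)\<^sup>2 + (C1\<^sup>2 + C2) * s ^ 3 * (1 + (norm (g v))\<^sup>2)\<^sup>2"
      by (simp add: q_def[symmetric] algebra_simps)
    finally have bound: "(\<integral> z. \<psi> z \<partial>std_gauss) \<le> (1 + s\<^sup>2) * (norm w)\<^sup>2 + (C1\<^sup>2 + C2) * s ^ 3 * (1 + (norm (g v))\<^sup>2)\<^sup>2" .
    have "(\<integral>\<^sup>+ \<zeta>. ennreal ((norm (w + (metropolis s v (fst \<zeta>) (snd \<zeta>) - v - s *\<^sub>R fst \<zeta> + (s\<^sup>2 / 2) *\<^sub>R g v)))\<^sup>2) \<partial>noise)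
      = (\<integral>\<^sup>+ z. ennreal (accept s v z) * ennreal ((norm W)\<^sup>2) + ennreal (1 - accept s v z) * ennreal ((norm (W - s *\<^sub>R z))\<^sup>2) \<partial>std_gauss)"
      by (subst nn_integral_metropolis[of "\<lambda>z x. ennreal ((norm (w + (x - v - s *\<^sub>R z + (s\<^sup>2 / 2) *\<^sub>R g v)))\<^sup>2)"])
         (auto simp: W_def \<delta>_def algebra_simps)
    also have "\<dots> = (\<integral>\<^sup>+ z. ennreal (accept s v z * (norm W)\<^sup>2 + (1 - accept s v z) * (norm (W - s *\<^sub>R z))\<^sup>2) \<partial>std_gauss)"
      using accept_bounds(1)[THEN less_imp_le] accept_bounds(2)
      by (intro nn_integral_cong) (simp add: ennreal_mult)
    also have "\<dots> \<le> (\<integral>\<^sup>+ z. ennreal (\<psi> z) \<partial>std_gauss)"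
      by (intro nn_integral_mono ennreal_leI pointwise)
    also have "\<dots> = ennreal (\<integral> z. \<psi> z \<partial>std_gauss)"
    proof (intro nn_integral_eq_integral i\<psi> AE_I2)
      fix z
      have "0 \<le> accept s v z * (norm W)\<^sup>2 + (1 - accept s v z) * (norm (W - s *\<^sub>R z))\<^sup>2"
        using accept_bounds[of s v z] by (intro add_nonneg_nonneg mult_nonneg_nonneg) auto
      then show "0 \<le> \<psi> z" using pointwise[of z] by linarith
    qed
    also have "\<dots> \<le> ennreal ((1 + s\<^sup>2) * (norm w)\<^sup>2 + (C1\<^sup>2 + C2) * s ^ 3 * (1 + (norm (g v))\<^sup>2)\<^sup>2)"
      by (rule ennreal_leI[OF bound])
    finally show "(\<integral>\<^sup>+ \<zeta>. ennreal ((norm (w + (metropolis s v (fst \<zeta>) (snd \<zeta>) - v - s *\<^sub>R fst \<zeta> + (s\<^sup>2 / 2) *\<^sub>R g v)))\<^sup>2) \<partial>noise)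
      \<le> ennreal ((1 + s\<^sup>2) * (norm w)\<^sup>2 + (C1\<^sup>2 + C2) * s ^ 3 * (1 + (norm (g v))\<^sup>2)\<^sup>2)" .
  qed (use C in simp)
qed

end

section \<open>The Metropolis walk coupled with the chain\<close>

lemma nn_integral_std_gauss_add_scaled:
  fixes \<phi> :: "'a::euclidean_space \<Rightarrow> ennreal"
  assumes [measurable]: "\<phi> \<in> borel_measurable borel"
  shows "(\<integral>\<^sup>+ y. \<integral>\<^sup>+ z. \<phi> (sqrt (real i) *\<^sub>R y + z) \<partial>std_gauss \<partial>std_gauss)
    = (\<integral>\<^sup>+ z. \<phi> (sqrt (real (Suc i)) *\<^sub>R z) \<partial>std_gauss)"
proof -
  interpret G: prob_space "std_gauss :: 'a measure" by (rule prob_space_std_gauss)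
  interpret GG: pair_sigma_finite "std_gauss :: 'a measure" "std_gauss :: 'a measure" ..
  define r where "r = sqrt (real (Suc i))"
  have r: "0 < r" "r\<^sup>2 = real i + 1" by (simp_all add: r_def)
  have 1: "(1 / r)\<^sup>2 + (sqrt (real i) / r)\<^sup>2 = 1"
    using r by (simp add: power_divide field_simps)
  have 2: "r *\<^sub>R ((1 / r) *\<^sub>R z + (sqrt (real i) / r) *\<^sub>R y) = sqrt (real i) *\<^sub>R y + z" for y z :: 'a
    using r by (simp add: scaleR_add_right add.commute)
  have "(\<integral>\<^sup>+ y. \<integral>\<^sup>+ z. \<phi> (sqrt (real i) *\<^sub>R y + z) \<partial>std_gauss \<partial>std_gauss)
      = (\<integral>\<^sup>+ z. \<integral>\<^sup>+ y. \<phi> (sqrt (real i) *\<^sub>R y + z) \<partial>std_gauss \<partial>std_gauss)"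
    by (rule GG.Fubini') measurable
  also have "\<dots> = (\<integral>\<^sup>+ z. \<phi> (r *\<^sub>R z) \<partial>std_gauss)"
    using nn_integral_std_gauss_rotate[of "\<lambda>x. \<phi> (r *\<^sub>R x)", OF _ 1] r by (simp add: 2)
  finally show ?thesis by (simp add: r_def)
qed

lemma l2norm_std_gauss: "l2norm std_gauss (\<lambda>z::'a::euclidean_space. z) = ennreal (sqrt DIM('a))"
proof -
  have "integrable std_gauss (\<lambda>z::'a. (norm z)\<^sup>2)"
    by (rule integrable_std_gauss[where C=1 and k=2]) (auto intro!: power_mono)
  then have "(\<integral>\<^sup>+ (z::'a). ennreal ((norm z)\<^sup>2) \<partial>std_gauss) = ennreal (\<integral> (z::'a). (norm z)\<^sup>2 \<partial>std_gauss)"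
    by (intro nn_integral_eq_integral) auto
  then show ?thesis by (simp add: l2norm_def std_gauss_second_moment ennsqrt_ennreal)
qed

context smooth_strongly_convex
begin

text \<open>A state \<open>(c, v, S, A)\<close> keeps the initial pair \<open>c = (x, v\<^sub>0)\<close>, the current position \<open>v\<close> of the walk
  started at \<open>v\<^sub>0\<close>, the sum \<open>S\<close> of the Gaussian increments used so far, and the sum \<open>A\<close> of the gradients
  at the positions visited before \<open>v\<close>. All that is needed about the joint law of the walk and its
  noise can be read off from this state, so the walk is a sequence of measures on states.\<close>

abbreviation state_space :: "(('a \<times> 'a) \<times> 'a \<times> 'a \<times> 'a) measure" where
  "state_space \<equiv> (borel \<Otimes>\<^sub>M borel) \<Otimes>\<^sub>M (borel \<Otimes>\<^sub>M (borel \<Otimes>\<^sub>M borel))"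

definition walk_step :: "real \<Rightarrow> (('a \<times> 'a) \<times> 'a \<times> 'a \<times> 'a) \<times> ('a \<times> real) \<Rightarrow> ('a \<times> 'a) \<times> 'a \<times> 'a \<times> 'a" where
  "walk_step s = (\<lambda>((c, v, S, A), (z, u)). (c, metropolis s v z u, S + z, A + g v))"

primrec walk :: "real \<Rightarrow> ('a \<times> 'a) measure \<Rightarrow> nat \<Rightarrow> (('a \<times> 'a) \<times> 'a \<times> 'a \<times> 'a) measure" where
  "walk s \<gamma> 0 = distr \<gamma> state_space (\<lambda>c. (c, snd c, 0, 0))"
| "walk s \<gamma> (Suc i) = distr (walk s \<gamma> i \<Otimes>\<^sub>M noise) state_space (walk_step s)"

lemma sets_walk [simp, measurable_cong]: "sets (walk s \<gamma> i) = sets state_space"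
  by (cases i) simp_all

lemma walk_step_measurable [measurable]:
  "walk_step s \<in> measurable (state_space \<Otimes>\<^sub>M (borel \<Otimes>\<^sub>M borel)) state_space"
  unfolding walk_step_def case_prod_beta by measurable

text \<open>The accumulated deviation of the walk from the Euler recursion along its own gradients.\<close>

definition walk_error :: "real \<Rightarrow> ('a \<times> 'a) \<times> 'a \<times> 'a \<times> 'a \<Rightarrow> 'a" where
  "walk_error s = (\<lambda>(c, v, S, A). v - snd c - s *\<^sub>R S + (s\<^sup>2 / 2) *\<^sub>R A)"

lemma walk_error_measurable [measurable]: "walk_error s \<in> borel_measurable state_space"
  unfolding walk_error_def by measurable

context
  fixes \<gamma> :: "('a \<times> 'a) measure" and s :: real
  assumes prob_\<gamma>: "prob_space \<gamma>"
    and sets_\<gamma> [measurable_cong, simp]: "sets \<gamma> = sets (borel \<Otimes>\<^sub>M borel)"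
    and snd_\<gamma>: "distr \<gamma> borel snd = \<pi>"
begin

lemma prob_space_walk: "prob_space (walk s \<gamma> i)"
proof (induction i)
  case 0
  interpret prob_space \<gamma> by (rule prob_\<gamma>)
  show ?case by (simp, rule prob_space_distr) measurable
next
  case (Suc i)
  interpret A: prob_space "walk s \<gamma> i" by (rule Suc)
  interpret B: prob_space noise by (rule prob_space_noise)
  interpret pair_prob_space "walk s \<gamma> i" noise ..
  show ?case by (simp, rule prob_space_distr) measurable
qed

lemma nn_integral_walk_0:
  assumes [measurable]: "\<phi> \<in> borel_measurable state_space"
  shows "(\<integral>\<^sup>+ \<sigma>. \<phi> \<sigma> \<partial>walk s \<gamma> 0) = (\<integral>\<^sup>+ c. \<phi> (c, snd c, 0, 0) \<partial>\<gamma>)"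
  by (simp add: nn_integral_distr)

lemma nn_integral_walk_Suc:
  assumes [measurable]: "\<phi> \<in> borel_measurable state_space"
  shows "(\<integral>\<^sup>+ \<sigma>. \<phi> \<sigma> \<partial>walk s \<gamma> (Suc i)) = (\<integral>\<^sup>+ \<sigma>. \<integral>\<^sup>+ \<zeta>. \<phi> (walk_step s (\<sigma>, \<zeta>)) \<partial>noise \<partial>walk s \<gamma> i)"
proof -
  interpret B: prob_space noise by (rule prob_space_noise)
  show ?thesis by (simp add: nn_integral_distr, subst B.nn_integral_fst[symmetric]) auto
qed

lemma l2norm_walk_Suc_past:
  fixes F H :: "_ \<Rightarrow> 'a"
  assumes [measurable]: "F \<in> borel_measurable state_space" "H \<in> borel_measurable state_space"
    and FH: "\<And>\<sigma> \<zeta>. F (walk_step s (\<sigma>, \<zeta>)) = H \<sigma>"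
  shows "l2norm (walk s \<gamma> (Suc i)) F = l2norm (walk s \<gamma> i) H"
proof -
  interpret B: prob_space noise by (rule prob_space_noise)
  show ?thesis unfolding l2norm_def
    by (subst nn_integral_walk_Suc) (auto simp: FH B.emeasure_space_1)
qed

lemma walk_position:
  assumes [measurable]: "\<phi> \<in> borel_measurable borel"
  shows "(\<integral>\<^sup>+ \<sigma>. \<phi> (fst (snd \<sigma>)) \<partial>walk s \<gamma> i) = (\<integral>\<^sup>+ x. \<phi> x \<partial>\<pi>)"
  using assms
proof (induction i arbitrary: \<phi>)
  case 0
  note [measurable] = 0
  have "(\<integral>\<^sup>+ \<sigma>. \<phi> (fst (snd \<sigma>)) \<partial>walk s \<gamma> 0) = (\<integral>\<^sup>+ c. \<phi> (snd c) \<partial>\<gamma>)"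
    by (subst nn_integral_walk_0) auto
  also have "\<dots> = (\<integral>\<^sup>+ x. \<phi> x \<partial>\<pi>)"
    by (subst snd_\<gamma>[symmetric], subst nn_integral_distr) auto
  finally show ?case .
next
  case (Suc i)
  note [measurable] = Suc.prems
  interpret B: prob_space noise by (rule prob_space_noise)
  have "(\<integral>\<^sup>+ \<sigma>. \<phi> (fst (snd \<sigma>)) \<partial>walk s \<gamma> (Suc i))
      = (\<integral>\<^sup>+ \<sigma>. \<integral>\<^sup>+ \<zeta>. \<phi> (metropolis s (fst (snd \<sigma>)) (fst \<zeta>) (snd \<zeta>)) \<partial>noise \<partial>walk s \<gamma> i)"
    by (subst nn_integral_walk_Suc) (auto simp: walk_step_def case_prod_beta)
  also have "\<dots> = (\<integral>\<^sup>+ v. \<integral>\<^sup>+ \<zeta>. \<phi> (metropolis s v (fst \<zeta>) (snd \<zeta>)) \<partial>noise \<partial>\<pi>)"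
    by (rule Suc.IH) measurable
  also have "\<dots> = (\<integral>\<^sup>+ x. \<phi> x \<partial>\<pi>)" by (rule metropolis_invariant) measurable
  finally show ?case .
qed

text \<open>The sum of the increments is independent of the initial pair and Gaussian with covariance \<open>i\<close> times
  the identity. Both facts are stated at once through a test function \<open>\<phi>\<close>.\<close>

lemma walk_noise_sum:
  assumes "(\<lambda>(c, S). \<phi> c S) \<in> borel_measurable ((borel \<Otimes>\<^sub>M borel) \<Otimes>\<^sub>M borel)"
  shows "(\<integral>\<^sup>+ \<sigma>. \<phi> (fst \<sigma>) (fst (snd (snd \<sigma>))) \<partial>walk s \<gamma> i)
    = (\<integral>\<^sup>+ c. \<integral>\<^sup>+ z. \<phi> c (sqrt (real i) *\<^sub>R z) \<partial>std_gauss \<partial>\<gamma>)"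
  using assms
proof (induction i arbitrary: \<phi>)
  case 0
  interpret G: prob_space "std_gauss :: 'a measure" by (rule prob_space_std_gauss)
  have [measurable]: "(\<lambda>x. \<phi> (X x) (Y x)) \<in> borel_measurable N"
    if [measurable]: "X \<in> measurable N (borel \<Otimes>\<^sub>M borel)" "Y \<in> borel_measurable N" for X Y and N :: "'b measure"
    using measurable_compose[OF _ 0, of "\<lambda>x. (X x, Y x)" N] by simp
  show ?case
    by (subst nn_integral_walk_0) (auto simp: G.emeasure_space_1[simplified])
next
  case (Suc i)
  interpret G: prob_space "std_gauss :: 'a measure" by (rule prob_space_std_gauss)
  interpret U: prob_space unit_uniform by (rule prob_space_unit_uniform)
  have [measurable]: "(\<lambda>x. \<phi> (X x) (Y x)) \<in> borel_measurable N"
    if [measurable]: "X \<in> measurable N (borel \<Otimes>\<^sub>M borel)" "Y \<in> borel_measurable N" for X Y and N :: "'b measure"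
    using measurable_compose[OF _ Suc.prems, of "\<lambda>x. (X x, Y x)" N] by simp
  have "(\<integral>\<^sup>+ \<sigma>. \<phi> (fst \<sigma>) (fst (snd (snd \<sigma>))) \<partial>walk s \<gamma> (Suc i))
      = (\<integral>\<^sup>+ \<sigma>. \<integral>\<^sup>+ \<zeta>. \<phi> (fst \<sigma>) (fst (snd (snd \<sigma>)) + fst \<zeta>) \<partial>noise \<partial>walk s \<gamma> i)"
    by (subst nn_integral_walk_Suc) (auto simp: walk_step_def case_prod_beta)
  also have "\<dots> = (\<integral>\<^sup>+ \<sigma>. \<integral>\<^sup>+ z. \<phi> (fst \<sigma>) (fst (snd (snd \<sigma>)) + z) \<partial>std_gauss \<partial>walk s \<gamma> i)"
    by (subst nn_integral_noise) (auto simp: U.emeasure_space_1)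
  also have "\<dots> = (\<integral>\<^sup>+ c. \<integral>\<^sup>+ y. \<integral>\<^sup>+ z. \<phi> c (sqrt (real i) *\<^sub>R y + z) \<partial>std_gauss \<partial>std_gauss \<partial>\<gamma>)"
    by (rule Suc.IH) measurable
  also have "\<dots> = (\<integral>\<^sup>+ c. \<integral>\<^sup>+ z. \<phi> c (sqrt (real (Suc i)) *\<^sub>R z) \<partial>std_gauss \<partial>\<gamma>)"
  proof (rule nn_integral_cong)
    show "(\<integral>\<^sup>+ y. \<integral>\<^sup>+ z. \<phi> c (sqrt (real i) *\<^sub>R y + z) \<partial>std_gauss \<partial>std_gauss)
        = (\<integral>\<^sup>+ z. \<phi> c (sqrt (real (Suc i)) *\<^sub>R z) \<partial>std_gauss)" for c
      by (rule nn_integral_std_gauss_add_scaled, measurable, simp_all add: space_pair_measure)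
  qed
  finally show ?case .
qed

lemma l2norm_walk_noise_sum:
  "l2norm (walk s \<gamma> i) (\<lambda>\<sigma>. fst (snd (snd \<sigma>))) \<le> ennreal (sqrt (real i * DIM('a)))"
proof -
  interpret prob_space \<gamma> by (rule prob_\<gamma>)
  have "l2norm (walk s \<gamma> i) (\<lambda>\<sigma>. fst (snd (snd \<sigma>))) = l2norm std_gauss (\<lambda>z::'a. sqrt (real i) *\<^sub>R z)"
    unfolding l2norm_def
    using walk_noise_sum[of "\<lambda>c S. ennreal ((norm S)\<^sup>2)" i] by (simp add: emeasure_space_1)
  also have "\<dots> \<le> ennreal \<bar>sqrt (real i)\<bar> * ennreal (sqrt DIM('a))"
    unfolding l2norm_std_gauss[symmetric] by (rule l2norm_scaleR) simp
  also have "\<dots> = ennreal (sqrt (real i * DIM('a)))"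
    by (simp add: real_sqrt_mult flip: ennreal_mult)
  finally show ?thesis .
qed

lemma l2norm_gradient_walk:
  "l2norm (walk s \<gamma> i) (\<lambda>\<sigma>. g (fst (snd \<sigma>))) \<le> ennreal (sqrt (M * DIM('a)))"
proof -
  have "(ennreal (sqrt (M * real DIM('a))))\<^sup>2 = ennreal (M * DIM('a))"
    using M_pos by (simp add: ennreal_power)
  then show ?thesis
    unfolding l2norm_le_iff using walk_position[of "\<lambda>v. ennreal ((norm (g v))\<^sup>2)" i]
      expectation_norm_gradient_squared by simp
qed

lemma l2norm_walk_gradient_sum:
  "l2norm (walk s \<gamma> i) (\<lambda>\<sigma>. snd (snd (snd \<sigma>))) \<le> ennreal (real i * sqrt (M * DIM('a)))"
proof (induction i)
  case 0
  have "(\<integral>\<^sup>+ \<sigma>. ennreal ((norm (snd (snd (snd \<sigma>))))\<^sup>2) \<partial>walk s \<gamma> 0) = 0"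
    by (subst nn_integral_walk_0) auto
  then show ?case unfolding l2norm_le_iff by (simp del: walk.simps)
next
  case (Suc i)
  have "l2norm (walk s \<gamma> (Suc i)) (\<lambda>\<sigma>. snd (snd (snd \<sigma>)))
      = l2norm (walk s \<gamma> i) (\<lambda>\<sigma>. snd (snd (snd \<sigma>)) + g (fst (snd \<sigma>)))"
    by (rule l2norm_walk_Suc_past) (auto simp: walk_step_def case_prod_beta)
  also have "\<dots> \<le> l2norm (walk s \<gamma> i) (\<lambda>\<sigma>. snd (snd (snd \<sigma>))) + l2norm (walk s \<gamma> i) (\<lambda>\<sigma>. g (fst (snd \<sigma>)))"
    by (rule l2norm_triangle) measurable
  also have "\<dots> \<le> ennreal (real i * sqrt (M * DIM('a))) + ennreal (sqrt (M * DIM('a)))"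
    by (intro add_mono Suc l2norm_gradient_walk)
  also have "\<dots> = ennreal (real (Suc i) * sqrt (M * DIM('a)))"
    using M_pos by (simp add: distrib_right add.commute flip: ennreal_plus)
  finally show ?case .
qed

lemma walk_displacement:
  assumes "0 < s" and err: "l2norm (walk s \<gamma> i) (walk_error s) \<le> ennreal \<epsilon>" and "0 \<le> \<epsilon>"
  shows "l2norm (walk s \<gamma> i) (\<lambda>\<sigma>. snd (fst \<sigma>) - fst (snd \<sigma>))
    \<le> ennreal (\<epsilon> + s * sqrt (real i * DIM('a)) + s\<^sup>2 / 2 * (real i * sqrt (M * DIM('a))))"
proof -
  let ?Q = "walk s \<gamma> i"
  let ?N = "\<lambda>\<sigma>::('a \<times> 'a) \<times> 'a \<times> 'a \<times> 'a. s *\<^sub>R fst (snd (snd \<sigma>))"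
  let ?G = "\<lambda>\<sigma>::('a \<times> 'a) \<times> 'a \<times> 'a \<times> 'a. (- (s\<^sup>2 / 2)) *\<^sub>R snd (snd (snd \<sigma>))"
  have "l2norm ?Q (\<lambda>\<sigma>. snd (fst \<sigma>) - fst (snd \<sigma>)) = l2norm ?Q (\<lambda>\<sigma>. - (walk_error s \<sigma> + (?N \<sigma> + ?G \<sigma>)))"
    by (intro arg_cong[where f="l2norm ?Q"]) (auto simp: walk_error_def)
  also have "\<dots> = l2norm ?Q (\<lambda>\<sigma>. walk_error s \<sigma> + (?N \<sigma> + ?G \<sigma>))" by (rule l2norm_minus)
  also have "\<dots> \<le> l2norm ?Q (walk_error s) + l2norm ?Q (\<lambda>\<sigma>. ?N \<sigma> + ?G \<sigma>)"
    by (rule l2norm_triangle) measurable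
  also have "\<dots> \<le> ennreal \<epsilon> + (l2norm ?Q ?N + l2norm ?Q ?G)"
    by (intro add_mono err l2norm_triangle) measurable
  also have "l2norm ?Q ?N \<le> ennreal \<bar>s\<bar> * l2norm ?Q (\<lambda>\<sigma>. fst (snd (snd \<sigma>)))"
    by (rule l2norm_scaleR) measurable
  also have "\<dots> \<le> ennreal \<bar>s\<bar> * ennreal (sqrt (real i * DIM('a)))"
    by (intro mult_left_mono l2norm_walk_noise_sum) simp
  also have "l2norm ?Q ?G \<le> ennreal \<bar>- (s\<^sup>2 / 2)\<bar> * l2norm ?Q (\<lambda>\<sigma>. snd (snd (snd \<sigma>)))"
    by (rule l2norm_scaleR) measurable
  also have "\<dots> \<le> ennreal \<bar>- (s\<^sup>2 / 2)\<bar> * ennreal (real i * sqrt (M * DIM('a)))"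
    by (intro mult_left_mono l2norm_walk_gradient_sum) simp
  finally show ?thesis
    using assms(1,3) M_pos by (simp add: add.assoc flip: ennreal_mult ennreal_plus)
qed

text \<open>On the left stands the sum of \<open>\<nabla>f(v\<^sub>0) - \<nabla>f(v\<^sub>j)\<close> over \<open>j < i\<close>; the Lipschitz condition reduces each
  summand to the displacement of the walk at time \<open>j\<close>.\<close>

lemma walk_gradient_displacement:
  assumes "0 < s" and err: "\<And>j. j < i \<Longrightarrow> l2norm (walk s \<gamma> j) (walk_error s) \<le> ennreal \<epsilon>" and "0 \<le> \<epsilon>"
  shows "l2norm (walk s \<gamma> i) (\<lambda>\<sigma>. real i *\<^sub>R g (snd (fst \<sigma>)) - snd (snd (snd \<sigma>)))
    \<le> ennreal (M * (\<Sum>j<i. \<epsilon> + s * sqrt (real j * DIM('a)) + s\<^sup>2 / 2 * (real j * sqrt (M * DIM('a)))))"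
  using err
proof (induction i)
  case 0
  have "(\<integral>\<^sup>+ \<sigma>. ennreal ((norm (real 0 *\<^sub>R g (snd (fst \<sigma>)) - snd (snd (snd \<sigma>))))\<^sup>2) \<partial>walk s \<gamma> 0) = 0"
    by (subst nn_integral_walk_0) auto
  then show ?case unfolding l2norm_le_iff by (simp del: walk.simps)
next
  case (Suc i)
  define t where "t j = \<epsilon> + s * sqrt (real j * DIM('a)) + s\<^sup>2 / 2 * (real j * sqrt (M * DIM('a)))" for j
  have t: "0 \<le> t j" for j using assms(1,3) M_pos by (simp add: t_def)
  let ?Q = "walk s \<gamma> i"
  let ?D = "\<lambda>\<sigma>::('a \<times> 'a) \<times> 'a \<times> 'a \<times> 'a. g (snd (fst \<sigma>)) - g (fst (snd \<sigma>))"
  have "l2norm (walk s \<gamma> (Suc i)) (\<lambda>\<sigma>. real (Suc i) *\<^sub>R g (snd (fst \<sigma>)) - snd (snd (snd \<sigma>)))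
      = l2norm ?Q (\<lambda>\<sigma>. (real i *\<^sub>R g (snd (fst \<sigma>)) - snd (snd (snd \<sigma>))) + ?D \<sigma>)"
    by (rule l2norm_walk_Suc_past) (auto simp: walk_step_def case_prod_beta algebra_simps)
  also have "\<dots> \<le> l2norm ?Q (\<lambda>\<sigma>. real i *\<^sub>R g (snd (fst \<sigma>)) - snd (snd (snd \<sigma>))) + l2norm ?Q ?D"
    by (rule l2norm_triangle) measurable
  also have "l2norm ?Q ?D \<le> ennreal M * l2norm ?Q (\<lambda>\<sigma>. snd (fst \<sigma>) - fst (snd \<sigma>))"
    by (rule l2norm_mono) (use lipschitz M_pos in auto)
  also have "\<dots> \<le> ennreal M * ennreal (t i)"
    unfolding t_def by (intro mult_left_mono walk_displacement assms Suc.prems) auto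
  also have "l2norm ?Q (\<lambda>\<sigma>. real i *\<^sub>R g (snd (fst \<sigma>)) - snd (snd (snd \<sigma>))) \<le> ennreal (M * (\<Sum>j<i. t j))"
    unfolding t_def by (rule Suc.IH) (use Suc.prems in auto)
  finally show ?case
    using M_pos t unfolding t_def[symmetric]
    by (simp add: sum_nonneg distrib_left del: walk.simps flip: ennreal_mult ennreal_plus)
qed

text \<open>The discrete Gronwall argument for the recursion of \<open>metropolis_drift\<close>. The position is always
  distributed according to \<open>\<pi>\<close>, so the inhomogeneous term is the same constant in every step.\<close>

lemma walk_error_bound:
  assumes C: "0 \<le> C" and s: "0 < s"
    and drift: "\<And>v w. (\<integral>\<^sup>+ \<zeta>. ennreal ((norm (w + (metropolis s v (fst \<zeta>) (snd \<zeta>) - v - s *\<^sub>R fst \<zeta> + (s\<^sup>2 / 2) *\<^sub>R g v)))\<^sup>2) \<partial>noise)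
    \<le> ennreal ((1 + s\<^sup>2) * (norm w)\<^sup>2 + C * s ^ 3 * (1 + (norm (g v))\<^sup>2)\<^sup>2)"
    and G: "(\<integral>\<^sup>+ x. ennreal ((1 + (norm (g x))\<^sup>2)\<^sup>2) \<partial>\<pi>) = ennreal G" "0 \<le> G"
  shows "(\<integral>\<^sup>+ \<sigma>. ennreal ((norm (walk_error s \<sigma>))\<^sup>2) \<partial>walk s \<gamma> i) \<le> ennreal (C * s ^ 3 * G * real i * (1 + s\<^sup>2) ^ i)"
proof (induction i)
  case 0
  have "(\<integral>\<^sup>+ \<sigma>. ennreal ((norm (walk_error s \<sigma>))\<^sup>2) \<partial>walk s \<gamma> 0) = 0"
    by (subst nn_integral_walk_0) (auto simp: walk_error_def)
  then show ?case by simp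
next
  case (Suc i)
  have "(\<integral>\<^sup>+ \<sigma>. ennreal ((norm (walk_error s \<sigma>))\<^sup>2) \<partial>walk s \<gamma> (Suc i))
    = (\<integral>\<^sup>+ \<sigma>. \<integral>\<^sup>+ \<zeta>. ennreal ((norm (walk_error s (walk_step s (\<sigma>, \<zeta>))))\<^sup>2) \<partial>noise \<partial>walk s \<gamma> i)"
    by (rule nn_integral_walk_Suc) measurable
  also have "\<dots> \<le> (\<integral>\<^sup>+ \<sigma>. ennreal (1 + s\<^sup>2) * ennreal ((norm (walk_error s \<sigma>))\<^sup>2)
      + ennreal (C * s ^ 3) * ennreal ((1 + (norm (g (fst (snd \<sigma>))))\<^sup>2)\<^sup>2) \<partial>walk s \<gamma> i)"
  proof (rule nn_integral_mono)
    fix \<sigma> :: "('a \<times> 'a) \<times> 'a \<times> 'a \<times> 'a"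
    obtain c v S A where \<sigma>: "\<sigma> = (c, v, S, A)" by (metis prod.exhaust)
    have "walk_error s (walk_step s (\<sigma>, \<zeta>))
      = walk_error s \<sigma> + (metropolis s v (fst \<zeta>) (snd \<zeta>) - v - s *\<^sub>R fst \<zeta> + (s\<^sup>2 / 2) *\<^sub>R g v)" for \<zeta>
      by (cases \<zeta>) (simp add: \<sigma> walk_error_def walk_step_def algebra_simps)
    then have "(\<integral>\<^sup>+ \<zeta>. ennreal ((norm (walk_error s (walk_step s (\<sigma>, \<zeta>))))\<^sup>2) \<partial>noise)
      \<le> ennreal ((1 + s\<^sup>2) * (norm (walk_error s \<sigma>))\<^sup>2 + C * s ^ 3 * (1 + (norm (g v))\<^sup>2)\<^sup>2)"
      using drift[of "walk_error s \<sigma>" v] by simp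
    also have "\<dots> = ennreal (1 + s\<^sup>2) * ennreal ((norm (walk_error s \<sigma>))\<^sup>2) + ennreal (C * s ^ 3) * ennreal ((1 + (norm (g v))\<^sup>2)\<^sup>2)"
      using C s by (simp add: ennreal_mult)
    finally show "(\<integral>\<^sup>+ \<zeta>. ennreal ((norm (walk_error s (walk_step s (\<sigma>, \<zeta>))))\<^sup>2) \<partial>noise)
      \<le> ennreal (1 + s\<^sup>2) * ennreal ((norm (walk_error s \<sigma>))\<^sup>2)
      + ennreal (C * s ^ 3) * ennreal ((1 + (norm (g (fst (snd \<sigma>))))\<^sup>2)\<^sup>2)" by (simp add: \<sigma>)
  qed
  also have "\<dots> = ennreal (1 + s\<^sup>2) * (\<integral>\<^sup>+ \<sigma>. ennreal ((norm (walk_error s \<sigma>))\<^sup>2) \<partial>walk s \<gamma> i)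
      + ennreal (C * s ^ 3) * (\<integral>\<^sup>+ \<sigma>. ennreal ((1 + (norm (g (fst (snd \<sigma>))))\<^sup>2)\<^sup>2) \<partial>walk s \<gamma> i)"
    by (subst nn_integral_add) (auto simp: nn_integral_cmult)
  also have "(\<integral>\<^sup>+ \<sigma>. ennreal ((1 + (norm (g (fst (snd \<sigma>))))\<^sup>2)\<^sup>2) \<partial>walk s \<gamma> i) = ennreal G"
    unfolding G(1)[symmetric] by (rule walk_position) measurable
  also have "ennreal (1 + s\<^sup>2) * (\<integral>\<^sup>+ \<sigma>. ennreal ((norm (walk_error s \<sigma>))\<^sup>2) \<partial>walk s \<gamma> i) + ennreal (C * s ^ 3) * ennreal G
      \<le> ennreal (1 + s\<^sup>2) * ennreal (C * s ^ 3 * G * real i * (1 + s\<^sup>2) ^ i) + ennreal (C * s ^ 3) * ennreal G"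
    by (intro add_right_mono mult_left_mono Suc) simp
  also have "\<dots> = ennreal ((1 + s\<^sup>2) * (C * s ^ 3 * G * real i * (1 + s\<^sup>2) ^ i) + C * s ^ 3 * G)"
    using C s G(2) by (simp add: ennreal_mult)
  also have "\<dots> \<le> ennreal (C * s ^ 3 * G * real (Suc i) * (1 + s\<^sup>2) ^ Suc i)"
  proof (rule ennreal_leI)
    have "C * s ^ 3 * G * 1 \<le> C * s ^ 3 * G * (1 + s\<^sup>2) ^ Suc i"
      using C s G(2) by (intro mult_left_mono one_le_power) auto
    then show "(1 + s\<^sup>2) * (C * s ^ 3 * G * real i * (1 + s\<^sup>2) ^ i) + C * s ^ 3 * G
       \<le> C * s ^ 3 * G * real (Suc i) * (1 + s\<^sup>2) ^ Suc i"
      by (simp add: algebra_simps)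
  qed
  finally show ?case .
qed

end
end

section \<open>The Wasserstein bound for the chain\<close>

text \<open>The left Riemann sum of an increasing function is at most its integral.\<close>

lemma sum_sqrt_le: "(\<Sum>j<n. sqrt (real j)) \<le> 2 / 3 * (real n * sqrt (real n))"
proof (induction n)
  case 0
  then show ?case by simp
next
  case (Suc n)
  define a b where "a = sqrt (real n)" and "b = sqrt (real (Suc n))"
  have ab: "0 \<le> a" "a \<le> b" "a\<^sup>2 = real n" "b\<^sup>2 = a\<^sup>2 + 1" by (auto simp: a_def b_def)
  have "3 * a * (a + b) \<le> 2 * (a\<^sup>2 + a * b + b\<^sup>2)"
  proof -
    have "a * b \<le> b * b" "a * a \<le> b * b" using ab by (auto intro: mult_mono)
    then show ?thesis by (simp add: power2_eq_square algebra_simps)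
  qed
  then have "(b - a) * (3 * a * (a + b)) \<le> (b - a) * (2 * (a\<^sup>2 + a * b + b\<^sup>2))"
    using ab by (intro mult_left_mono) auto
  moreover have "(b - a) * (3 * a * (a + b)) = 3 * a * (b\<^sup>2 - a\<^sup>2)"
    by (simp add: power2_eq_square algebra_simps)
  moreover have "(b - a) * (2 * (a\<^sup>2 + a * b + b\<^sup>2)) = 2 * (b\<^sup>2 * b - a\<^sup>2 * a)"
    by (simp add: power2_eq_square algebra_simps)
  ultimately have "3 * a \<le> 2 * (b\<^sup>2 * b - a\<^sup>2 * a)" using ab(4) by simp
  moreover have "b\<^sup>2 = real (Suc n)" by (simp add: b_def)
  ultimately have "2 / 3 * (real n * a) + a \<le> 2 / 3 * (real (Suc n) * b)"
    using ab(3) by (simp add: mult.commute[of a])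
  then show ?case using Suc by (simp add: a_def b_def)
qed

lemma measure_eqI_nn_integral_indicator:
  assumes "sets M = sets N"
    and "\<And>A. A \<in> sets M \<Longrightarrow> (\<integral>\<^sup>+ x. indicator A x \<partial>M) = (\<integral>\<^sup>+ x. indicator A x \<partial>N)"
  shows "M = N"
proof (rule measure_eqI)
  fix A assume A: "A \<in> sets M"
  then have "A \<in> sets N" using assms(1) by simp
  then show "emeasure M A = emeasure N A" using assms(2)[OF A] A by simp
qed (rule assms(1))

context smooth_strongly_convex
begin

lemma gradient_fourth_moment:
  "\<exists>G\<ge>0. (\<integral>\<^sup>+ x. ennreal ((1 + (norm (g x))\<^sup>2)\<^sup>2) \<partial>\<pi>) = ennreal G"
proof -
  define A where "A = norm (g 0) + M"
  have A: "0 \<le> A" using M_pos by (simp add: A_def)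
  have "integrable \<pi> (\<lambda>x. (1 + (norm (g x))\<^sup>2)\<^sup>2)"
  proof (rule integrable_\<pi>[where C="(1 + A\<^sup>2)\<^sup>2" and k=4])
    fix x
    have "(norm (g x))\<^sup>2 \<le> (A * (1 + norm x))\<^sup>2"
      using norm_g_growth[of x] by (intro power_mono) (auto simp: A_def)
    moreover have "1 \<le> (1 + norm x)\<^sup>2" by (intro one_le_power) simp
    ultimately have "1 + (norm (g x))\<^sup>2 \<le> (1 + A\<^sup>2) * (1 + norm x)\<^sup>2"
      unfolding power_mult_distrib distrib_right mult_1 by linarith
    then have "(1 + (norm (g x))\<^sup>2)\<^sup>2 \<le> ((1 + A\<^sup>2) * (1 + norm x)\<^sup>2)\<^sup>2"
      by (intro power_mono) auto
    then show "\<bar>(1 + (norm (g x))\<^sup>2)\<^sup>2\<bar> \<le> (1 + A\<^sup>2)\<^sup>2 * (1 + norm x) ^ 4"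
      by (simp add: power_mult_distrib flip: power_mult)
  qed simp
  then have "(\<integral>\<^sup>+ x. ennreal ((1 + (norm (g x))\<^sup>2)\<^sup>2) \<partial>\<pi>) = ennreal (\<integral> x. (1 + (norm (g x))\<^sup>2)\<^sup>2 \<partial>\<pi>)"
    by (intro nn_integral_eq_integral) auto
  then show ?thesis by (intro exI[of _ "\<integral> x. (1 + (norm (g x))\<^sup>2)\<^sup>2 \<partial>\<pi>"]) simp
qed

text \<open>With \<open>s\<^sup>2 = 2 h / n\<close> the bound of \<open>walk_error_bound\<close> is at most \<open>C G s (2 h) exp (2 h)\<close>.\<close>

lemma walk_error_vanishes:
  assumes h: "0 < h" and \<epsilon>: "0 < \<epsilon>"
    and \<gamma>: "prob_space \<gamma>" "sets \<gamma> = sets (borel \<Otimes>\<^sub>M borel)" "distr \<gamma> borel snd = \<pi>"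
  shows "\<exists>n>0. \<forall>j\<le>n. l2norm (walk (sqrt (2 * h / real n)) \<gamma> j) (walk_error (sqrt (2 * h / real n))) \<le> ennreal \<epsilon>"
proof -
  obtain C where C: "0 \<le> C" and drift: "\<And>s v w. 0 < s \<Longrightarrow> s \<le> 1 \<Longrightarrow>
    (\<integral>\<^sup>+ \<zeta>. ennreal ((norm (w + (metropolis s v (fst \<zeta>) (snd \<zeta>) - v - s *\<^sub>R fst \<zeta> + (s\<^sup>2 / 2) *\<^sub>R g v)))\<^sup>2) \<partial>noise)
    \<le> ennreal ((1 + s\<^sup>2) * (norm w)\<^sup>2 + C * s ^ 3 * (1 + (norm (g v))\<^sup>2)\<^sup>2)"
    using metropolis_drift by blast
  obtain G where G: "0 \<le> G" "(\<integral>\<^sup>+ x. ennreal ((1 + (norm (g x))\<^sup>2)\<^sup>2) \<partial>\<pi>) = ennreal G"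
    using gradient_fourth_moment by blast
  define K where "K = C * G * (2 * h) * exp (2 * h)"
  have K: "0 \<le> K" using C G h by (simp add: K_def)
  \<comment> \<open>Step sizes \<open>s \<le> \<eta>\<close> are in the range of the drift estimate and satisfy \<open>K s \<le> \<epsilon>\<^sup>2\<close>.\<close>
  define \<eta> where "\<eta> = min 1 (\<epsilon>\<^sup>2 / (K + 1))"
  have \<eta>: "0 < \<eta>" "\<eta> \<le> 1" using \<epsilon> K by (auto simp: \<eta>_def)
  obtain n where n: "2 * h / \<eta>\<^sup>2 < real n" using reals_Archimedean2 by blast
  have n0: "0 < n"
  proof (rule ccontr)
    assume "\<not> 0 < n"
    then have "2 * h / \<eta>\<^sup>2 < 0" using n by simp
    moreover have "0 \<le> 2 * h / \<eta>\<^sup>2" using h by simp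
    ultimately show False by linarith
  qed
  define s where "s = sqrt (2 * h / real n)"
  have s2: "s\<^sup>2 = 2 * h / real n" using h by (simp add: s_def)
  have s0: "0 < s" using h n0 by (simp add: s_def)
  have "s\<^sup>2 \<le> \<eta>\<^sup>2" using n n0 \<eta> by (simp add: s2 field_simps)
  then have s\<eta>: "s \<le> \<eta>" using \<eta> by (elim power2_le_imp_le) auto
  have "l2norm (walk s \<gamma> j) (walk_error s) \<le> ennreal \<epsilon>" if j: "j \<le> n" for j
  proof -
    have "C * s ^ 3 * G * real j * (1 + s\<^sup>2) ^ j \<le> C * s ^ 3 * G * real n * exp (2 * h)"
    proof (intro mult_mono)
      have "(1 + s\<^sup>2) ^ j \<le> (1 + s\<^sup>2) ^ n" using j by (intro power_increasing) auto
      also have "\<dots> \<le> exp (s\<^sup>2) ^ n" by (intro power_mono exp_ge_add_one_self) auto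
      also have "\<dots> = exp (2 * h)" using n0 by (simp add: s2 flip: exp_of_nat_mult)
      finally show "(1 + s\<^sup>2) ^ j \<le> exp (2 * h)" .
    qed (use j C G s0 in auto)
    also have "\<dots> = K * s" 
    proof -
      have "s ^ 3 * real n = s * (s\<^sup>2 * real n)" by (simp add: power3_eq_cube power2_eq_square)
      also have "s\<^sup>2 * real n = 2 * h" using n0 by (simp add: s2)
      finally have "C * G * (s ^ 3 * real n) * exp (2 * h) = C * G * (s * (2 * h)) * exp (2 * h)" by simp
      then show ?thesis by (simp add: K_def mult_ac)
    qed
    also have "\<dots> \<le> K * (\<epsilon>\<^sup>2 / (K + 1))"
      using s\<eta> K by (intro mult_left_mono) (auto simp: \<eta>_def)
    also have "\<dots> \<le> \<epsilon>\<^sup>2" using K by (simp add: field_simps)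
    finally have "(\<integral>\<^sup>+ \<sigma>. ennreal ((norm (walk_error s \<sigma>))\<^sup>2) \<partial>walk s \<gamma> j) \<le> ennreal (\<epsilon>\<^sup>2)"
      using walk_error_bound[OF \<gamma> C s0 drift G(2,1), of j] s0 s\<eta> \<eta> by (meson ennreal_leI order_trans)
    then show ?thesis using \<epsilon> by (simp add: l2norm_le_iff ennreal_power)
  qed
  then show ?thesis using n0 unfolding s_def by blast
qed

text \<open>With the drift frozen at \<open>v\<^sub>0\<close>, the walk misses the Euler step of length \<open>h\<close> by \<open>walk_error\<close> plus
  \<open>h/n\<close> times the accumulated gradient differences. Their sum over \<open>j\<close> contributes
  \<open>(2/3 sqrt 2 + 1/2 sqrt (M h)) M h sqrt (h p)\<close>, which is at most \<open>1.67 M h sqrt (h p)\<close> as \<open>M h \<le> 2\<close>;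
  the number of steps is chosen such that everything else is at most \<open>0.15 M h sqrt (h p)\<close>.\<close>

lemma walk_endpoint:
  assumes h: "0 < h" "h < 2 / M"
    and \<gamma>: "prob_space \<gamma>" "sets \<gamma> = sets (borel \<Otimes>\<^sub>M borel)" "distr \<gamma> borel snd = \<pi>"
  shows "\<exists>n>0. l2norm (walk (sqrt (2 * h / real n)) \<gamma> n)
      (\<lambda>\<sigma>. fst (snd \<sigma>) - (snd (fst \<sigma>) - h *\<^sub>R g (snd (fst \<sigma>)) + sqrt (2 * h / real n) *\<^sub>R fst (snd (snd \<sigma>))))
    \<le> ennreal (1.82 * M * h * sqrt (h * DIM('a)))"
proof -
  define p where "p = real DIM('a)"
  have p: "0 < p" by (simp add: p_def)
  define H where "H = M * h * sqrt (h * p)"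
  have H: "0 < H" using h p M_pos by (simp add: H_def)
  define c where "c = 1 + M * h"
  define \<epsilon> where "\<epsilon> = (15 / 100 * H) / c"
  have c: "0 < c" using h M_pos by (simp add: c_def add_pos_pos)
  have "\<epsilon> * c = 15 / 100 * H" using c by (simp add: \<epsilon>_def)
  then have \<epsilon>: "0 < \<epsilon>" "\<epsilon> + M * h * \<epsilon> = 15 / 100 * H"
    using c H by (simp add: \<epsilon>_def, simp add: c_def algebra_simps)
  obtain n where n: "0 < n" and
    err: "\<And>j. j \<le> n \<Longrightarrow> l2norm (walk (sqrt (2 * h / real n)) \<gamma> j) (walk_error (sqrt (2 * h / real n))) \<le> ennreal \<epsilon>"
    using walk_error_vanishes[OF h(1) \<epsilon>(1) \<gamma>] by blast
  define s where "s = sqrt (2 * h / real n)"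
  note err = err[folded s_def]
  define \<delta> where "\<delta> = s\<^sup>2 / 2"
  have \<delta>: "real n * \<delta> = h" "0 \<le> \<delta>" using h n by (simp_all add: \<delta>_def s_def)
  have s0: "0 < s" using h n by (simp add: s_def)
  have [measurable_cong]: "sets \<gamma> = sets (borel \<Otimes>\<^sub>M borel)" by (rule \<gamma>)
  let ?Q = "walk s \<gamma> n"
  let ?B = "\<lambda>\<sigma>::('a \<times> 'a) \<times> 'a \<times> 'a \<times> 'a. real n *\<^sub>R g (snd (fst \<sigma>)) - snd (snd (snd \<sigma>))"
  define T where "T = (\<Sum>j<n. \<epsilon> + s * sqrt (real j * p) + \<delta> * (real j * sqrt (M * p)))"
  have T0: "0 \<le> T" unfolding T_def using \<epsilon>(1) s0 p M_pos \<delta>(2) by (intro sum_nonneg add_nonneg_nonneg mult_nonneg_nonneg) auto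
  have "l2norm ?Q (\<lambda>\<sigma>. fst (snd \<sigma>) - (snd (fst \<sigma>) - h *\<^sub>R g (snd (fst \<sigma>)) + s *\<^sub>R fst (snd (snd \<sigma>))))
      = l2norm ?Q (\<lambda>\<sigma>. walk_error s \<sigma> + \<delta> *\<^sub>R ?B \<sigma>)"
    by (intro arg_cong[where f="l2norm ?Q"])
       (auto simp: walk_error_def \<delta>_def[symmetric] scaleR_diff_right \<delta>(1)[unfolded mult.commute[of "real n"]] algebra_simps)
  also have "\<dots> \<le> l2norm ?Q (walk_error s) + l2norm ?Q (\<lambda>\<sigma>. \<delta> *\<^sub>R ?B \<sigma>)"
    by (rule l2norm_triangle) measurable
  also have "\<dots> \<le> ennreal \<epsilon> + ennreal \<bar>\<delta>\<bar> * l2norm ?Q ?B"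
    by (intro add_mono err l2norm_scaleR) auto
  also have "\<dots> \<le> ennreal \<epsilon> + ennreal \<bar>\<delta>\<bar> * ennreal (M * T)"
    unfolding T_def p_def \<delta>_def
    by (intro add_left_mono mult_left_mono walk_gradient_displacement \<gamma> s0 err) (use \<epsilon> in auto)
  also have "\<dots> = ennreal (\<epsilon> + \<delta> * (M * T))"
    using \<delta> M_pos T0 \<epsilon> by (simp flip: ennreal_mult)
  also have "\<dots> \<le> ennreal (1.82 * M * h * sqrt (h * p))"
  proof (rule ennreal_leI)
    have sum1: "(\<Sum>j<n. sqrt (real j * p)) \<le> 2 / 3 * (real n * sqrt (real n)) * sqrt p"
      using sum_sqrt_le[of n] p by (simp add: real_sqrt_mult mult_right_mono flip: sum_distrib_right)
    have sum2: "(\<Sum>j<n. real j) \<le> (real n)\<^sup>2 / 2"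
      by (induction n) (auto simp: power2_eq_square algebra_simps)
    have "T = real n * \<epsilon> + s * (\<Sum>j<n. sqrt (real j * p)) + \<delta> * sqrt (M * p) * (\<Sum>j<n. real j)"
      unfolding T_def by (simp add: sum.distrib sum_distrib_left sum_distrib_right mult_ac)
    also have "\<dots> \<le> real n * \<epsilon> + s * (2 / 3 * (real n * sqrt (real n)) * sqrt p) + \<delta> * sqrt (M * p) * ((real n)\<^sup>2 / 2)"
      using sum1 sum2 s0 \<delta> M_pos p by (intro add_mono mult_left_mono) auto
    finally have "\<delta> * (M * T) \<le> \<delta> * (M * (real n * \<epsilon> + s * (2 / 3 * (real n * sqrt (real n)) * sqrt p) + \<delta> * sqrt (M * p) * ((real n)\<^sup>2 / 2)))"
      using \<delta> M_pos by (intro mult_left_mono) auto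
    also have "\<dots> = M * ((real n * \<delta>) * \<epsilon>) + M * ((2 / 3) * (real n * \<delta>) * (s * sqrt (real n)) * sqrt p) + M * ((real n * \<delta>)\<^sup>2 / 2 * sqrt (M * p))"
      by (simp add: power2_eq_square algebra_simps)
    also have "s * sqrt (real n) = sqrt (2 * h)"
      using n by (simp add: s_def flip: real_sqrt_mult)
    also have "M * ((real n * \<delta>) * \<epsilon>) + M * ((2 / 3) * (real n * \<delta>) * sqrt (2 * h) * sqrt p) + M * ((real n * \<delta>)\<^sup>2 / 2 * sqrt (M * p))
        = M * h * \<epsilon> + 2 / 3 * sqrt 2 * H + (sqrt (M * h) / 2) * H"
    proof -
      have "h * sqrt (M * p) = sqrt (M * h) * sqrt (h * p)"
        using h by (simp add: real_sqrt_mult)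
      then have "M * (h\<^sup>2 / 2 * sqrt (M * p)) = (sqrt (M * h) / 2) * H"
        by (simp add: H_def power2_eq_square)
      moreover have "M * (2 / 3 * h * sqrt (2 * h) * sqrt p) = 2 / 3 * sqrt 2 * H"
        by (simp add: H_def real_sqrt_mult)
      ultimately show ?thesis unfolding \<delta>(1) by (simp only: mult.assoc)
    qed
    also have "\<dots> \<le> M * h * \<epsilon> + 2 / 3 * sqrt 2 * H + (sqrt 2 / 2) * H"
    proof -
      have "sqrt (M * h) \<le> sqrt 2" using h M_pos by (simp add: field_simps)
      then show ?thesis using H by (intro add_left_mono mult_right_mono) auto
    qed
    finally have "\<epsilon> + \<delta> * (M * T) \<le> 15 / 100 * H + 7 / 6 * sqrt 2 * H"
      using \<epsilon>(2) by (simp add: algebra_simps)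
    also have "\<dots> \<le> 15 / 100 * H + 167 / 100 * H"
    proof -
      have "sqrt 2 \<le> 143 / 100" by (rule real_le_lsqrt) (simp_all add: power2_eq_square)
      then show ?thesis using H by (intro add_left_mono mult_right_mono) auto
    qed
    also have "\<dots> = 1.82 * M * h * sqrt (h * p)" by (simp add: H_def)
    finally show "\<epsilon> + \<delta> * (M * T) \<le> 1.82 * M * h * sqrt (h * p)" .
  qed
  finally show ?thesis using n unfolding s_def p_def by blast
qed

definition langevin_step :: "real \<Rightarrow> 'a \<Rightarrow> 'a \<Rightarrow> 'a" where
  "langevin_step h x z = x - h *\<^sub>R g x + sqrt (2 * h) *\<^sub>R z"

lemma langevin_step_measurable [measurable (raw)]:
  assumes [measurable]: "X \<in> borel_measurable N" "Y \<in> borel_measurable N"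
  shows "(\<lambda>x. langevin_step h (X x) (Y x)) \<in> borel_measurable N"
  unfolding langevin_step_def by measurable

text \<open>Given a coupling \<open>\<gamma>\<close> of \<open>\<mu>\<close> and \<open>\<pi>\<close>, the new coupling pairs the Langevin step from the first
  component, driven by the summed increments of the Metropolis walk, with the end point of that walk
  started from the second component.\<close>

lemma wasserstein2_langevin_step:
  assumes h: "0 < h" "h < 2 / M"
    and \<mu>: "prob_space \<mu>" and sets_\<mu> [measurable_cong, simp]: "sets \<mu> = sets borel"
  shows "wasserstein2 (distr (\<mu> \<Otimes>\<^sub>M std_gauss) borel (\<lambda>(x, z). langevin_step h x z)) \<pi>
    \<le> ennreal (contraction_factor h) * wasserstein2 \<mu> \<pi> + ennreal (1.82 * M * h * sqrt (h * DIM('a)))"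
proof (rule wasserstein2_le_via_couplings)
  show "couplings \<mu> \<pi> \<noteq> {}"
    using couplings_nonempty[OF \<mu> prob_space_\<pi> sets_\<mu> sets_\<pi>] by blast
next
  fix \<gamma> assume "\<gamma> \<in> couplings \<mu> \<pi>"
  then have \<gamma>: "prob_space \<gamma>" "sets \<gamma> = sets (borel \<Otimes>\<^sub>M borel)" "distr \<gamma> borel snd = \<pi>"
    and fst_\<gamma>: "distr \<gamma> borel fst = \<mu>"
    by (auto simp: couplings_def)
  note [measurable_cong] = \<gamma>(2)
  interpret G: prob_space "std_gauss :: 'a measure" by (rule prob_space_std_gauss)
  obtain n where n: "0 < n" and endpoint: "l2norm (walk (sqrt (2 * h / real n)) \<gamma> n)
      (\<lambda>\<sigma>. fst (snd \<sigma>) - (snd (fst \<sigma>) - h *\<^sub>R g (snd (fst \<sigma>)) + sqrt (2 * h / real n) *\<^sub>R fst (snd (snd \<sigma>))))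
    \<le> ennreal (1.82 * M * h * sqrt (h * DIM('a)))"
    using walk_endpoint[OF h \<gamma>] by blast
  define s where "s = sqrt (2 * h / real n)"
  have s: "s * sqrt (real n) = sqrt (2 * h)" using n by (simp add: s_def flip: real_sqrt_mult)
  let ?Q = "walk s \<gamma> n"
  define X where "X \<sigma> = fst (fst \<sigma>) - h *\<^sub>R g (fst (fst \<sigma>)) + s *\<^sub>R fst (snd (snd \<sigma>))" for \<sigma> :: "('a \<times> 'a) \<times> 'a \<times> 'a \<times> 'a"
  have [measurable]: "X \<in> borel_measurable state_space" unfolding X_def by measurable
  define \<gamma>' where "\<gamma>' = distr ?Q (borel \<Otimes>\<^sub>M borel) (\<lambda>\<sigma>. (X \<sigma>, fst (snd \<sigma>)))"
  have "\<gamma>' \<in> couplings (distr (\<mu> \<Otimes>\<^sub>M std_gauss) borel (\<lambda>(x, z). langevin_step h x z)) \<pi>"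
    unfolding couplings_def
  proof (intro CollectI conjI)
    interpret Q: prob_space ?Q by (rule prob_space_walk[OF \<gamma>])
    show "prob_space \<gamma>'" unfolding \<gamma>'_def by (rule Q.prob_space_distr) measurable
    show "sets \<gamma>' = sets (borel \<Otimes>\<^sub>M borel)" by (simp add: \<gamma>'_def)
    show "distr \<gamma>' borel fst = distr (\<mu> \<Otimes>\<^sub>M std_gauss) borel (\<lambda>(x, z). langevin_step h x z)"
    proof (rule measure_eqI_nn_integral_indicator)
      fix A assume "A \<in> sets (distr \<gamma>' borel fst)"
      then have [measurable]: "A \<in> sets borel" by simp
      have "(\<integral>\<^sup>+ x. indicator A x \<partial>distr \<gamma>' borel fst) = (\<integral>\<^sup>+ \<sigma>. indicator A (X \<sigma>) \<partial>?Q)"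
        unfolding \<gamma>'_def by (subst nn_integral_distr, measurable, subst nn_integral_distr) auto
      also have "\<dots> = (\<integral>\<^sup>+ c. \<integral>\<^sup>+ z. indicator A (fst c - h *\<^sub>R g (fst c) + s *\<^sub>R (sqrt (real n) *\<^sub>R z)) \<partial>std_gauss \<partial>\<gamma>)"
        unfolding X_def by (rule walk_noise_sum[OF \<gamma>]) measurable
      also have "\<dots> = (\<integral>\<^sup>+ c. \<integral>\<^sup>+ z. indicator A (langevin_step h (fst c) z) \<partial>std_gauss \<partial>\<gamma>)"
        by (simp add: s langevin_step_def)
      also have "\<dots> = (\<integral>\<^sup>+ x. \<integral>\<^sup>+ z. indicator A (langevin_step h x z) \<partial>std_gauss \<partial>\<mu>)"
        unfolding fst_\<gamma>[symmetric] by (subst nn_integral_distr) auto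
      also have "\<dots> = (\<integral>\<^sup>+ x. indicator A x \<partial>distr (\<mu> \<Otimes>\<^sub>M std_gauss) borel (\<lambda>(x, z). langevin_step h x z))"
        by (subst nn_integral_distr, measurable, subst G.nn_integral_fst[symmetric]) auto
      finally show "(\<integral>\<^sup>+ x. indicator A x \<partial>distr \<gamma>' borel fst)
        = (\<integral>\<^sup>+ x. indicator A x \<partial>distr (\<mu> \<Otimes>\<^sub>M std_gauss) borel (\<lambda>(x, z). langevin_step h x z))" .
    qed simp
    show "distr \<gamma>' borel snd = \<pi>"
    proof (rule measure_eqI_nn_integral_indicator)
      fix A assume "A \<in> sets (distr \<gamma>' borel snd)"
      then have [measurable]: "A \<in> sets borel" by simp
      have "(\<integral>\<^sup>+ x. indicator A x \<partial>distr \<gamma>' borel snd) = (\<integral>\<^sup>+ \<sigma>. indicator A (fst (snd \<sigma>)) \<partial>?Q)"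
        unfolding \<gamma>'_def by (subst nn_integral_distr, measurable, subst nn_integral_distr) auto
      also have "\<dots> = (\<integral>\<^sup>+ x. indicator A x \<partial>\<pi>)" by (rule walk_position[OF \<gamma>]) measurable
      finally show "(\<integral>\<^sup>+ x. indicator A x \<partial>distr \<gamma>' borel snd) = (\<integral>\<^sup>+ x. indicator A x \<partial>\<pi>)" .
    qed simp
  qed
  then have "wasserstein2 (distr (\<mu> \<Otimes>\<^sub>M std_gauss) borel (\<lambda>(x, z). langevin_step h x z)) \<pi>
      \<le> l2norm \<gamma>' (\<lambda>z. fst z - snd z)" by (rule wasserstein2_le_coupling)
  also have "\<dots> = l2norm ?Q (\<lambda>\<sigma>. X \<sigma> - fst (snd \<sigma>))"
    unfolding \<gamma>'_def by (subst l2norm_distr) auto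
  also have "\<dots> = l2norm ?Q (\<lambda>\<sigma>. ((fst (fst \<sigma>) - h *\<^sub>R g (fst (fst \<sigma>))) - (snd (fst \<sigma>) - h *\<^sub>R g (snd (fst \<sigma>))))
      + - (fst (snd \<sigma>) - (snd (fst \<sigma>) - h *\<^sub>R g (snd (fst \<sigma>)) + s *\<^sub>R fst (snd (snd \<sigma>)))))"
    by (intro arg_cong[where f="l2norm ?Q"]) (auto simp: X_def)
  also have "\<dots> \<le> l2norm ?Q (\<lambda>\<sigma>. (fst (fst \<sigma>) - h *\<^sub>R g (fst (fst \<sigma>))) - (snd (fst \<sigma>) - h *\<^sub>R g (snd (fst \<sigma>))))
      + l2norm ?Q (\<lambda>\<sigma>. - (fst (snd \<sigma>) - (snd (fst \<sigma>) - h *\<^sub>R g (snd (fst \<sigma>)) + s *\<^sub>R fst (snd (snd \<sigma>)))))"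
    by (rule l2norm_triangle) measurable
  also have "\<dots> \<le> ennreal (contraction_factor h) * l2norm ?Q (\<lambda>\<sigma>. fst (fst \<sigma>) - snd (fst \<sigma>))
      + ennreal (1.82 * M * h * sqrt (h * DIM('a)))"
  proof (rule add_mono)
    show "l2norm ?Q (\<lambda>\<sigma>. (fst (fst \<sigma>) - h *\<^sub>R g (fst (fst \<sigma>))) - (snd (fst \<sigma>) - h *\<^sub>R g (snd (fst \<sigma>))))
        \<le> ennreal (contraction_factor h) * l2norm ?Q (\<lambda>\<sigma>. fst (fst \<sigma>) - snd (fst \<sigma>))"
    proof (rule l2norm_mono)
      show "norm ((fst (fst \<sigma>) - h *\<^sub>R g (fst (fst \<sigma>))) - (snd (fst \<sigma>) - h *\<^sub>R g (snd (fst \<sigma>))))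
        \<le> contraction_factor h * norm (fst (fst \<sigma>) - snd (fst \<sigma>))" for \<sigma> :: "('a \<times> 'a) \<times> 'a \<times> 'a \<times> 'a"
        by (rule gradient_step_contraction[OF h])
    qed (use contraction_factor_bounds[OF h] in auto)
    show "l2norm ?Q (\<lambda>\<sigma>. - (fst (snd \<sigma>) - (snd (fst \<sigma>) - h *\<^sub>R g (snd (fst \<sigma>)) + s *\<^sub>R fst (snd (snd \<sigma>)))))
       \<le> ennreal (1.82 * M * h * sqrt (h * DIM('a)))"
      unfolding l2norm_minus s_def by (rule endpoint)
  qed
  also have "l2norm ?Q (\<lambda>\<sigma>. fst (fst \<sigma>) - snd (fst \<sigma>)) = l2norm \<gamma> (\<lambda>c. fst c - snd c)"
    unfolding l2norm_def
    by (subst walk_noise_sum[OF \<gamma>, of "\<lambda>c S. ennreal ((norm (fst c - snd c))\<^sup>2)"])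
       (auto simp: G.emeasure_space_1[simplified])
  finally show "wasserstein2 (distr (\<mu> \<Otimes>\<^sub>M std_gauss) borel (\<lambda>(x, z). langevin_step h x z)) \<pi>
    \<le> ennreal (contraction_factor h) * l2norm \<gamma> (\<lambda>z. fst z - snd z) + ennreal (1.82 * M * h * sqrt (h * DIM('a)))" .
qed

lemma wasserstein2_langevin_iterates:
  fixes \<nu> :: "nat \<Rightarrow> 'a measure"
  assumes h: "0 < h" "h < 2 / M"
    and \<nu>: "\<And>k. prob_space (\<nu> k)" "\<And>k. sets (\<nu> k) = sets borel"
    and step: "\<And>k. \<nu> (Suc k) = distr (\<nu> k \<Otimes>\<^sub>M std_gauss) borel (\<lambda>(x, z). langevin_step h x z)"
  shows "wasserstein2 (\<nu> K) \<pi> \<le> ennreal (contraction_factor h ^ K) * wasserstein2 (\<nu> 0) \<pi>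
    + ennreal (1.82 * M * h * sqrt (h * DIM('a)) / (1 - contraction_factor h))"
proof (induction K)
  case 0
  then show ?case by (simp add: add_increasing2)
next
  case (Suc K)
  define \<rho> where "\<rho> = contraction_factor h"
  define E where "E = 1.82 * M * h * sqrt (h * DIM('a))"
  have \<rho>: "0 \<le> \<rho>" "\<rho> < 1" using contraction_factor_bounds[OF h] by (auto simp: \<rho>_def)
  have E: "0 \<le> E" using M_pos h by (simp add: E_def)
  have "wasserstein2 (\<nu> (Suc K)) \<pi> \<le> ennreal \<rho> * wasserstein2 (\<nu> K) \<pi> + ennreal E"
    unfolding step \<rho>_def E_def by (rule wasserstein2_langevin_step[OF h \<nu>])
  also have "\<dots> \<le> ennreal \<rho> * (ennreal (\<rho> ^ K) * wasserstein2 (\<nu> 0) \<pi> + ennreal (E / (1 - \<rho>))) + ennreal E"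
    using Suc by (intro add_right_mono mult_left_mono) (auto simp: \<rho>_def E_def)
  also have "\<dots> = ennreal (\<rho> ^ Suc K) * wasserstein2 (\<nu> 0) \<pi> + ennreal (\<rho> * (E / (1 - \<rho>)) + E)"
  proof -
    have "ennreal (\<rho> * (E / (1 - \<rho>)) + E) = ennreal \<rho> * ennreal (E / (1 - \<rho>)) + ennreal E"
      using \<rho> E by (simp flip: ennreal_mult)
    moreover have "ennreal (\<rho> ^ Suc K) = ennreal \<rho> * ennreal (\<rho> ^ K)"
      using \<rho> by (simp flip: ennreal_mult)
    ultimately show ?thesis by (simp only: distrib_left mult.assoc add.assoc)
  qed
  also have "\<rho> * (E / (1 - \<rho>)) + E = E / (1 - \<rho>)" using \<rho> by (simp add: field_simps)
  finally show ?case by (simp add: \<rho>_def E_def)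
qed

end

text \<open>The \<open>k\<close>-th iterate is a function of \<open>X 0, \<dots>, X k\<close> alone, hence independent of \<open>X (Suc k)\<close>; so the
  laws of the iterates follow the one-step kernel.\<close>

lemma (in prob_space) distr_iterated_random_map:
  fixes X Y :: "nat \<Rightarrow> 'a \<Rightarrow> 'b::second_countable_topology"
  assumes indep: "indep_vars (\<lambda>_. borel) X UNIV"
    and F [measurable]: "(\<lambda>(x, z). F x z) \<in> borel_measurable (borel \<Otimes>\<^sub>M borel)"
    and Y0: "\<And>\<omega>. \<omega> \<in> space M \<Longrightarrow> Y 0 \<omega> = X 0 \<omega>"
    and YS: "\<And>k \<omega>. \<omega> \<in> space M \<Longrightarrow> Y (Suc k) \<omega> = F (Y k \<omega>) (X (Suc k) \<omega>)"
  shows "Y k \<in> borel_measurable M"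
    and "distr M borel (Y (Suc k)) = distr (distr M borel (Y k) \<Otimes>\<^sub>M distr M borel (X (Suc k))) borel (\<lambda>(x, z). F x z)"
proof -
  define \<Phi> :: "nat \<Rightarrow> (nat \<Rightarrow> 'b) \<Rightarrow> 'b" where
    "\<Phi> = rec_nat (\<lambda>w. w 0) (\<lambda>k \<phi> w. F (\<phi> w) (w (Suc k)))"
  have \<Phi>_simps: "\<Phi> 0 w = w 0" "\<Phi> (Suc k) w = F (\<Phi> k w) (w (Suc k))" for k w
    by (simp_all add: \<Phi>_def)
  have X [measurable]: "X k \<in> borel_measurable M" for k using indep by (auto simp: indep_vars_def)
  have \<Phi>_meas: "\<Phi> k \<in> borel_measurable (PiM I (\<lambda>_. borel))" if "{..k} \<subseteq> I" for k I
    using that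
  proof (induction k)
    case 0
    then show ?case by (simp add: \<Phi>_simps[abs_def] measurable_component_singleton)
  next
    case (Suc k)
    have I: "{..k} \<subseteq> I" "Suc k \<in> I" using Suc.prems by (auto simp: subset_iff)
    note [measurable] = Suc.IH[OF I(1)] measurable_component_singleton[OF I(2)]
    have "(\<lambda>w. (\<lambda>(x, z). F x z) (\<Phi> k w, w (Suc k))) \<in> borel_measurable (PiM I (\<lambda>_. borel))"
      by measurable
    then show ?case by (simp add: \<Phi>_simps[abs_def])
  qed
  have \<Phi>_eq: "\<Phi> k (\<lambda>i\<in>I. X i \<omega>) = Y k \<omega>" if "{..k} \<subseteq> I" "\<omega> \<in> space M" for k \<omega> I
    using that by (induction k) (auto simp: \<Phi>_simps Y0 YS atMost_Suc)
  define U where "U k = \<Phi> k \<circ> (\<lambda>\<omega>. \<lambda>i\<in>{..k}. X i \<omega>)" for k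
  have U: "U k \<omega> = Y k \<omega>" if "\<omega> \<in> space M" for k \<omega>
    using \<Phi>_eq[of k "{..k}" \<omega>] that by (simp add: U_def)
  have ind: "indep_var borel (U k) borel ((\<lambda>w. w (Suc k)) \<circ> (\<lambda>\<omega>. \<lambda>i\<in>{Suc k}. X i \<omega>))" for k
    unfolding U_def
  proof (rule indep_var_compose[OF indep_var_restrict[OF indep]])
    show "\<Phi> k \<in> borel_measurable (PiM {..k} (\<lambda>_. borel))" by (rule \<Phi>_meas) simp
    show "(\<lambda>w. w (Suc k)) \<in> borel_measurable (PiM {Suc k} (\<lambda>_. borel))"
      by (rule measurable_component_singleton) simp
  qed auto
  have o: "(\<lambda>w. w (Suc k)) \<circ> (\<lambda>\<omega>. \<lambda>i\<in>{Suc k}. X i \<omega>) = X (Suc k)" for k by auto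
  have meas: "Y k \<in> borel_measurable M" for k
    using indep_var_rv1[OF ind[of k]] by (subst measurable_cong[OF U[symmetric]])
  then show "Y k \<in> borel_measurable M" .
  have [measurable]: "U k \<in> borel_measurable M" using indep_var_rv1[OF ind] .
  have "distr M borel (Y (Suc k)) = distr M borel (\<lambda>\<omega>. (\<lambda>(x, z). F x z) (U k \<omega>, X (Suc k) \<omega>))"
    by (rule distr_cong) (auto simp: YS U)
  also have "\<dots> = distr (distr M (borel \<Otimes>\<^sub>M borel) (\<lambda>\<omega>. (U k \<omega>, X (Suc k) \<omega>))) borel (\<lambda>(x, z). F x z)"
    by (subst distr_distr) (auto simp: o_def)
  also have "distr M (borel \<Otimes>\<^sub>M borel) (\<lambda>\<omega>. (U k \<omega>, X (Suc k) \<omega>)) = distr M borel (U k) \<Otimes>\<^sub>M distr M borel (X (Suc k))"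
    using ind[of k] unfolding o indep_var_distribution_eq by simp
  also have "distr M borel (U k) = distr M borel (Y k)"
    by (rule distr_cong) (auto simp: U)
  finally show "distr M borel (Y (Suc k)) = distr (distr M borel (Y k) \<Otimes>\<^sub>M distr M borel (X (Suc k))) borel (\<lambda>(x, z). F x z)" .
qed

lemma density_mvnormal_standard:
  "density lborel (\<lambda>x. ennreal (mvnormal_density 0 (mat 1) x)) = (std_gauss :: (real ^ 'p) measure)"
  by (simp add: std_gauss_def gauss_density_def mvnormal_density_standard)

theorem theorem1:
  fixes f :: "real ^ 'p \<Rightarrow> real" and gradf :: "real ^ 'p \<Rightarrow> real ^ 'p"
    and m M h :: real
    and P :: "'w measure"
    and \<theta>0 :: "'w \<Rightarrow> real ^ 'p"
    and \<xi> \<theta> :: "nat \<Rightarrow> 'w \<Rightarrow> real ^ 'p"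
  assumes "0 < m" and "m \<le> M"
    and gradient: "\<And>x. GDERIV f x :> gradf x"
    and strongly_convex: "\<And>x y. f x - f y - gradf y \<bullet> (x - y) \<ge> m / 2 * (norm (x - y))\<^sup>2"
    and lipschitz_gradient: "\<And>x y. norm (gradf x - gradf y) \<le> M * norm (x - y)"
    and "0 < h" and "h < 2 / M"
    and "prob_space P"
    and gaussian: "\<And>k. k \<ge> 1 \<Longrightarrow> distributed P lborel (\<xi> k) (\<lambda>x. ennreal (mvnormal_density 0 (mat 1) x))"
    and independent: "prob_space.indep_vars P (\<lambda>_. borel) (\<lambda>k. if k = 0 then \<theta>0 else \<xi> k) (UNIV :: nat set)"
    and init: "\<And>\<omega>. \<omega> \<in> space P \<Longrightarrow> \<theta> 0 \<omega> = \<theta>0 \<omega>"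
    and step: "\<And>k \<omega>. \<omega> \<in> space P \<Longrightarrow>
      \<theta> (Suc k) \<omega> = \<theta> k \<omega> - h *\<^sub>R gradf (\<theta> k \<omega>) + sqrt (2 * h) *\<^sub>R \<xi> (Suc k) \<omega>"
  shows "\<forall>K::nat.
    (h \<le> 2 / (m + M) \<longrightarrow>
      wasserstein2 (distr P borel (\<theta> K)) (gibbs_measure f)
        \<le> ennreal ((1 - m * h) ^ K) * wasserstein2 (distr P borel (\<theta> 0)) (gibbs_measure f)
          + ennreal (1.82 * (M / m) * sqrt (h * real CARD('p)))) \<and>
    (h \<ge> 2 / (m + M) \<longrightarrow>
      wasserstein2 (distr P borel (\<theta> K)) (gibbs_measure f)
        \<le> ennreal ((M * h - 1) ^ K) * wasserstein2 (distr P borel (\<theta> 0)) (gibbs_measure f)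
          + ennreal (1.82 * (M * h / (2 - M * h)) * sqrt (h * real CARD('p))))"
proof -
  interpret P: prob_space P by fact
  interpret smooth_strongly_convex f gradf m M
    by unfold_locales (fact assms(1), fact assms(2), fact gradient, fact strongly_convex, fact lipschitz_gradient)
  have \<xi>: "distr P borel (\<xi> (Suc k)) = std_gauss" for k
  proof -
    have "distr P borel (\<xi> (Suc k)) = distr P lborel (\<xi> (Suc k))" by (rule distr_cong) auto
    also have "\<dots> = density lborel (\<lambda>x. ennreal (mvnormal_density 0 (mat 1) x))"
      using gaussian[of "Suc k"] by (intro distributed_distr_eq_density) simp
    finally show ?thesis by (simp only: density_mvnormal_standard)
  qed
  define X where "X k = (if k = 0 then \<theta>0 else \<xi> k)" for k
  have indep: "P.indep_vars (\<lambda>_. borel) X UNIV" using independent by (simp add: X_def[abs_def])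
  have F: "(\<lambda>(x, z). langevin_step h x z) \<in> borel_measurable (borel \<Otimes>\<^sub>M borel)" by measurable
  have Y0: "\<theta> 0 \<omega> = X 0 \<omega>" if "\<omega> \<in> space P" for \<omega> using init[OF that] by (simp add: X_def)
  have YS: "\<theta> (Suc k) \<omega> = langevin_step h (\<theta> k \<omega>) (X (Suc k) \<omega>)" if "\<omega> \<in> space P" for k \<omega>
    using step[OF that, of k] by (simp add: X_def langevin_step_def)
  note iter = P.distr_iterated_random_map[OF indep F Y0 YS]
  have main: "wasserstein2 (distr P borel (\<theta> K)) (gibbs_measure f)
    \<le> ennreal (contraction_factor h ^ K) * wasserstein2 (distr P borel (\<theta> 0)) (gibbs_measure f)
      + ennreal (1.82 * M * h * sqrt (h * real CARD('p)) / (1 - contraction_factor h))" for K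
  proof -
    have "wasserstein2 (distr P borel (\<theta> K)) \<pi>
      \<le> ennreal (contraction_factor h ^ K) * wasserstein2 (distr P borel (\<theta> 0)) \<pi>
        + ennreal (1.82 * M * h * sqrt (h * real DIM(real ^ 'p)) / (1 - contraction_factor h))"
    proof (rule wasserstein2_langevin_iterates[where \<nu>="\<lambda>k. distr P borel (\<theta> k)"])
      show "distr P borel (\<theta> (Suc k)) = distr (distr P borel (\<theta> k) \<Otimes>\<^sub>M std_gauss) borel (\<lambda>(x, z). langevin_step h x z)" for k
        using iter(2)[of k] by (simp add: X_def \<xi>)
    qed (auto intro!: P.prob_space_distr iter(1) assms(6,7))
    then show ?thesis by (simp add: \<pi>_def)
  qed
  show ?thesis
  proof (intro allI conjI impI)
    fix K
    assume "h \<le> 2 / (m + M)"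
    then have "contraction_factor h = 1 - m * h" by (simp add: contraction_factor_def)
    moreover have "1.82 * M * h * sqrt (h * real CARD('p)) / (m * h) = 1.82 * (M / m) * sqrt (h * real CARD('p))"
      using \<open>0 < h\<close> by simp
    ultimately show "wasserstein2 (distr P borel (\<theta> K)) (gibbs_measure f)
        \<le> ennreal ((1 - m * h) ^ K) * wasserstein2 (distr P borel (\<theta> 0)) (gibbs_measure f)
          + ennreal (1.82 * (M / m) * sqrt (h * real CARD('p)))"
      using main[of K] by simp
  next
    fix K
    assume ge: "h \<ge> 2 / (m + M)"
    have \<rho>: "contraction_factor h = M * h - 1"
    proof (cases "h = 2 / (m + M)")
      case True
      have "m + M \<noteq> 0" using m_pos M_pos by simp
      then have "h * (m + M) = 2" using True by (metis nonzero_eq_divide_eq)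
      then have "1 - m * h = M * h - 1" by (simp add: algebra_simps)
      moreover have "h \<le> 2 / (m + M)" using True by simp
      ultimately show ?thesis by (simp add: contraction_factor_def)
    qed (use ge in \<open>simp add: contraction_factor_def\<close>)
    have "1 - (M * h - 1) = 2 - M * h" by simp
    then show "wasserstein2 (distr P borel (\<theta> K)) (gibbs_measure f)
        \<le> ennreal ((M * h - 1) ^ K) * wasserstein2 (distr P borel (\<theta> 0)) (gibbs_measure f)
          + ennreal (1.82 * (M * h / (2 - M * h)) * sqrt (h * real CARD('p)))"
      using main[of K] unfolding \<rho> by (simp add: mult.assoc)
  qed
qed

end
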